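(* The family $(\mathcal K_{\delta,0})_{\delta\in[0,\tilde\delta_0]}$ is uniformly bounded in $\mathcal L(L^p(D;\mathbb R^q);L^p(D;\mathbb R^q))$ for all $p\in[1,\infty]$. Moreover, for all $p\in[1,\infty)$, $$\lim_{\delta\to0}\|\mathcal K_{\delta,0}f-f\|_{L^p(D;\mathbb R^q)}=0\quad\forall f\in L^p(D;\mathbb R^q),$$ and (with $d=3$) $$\lim_{\delta\to0}\|\nabla(\mathcal K^{\mathrm g}_{\delta,0}f-f)\|_{\mathbf L^p(D)}=0\quad\forall f\in\widetilde Z^{\mathrm g,p}(D),$$ $$\lim_{\delta\to0}\|\nabla\times(\mathcal K^{\mathrm c}_{\delta,0}\mathbf g-\mathbf g)\|_{\mathbf L^p(D)}=0\quad\forall\mathbf g\in\widetilde{\mathbf Z}^{\mathrm c,p}(D),$$ $$\lim_{\delta\to0}\|\nabla\cdot(\mathcal K^{\mathrm d}_{\delta,0}\mathbf g-\mathbf g)\|_{L^p(D)}=0\quad\forall\mathbf g\in\widetilde{\mathbf Z}^{\mathrm d,p}(D).$$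
   Context: $D\subset\mathbb R^d$ is an open, bounded, connected, strongly Lipschitz set. $\mathbf L^p=L^p(\cdot;\mathbb R^d)$. $B(\mathbf x,\rho)$ is the open Euclidean ball, $\|\cdot\|_{\ell^2}$ the Euclidean norm and induced norm on matrices and multilinear maps. Let $\mathbf x_D\in\mathbb R^d$, $r_D>0$ with $D\subset B(\mathbf x_D,r_D)$ be such that $\mathcal O:=B(\mathbf x_D,r_D)\setminus\overline D$ is a bounded open strongly Lipschitz set with $\partial D\subset\partial\mathcal O$. Let $\mathbf k\in C^\infty(\mathbb R^d;\mathbb R^d)$ be a fixed vector field, globally transversal for $\mathcal O$ and pointing outward $D$ (there is $\gamma>0$ with $-\mathbf n_{\mathcal O}\cdot\mathbf k\ge\gamma$ a.e. on $\partial\mathcal O$, $\mathbf n_{\mathcal O}$ the outward unit normal of $\mathcal O$), with $\|\mathbf k\|_{\ell^2}=1$ on $\partial\mathcal O$. Set $\boldsymbol\vartheta_\delta(\mathbf x)=\mathbf x+\delta\,\mathbf k(\mathbf x)$ and let $\zeta>0$ be fixed such that $\boldsymbol\vartheta_\delta(\mathcal O)+B(\mathbf 0,3\delta\zeta)\subset\mathcal O$ for all $\delta\in[0,1]$ (for $\delta=0$ the ball is understood as $\{\mathbf 0\}$). Let $\mathbb K_\delta(\mathbf x)$ be the Jacobian matrix of $\boldsymbol\vartheta_\delta$ at $\mathbf x\in D$, and let $\tilde\delta_0\in(0,1]$ be such that $\|\mathbb K_\delta-\mathbb I\|_{\ell^2}\le\frac12$, $\|\mathbb K_\delta^{-1}\|_{\ell^2}\le2$,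 $|\det(\mathbb K_\delta^{-1})|\le2^d$ on $D$ for all $\delta\in[0,\tilde\delta_0]$. The kernel is $\rho(\mathbf y)=\eta\exp\left(-\frac{1}{1-\|\mathbf y\|_{\ell^2}^2}\right)$ if $\|\mathbf y\|_{\ell^2}<1$, $0$ otherwise, with $\eta$ such that $\int_{\mathbb R^d}\rho=1$. For a function $g$ on $D$, $\widetilde g$ denotes its extension by zero to $\mathbb R^d$. Let $q\ge1$ be an integer and, for $\delta\in[0,1]$, let $\mathbb B_\delta:D\to\mathbb R^{q\times q}$ be a smooth field such that for all $l\in\mathbb N$ there is $c$ (independent of $\delta$) with $\sup_{\mathbf x\in D}\|D^l(\mathbb B_\delta(\mathbf x)-\mathbb I)\|_{\ell^2}\le c\,\delta$. For $\mathbf x\in D$, $f\in L^1(D)$, $g\in L^1(D;\mathbb R^q)$, define $$(\mathcal K_{\delta,0}^{\mathrm g}f)(\mathbf x)=\int_{B(\mathbf 0,1)}\rho(\mathbf y)\widetilde f(\boldsymbol\vartheta_\delta(\mathbf x)+\delta\zeta\mathbf y)\,d\mathbf y,\qquad(\mathcal K_{\delta,0}g)(\mathbf x)=\mathbb B_\delta(\mathbf x)(\mathcal K_{\delta,0}^{\mathrm g}g_1(\mathbf x),\dots,\mathcal K_{\delta,0}^{\mathrm g}g_q(\mathbf x))^{\mathsf T}.$$ $\mathcal K_{\delta,0}^{\mathrm c}$ and $\mathcal K_{\delta,0}^{\mathrm d}$ denote $\mathcal K_{\delta,0}$ with $q=d$ and $\mathbb B_\delta=\mathbb K_\delta^{\mathsf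 T}$, respectively $\mathbb B_\delta=\det(\mathbb K_\delta)\mathbb K_\delta^{-1}$. Spaces ($d=3$, derivatives in the distribution sense on $\mathbb R^3$): $\widetilde Z^{\mathrm g,p}(D)=\{f\in L^p(D):\nabla\widetilde f\in\mathbf L^p(\mathbb R^d)\}$, $\widetilde{\mathbf Z}^{\mathrm c,p}(D)=\{\mathbf v\in\mathbf L^p(D):\nabla\times\widetilde{\mathbf v}\in\mathbf L^p(\mathbb R^d)\}$, $\widetilde{\mathbf Z}^{\mathrm d,p}(D)=\{\mathbf v\in\mathbf L^p(D):\nabla\cdot\widetilde{\mathbf v}\in L^p(\mathbb R^d)\}$. *)

theory Defs
  imports "HOL-Analysis.Analysis" "HOL-Probability.Essential_Supremum"
begin

section \<open>Smooth functions and norms of higher derivatives\<close>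

text \<open>\<open>iter_deriv f [h\<^sub>1, \<dots>, h\<^sub>l] x\<close> is the value of the multilinear map \<open>D\<^sup>l f(x)\<close> at
  \<open>(h\<^sub>1, \<dots>, h\<^sub>l)\<close>.\<close>

primrec iter_deriv ::
  "('a::euclidean_space \<Rightarrow> 'b::euclidean_space) \<Rightarrow> 'a list \<Rightarrow> 'a \<Rightarrow> 'b" where
  "iter_deriv f [] = f"
| "iter_deriv f (h # hs) = (\<lambda>x. frechet_derivative (iter_deriv f hs) (at x) h)"

text \<open>Class \<open>C\<^sup>\<infinity>\<close> on an open set.\<close>

definition smooth_on :: "'a::euclidean_space set \<Rightarrow> ('a \<Rightarrow> 'b::euclidean_space) \<Rightarrow> bool" where
  "smooth_on S f \<longleftrightarrow> (\<forall>hs. \<forall>x\<in>S. iter_deriv f hs differentiable (at x))"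

definition matrix_norm :: "real^'n^'m \<Rightarrow> real" where
  "matrix_norm A = onorm ((*v) A)"

definition deriv_norm :: "nat \<Rightarrow> (real^'d \<Rightarrow> real^'n^'m) \<Rightarrow> real^'d \<Rightarrow> ennreal" where
  "deriv_norm l F x =
     (SUP hs \<in> {hs. length hs = l \<and> (\<forall>h\<in>set hs. norm h \<le> 1)}.
        ennreal (matrix_norm (iter_deriv F hs x)))"

section \<open>Strongly Lipschitz sets and their outward unit normal\<close>

text \<open>Local graph description in the sense of Hofmann, Mitrea and Taylor: in a cylinder centred at
  \<open>x\<close> with axis \<open>N\<close>, radius \<open>r\<close> and half height \<open>c\<close>, the set \<open>S\<close> is the part strictly above the
  graph of a Lipschitz function \<open>\<phi>\<close> defined on the hyperplane orthogonal to \<open>N\<close>. Rotated Cartesian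
  coordinates centred at \<open>x\<close> are replaced by the orthogonal decomposition \<open>x + y + tN\<close>.\<close>

definition hyperplane_of :: "'a::euclidean_space \<Rightarrow> 'a set" where
  "hyperplane_of N = {y. y \<bullet> N = 0}"

definition lipschitz_chart ::
  "'a::euclidean_space set \<Rightarrow> 'a \<Rightarrow> 'a \<Rightarrow> real \<Rightarrow> real \<Rightarrow> ('a \<Rightarrow> real) \<Rightarrow> bool" where
  "lipschitz_chart S x N r c \<phi> \<longleftrightarrow>
     norm N = 1 \<and> 0 < r \<and> 0 < c \<and>
     (\<exists>L. L-lipschitz_on (hyperplane_of N) \<phi>) \<and> \<phi> 0 = 0 \<and>
     (\<forall>y\<in>hyperplane_of N. norm y \<le> r \<longrightarrow> \<bar>\<phi> y\<bar> < c) \<and>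
     (\<forall>y\<in>hyperplane_of N. \<forall>t. norm y < r \<and> \<bar>t\<bar> < c \<longrightarrow>
        (x + y + t *\<^sub>R N \<in> S \<longleftrightarrow> \<phi> y < t) \<and>
        (x + y + t *\<^sub>R N \<in> frontier S \<longleftrightarrow> t = \<phi> y) \<and>
        (x + y + t *\<^sub>R N \<notin> closure S \<longleftrightarrow> t < \<phi> y))"

definition strongly_lipschitz :: "'a::euclidean_space set \<Rightarrow> bool" where
  "strongly_lipschitz S \<longleftrightarrow>
     compact (frontier S) \<and> (\<forall>x\<in>frontier S. \<exists>N r c \<phi>. lipschitz_chart S x N r c \<phi>)"

text \<open>Where the graph function has gradient \<open>g\<close>, the outward unit normal is
  \<open>(g - N) / sqrt (1 + \<bar>g\<bar>\<^sup>2)\<close>, because \<open>S\<close> lies above the graph. It exists almost everywhere on the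
  boundary and depends neither on the chart nor on its centre; \<open>outward_normal\<close> is unspecified at
  the exceptional points.\<close>

definition is_outward_normal :: "'a::euclidean_space set \<Rightarrow> 'a \<Rightarrow> 'a \<Rightarrow> bool" where
  "is_outward_normal S x n \<longleftrightarrow>
     (\<exists>N r c \<phi> g. lipschitz_chart S x N r c \<phi> \<and> g \<in> hyperplane_of N \<and>
        (\<phi> has_derivative (\<lambda>h. g \<bullet> h)) (at 0 within hyperplane_of N) \<and>
        n = (g - N) /\<^sub>R sqrt (1 + (norm g)\<^sup>2))"

definition outward_normal :: "'a::euclidean_space set \<Rightarrow> 'a \<Rightarrow> 'a" where
  "outward_normal S x = (THE n. is_outward_normal S x n)"

text \<open>The \<open>s\<close>-dimensional Hausdorff outer measure (without normalising constant; empty covering sets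
  count \<open>0\<close>, so that \<open>s = 0\<close> gives the counting measure). Surface null sets are the null sets of
  the \<open>(d-1)\<close>-dimensional one.\<close>

definition hausdorff_outer :: "nat \<Rightarrow> 'a::metric_space set \<Rightarrow> ennreal" where
  "hausdorff_outer s Z =
     (SUP e\<in>{0<..}. INF A\<in>{A :: nat \<Rightarrow> 'a set. Z \<subseteq> (\<Union>i. A i) \<and>
                                   (\<forall>i. bounded (A i) \<and> diameter (A i) \<le> (e::real))}.
        \<Sum>i. if A i = {} then 0 else ennreal (diameter (A i) ^ s))"

definition ae_surface :: "(real^'d) set \<Rightarrow> (real^'d \<Rightarrow> bool) \<Rightarrow> bool" where
  "ae_surface S P \<longleftrightarrow> (\<exists>Z. hausdorff_outer (CARD('d) - 1) Z = 0 \<and> (\<forall>x\<in>S - Z. P x))"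

section \<open>Lebesgue spaces\<close>

definition Lp_norm ::
  "ennreal \<Rightarrow> 'a::euclidean_space set \<Rightarrow> ('a \<Rightarrow> 'b::euclidean_space) \<Rightarrow> ennreal" where
  "Lp_norm p S f =
     (if p = \<infinity> then esssup (lebesgue_on S) (\<lambda>x. ennreal (norm (f x)))
      else let I = \<integral>\<^sup>+ x. ennreal (norm (f x) powr enn2real p) \<partial>lebesgue_on S
           in if I = \<infinity> then \<infinity> else ennreal (enn2real I powr (1 / enn2real p)))"

definition Lp_space ::
  "ennreal \<Rightarrow> 'a::euclidean_space set \<Rightarrow> ('a \<Rightarrow> 'b::euclidean_space) set" where
  "Lp_space p S = {f \<in> borel_measurable (lebesgue_on S). Lp_norm p S f < \<infinity>}"

text \<open>\<open>T\<close> induces a bounded linear operator of norm at most \<open>C\<close> on the space of classes of almost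
  everywhere equal functions (compatibility with almost everywhere equality follows from linearity
  and the bound).\<close>

definition Lp_operator_bound ::
  "ennreal \<Rightarrow> 'a::euclidean_space set \<Rightarrow>
     (('a \<Rightarrow> 'b::euclidean_space) \<Rightarrow> 'a \<Rightarrow> 'b) \<Rightarrow> real \<Rightarrow> bool" where
  "Lp_operator_bound p S T C \<longleftrightarrow>
     (\<forall>f\<in>Lp_space p S. \<forall>g\<in>Lp_space p S. \<forall>a b.
        AE x in lebesgue_on S. T (\<lambda>z. a *\<^sub>R f z + b *\<^sub>R g z) x = a *\<^sub>R T f x + b *\<^sub>R T g x) \<and>
     (\<forall>f\<in>Lp_space p S. T f \<in> Lp_space p S \<and> Lp_norm p S (T f) \<le> ennreal C * Lp_norm p S f)"

definition zero_ext :: "'a set \<Rightarrow> ('a \<Rightarrow> 'b::zero) \<Rightarrow> 'a \<Rightarrow> 'b" where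
  "zero_ext D f x = (if x \<in> D then f x else 0)"

section \<open>Distributional gradient, curl and divergence\<close>

definition partial_deriv :: "'d \<Rightarrow> (real^'d \<Rightarrow> real) \<Rightarrow> real^'d \<Rightarrow> real" where
  "partial_deriv i \<phi> x = frechet_derivative \<phi> (at x) (axis i 1)"

definition gradient :: "(real^'d \<Rightarrow> real) \<Rightarrow> real^'d \<Rightarrow> real^'d" where
  "gradient \<phi> x = (\<chi> i. partial_deriv i \<phi> x)"

definition divergence :: "(real^'d \<Rightarrow> real^'d) \<Rightarrow> real^'d \<Rightarrow> real" where
  "divergence \<psi> x = (\<Sum>i\<in>UNIV. partial_deriv i (\<lambda>z. \<psi> z $ i) x)"

definition curl :: "(real^3 \<Rightarrow> real^3) \<Rightarrow> real^3 \<Rightarrow> real^3" where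
  "curl \<psi> x = vector
     [partial_deriv 2 (\<lambda>z. \<psi> z $ 3) x - partial_deriv 3 (\<lambda>z. \<psi> z $ 2) x,
      partial_deriv 3 (\<lambda>z. \<psi> z $ 1) x - partial_deriv 1 (\<lambda>z. \<psi> z $ 3) x,
      partial_deriv 1 (\<lambda>z. \<psi> z $ 2) x - partial_deriv 2 (\<lambda>z. \<psi> z $ 1) x]"

definition test_function ::
  "'a::euclidean_space set \<Rightarrow> ('a \<Rightarrow> 'b::euclidean_space) \<Rightarrow> bool" where
  "test_function S \<phi> \<longleftrightarrow>
     smooth_on UNIV \<phi> \<and> (\<exists>K. compact K \<and> K \<subseteq> S \<and> (\<forall>x. x \<notin> K \<longrightarrow> \<phi> x = 0))"

definition locally_integrable ::
  "'a::euclidean_space set \<Rightarrow> ('a \<Rightarrow> 'b::euclidean_space) \<Rightarrow> bool" where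
  "locally_integrable S f \<longleftrightarrow> (\<forall>K. compact K \<and> K \<subseteq> S \<longrightarrow> integrable (lebesgue_on K) f)"

text \<open>\<open>has_weak_gradient S u G\<close>: on the open set \<open>S\<close>, the distributional gradient of the locally
  integrable function \<open>u\<close> is the locally integrable field \<open>G\<close> (which is then unique almost
  everywhere on \<open>S\<close>); similarly for the curl and the divergence.\<close>

definition has_weak_gradient ::
  "(real^'d) set \<Rightarrow> (real^'d \<Rightarrow> real) \<Rightarrow> (real^'d \<Rightarrow> real^'d) \<Rightarrow> bool" where
  "has_weak_gradient S u G \<longleftrightarrow>
     locally_integrable S u \<and> locally_integrable S G \<and>
     (\<forall>\<psi> :: real^'d \<Rightarrow> real^'d. test_function S \<psi> \<longrightarrow>
        (LINT x|lebesgue_on S. u x * divergence \<psi> x) = - (LINT x|lebesgue_on S. G x \<bullet> \<psi> x))"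

definition has_weak_curl ::
  "(real^3) set \<Rightarrow> (real^3 \<Rightarrow> real^3) \<Rightarrow> (real^3 \<Rightarrow> real^3) \<Rightarrow> bool" where
  "has_weak_curl S v w \<longleftrightarrow>
     locally_integrable S v \<and> locally_integrable S w \<and>
     (\<forall>\<psi>. test_function S \<psi> \<longrightarrow>
        (LINT x|lebesgue_on S. v x \<bullet> curl \<psi> x) = (LINT x|lebesgue_on S. w x \<bullet> \<psi> x))"

definition has_weak_divergence ::
  "(real^'d) set \<Rightarrow> (real^'d \<Rightarrow> real^'d) \<Rightarrow> (real^'d \<Rightarrow> real) \<Rightarrow> bool" where
  "has_weak_divergence S v w \<longleftrightarrow>
     locally_integrable S v \<and> locally_integrable S w \<and>
     (\<forall>\<phi> :: real^'d \<Rightarrow> real. test_function S \<phi> \<longrightarrow>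
        (LINT x|lebesgue_on S. v x \<bullet> gradient \<phi> x) = - (LINT x|lebesgue_on S. w x * \<phi> x))"

definition Zg_space :: "ennreal \<Rightarrow> (real^3) set \<Rightarrow> (real^3 \<Rightarrow> real) set" where
  "Zg_space p D =
     {f \<in> Lp_space p D. \<exists>G\<in>Lp_space p UNIV. has_weak_gradient UNIV (zero_ext D f) G}"

definition Zc_space :: "ennreal \<Rightarrow> (real^3) set \<Rightarrow> (real^3 \<Rightarrow> real^3) set" where
  "Zc_space p D =
     {v \<in> Lp_space p D. \<exists>w\<in>Lp_space p UNIV. has_weak_curl UNIV (zero_ext D v) w}"

definition Zd_space :: "ennreal \<Rightarrow> (real^3) set \<Rightarrow> (real^3 \<Rightarrow> real^3) set" where
  "Zd_space p D =
     {v \<in> Lp_space p D. \<exists>w\<in>Lp_space p UNIV. has_weak_divergence UNIV (zero_ext D v) w}"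

section \<open>The mollification operators\<close>

definition bump :: "'a::euclidean_space \<Rightarrow> real" where
  "bump y = (if norm y < 1 then exp (- (1 / (1 - (norm y)\<^sup>2))) else 0)"

definition mollifier :: "'a::euclidean_space \<Rightarrow> real" where
  "mollifier (y :: 'a) = bump y / (LINT z|lebesgue. bump (z :: 'a))"

lemma integral_mollifier: "(LINT y|lebesgue. mollifier (y::'a::euclidean_space)) = 1"
proof -
  have meas: "(bump :: 'a \<Rightarrow> real) \<in> borel_measurable lebesgue"
    unfolding bump_def[abs_def] by (intro measurable_completion) measurable
  have int: "integrable lebesgue (bump :: 'a \<Rightarrow> real)"
  proof (rule Bochner_Integration.integrable_bound)
    show "integrable lebesgue (indicator (ball 0 1) :: 'a \<Rightarrow> real)"
      using lmeasurable_ball[of "0::'a" 1] by (simp add: fmeasurable_def less_top)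
    show "AE y in lebesgue. norm (bump (y::'a)) \<le> norm (indicator (ball 0 1) y :: real)"
      by (intro AE_I2) (auto simp: bump_def power_le_one)
  qed (use meas in auto)
  have "(LINT y|lebesgue. bump (y::'a)) \<noteq> 0"
  proof
    assume "(LINT y|lebesgue. bump (y::'a)) = 0"
    then have "AE y in lebesgue. bump (y::'a) = 0"
      by (subst (asm) integral_nonneg_eq_0_iff_AE[OF int]) (auto simp: bump_def)
    then have "AE y in lebesgue. y \<notin> ball (0::'a) 1"
      by eventually_elim (auto simp: bump_def)
    then have "ball (0::'a) 1 \<in> null_sets lebesgue"
      by (subst (asm) AE_iff_null_sets[symmetric]) auto
    then have "negligible (ball (0::'a) 1)"
      by (simp add: negligible_iff_null_sets)
    then show False
      using open_not_negligible[of "ball (0::'a) 1"] by auto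
  qed
  then show ?thesis
    by (simp add: mollifier_def[abs_def])
qed

definition shift_map :: "(real^'d \<Rightarrow> real^'d) \<Rightarrow> real \<Rightarrow> real^'d \<Rightarrow> real^'d" where
  "shift_map k \<delta> x = x + \<delta> *\<^sub>R k x"

definition shift_jacobian :: "(real^'d \<Rightarrow> real^'d) \<Rightarrow> real \<Rightarrow> real^'d \<Rightarrow> real^'d^'d" where
  "shift_jacobian k \<delta> x = jacobian (shift_map k \<delta>) (at x)"

definition mollify_g ::
  "(real^'d) set \<Rightarrow> (real^'d \<Rightarrow> real^'d) \<Rightarrow> real \<Rightarrow> real \<Rightarrow> (real^'d \<Rightarrow> real) \<Rightarrow> real^'d \<Rightarrow> real" where
  "mollify_g D k \<zeta> \<delta> f x =
     (LINT y|lebesgue_on (ball 0 1).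
        mollifier y * zero_ext D f (shift_map k \<delta> x + (\<delta> * \<zeta>) *\<^sub>R y))"

definition mollify ::
  "(real^'d) set \<Rightarrow> (real^'d \<Rightarrow> real^'d) \<Rightarrow> real \<Rightarrow> (real \<Rightarrow> real^'d \<Rightarrow> real^'q^'q) \<Rightarrow> real \<Rightarrow>
     (real^'d \<Rightarrow> real^'q) \<Rightarrow> real^'d \<Rightarrow> real^'q" where
  "mollify D k \<zeta> B \<delta> g x = B \<delta> x *v (\<chi> i. mollify_g D k \<zeta> \<delta> (\<lambda>z. g z $ i) x)"

definition mollify_c ::
  "(real^'d) set \<Rightarrow> (real^'d \<Rightarrow> real^'d) \<Rightarrow> real \<Rightarrow> real \<Rightarrow>
     (real^'d \<Rightarrow> real^'d) \<Rightarrow> real^'d \<Rightarrow> real^'d" where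
  "mollify_c D k \<zeta> = mollify D k \<zeta> (\<lambda>\<delta> x. transpose (shift_jacobian k \<delta> x))"

definition mollify_d ::
  "(real^'d) set \<Rightarrow> (real^'d \<Rightarrow> real^'d) \<Rightarrow> real \<Rightarrow> real \<Rightarrow>
     (real^'d \<Rightarrow> real^'d) \<Rightarrow> real^'d \<Rightarrow> real^'d" where
  "mollify_d D k \<zeta> = mollify D k \<zeta>
     (\<lambda>\<delta> x. det (shift_jacobian k \<delta> x) *\<^sub>R matrix_inv (shift_jacobian k \<delta> x))"

section \<open>Standing assumptions\<close>

definition transversal_setting ::
  "(real^'d) set \<Rightarrow> real^'d \<Rightarrow> real \<Rightarrow> (real^'d) set \<Rightarrow> (real^'d \<Rightarrow> real^'d) \<Rightarrow> bool" where
  "transversal_setting D xD rD Out k \<longleftrightarrow>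
     open D \<and> bounded D \<and> connected D \<and> strongly_lipschitz D \<and>
     0 < rD \<and> D \<subseteq> ball xD rD \<and> Out = ball xD rD - closure D \<and>
     open Out \<and> bounded Out \<and> strongly_lipschitz Out \<and> frontier D \<subseteq> frontier Out \<and>
     smooth_on UNIV k \<and>
     (\<exists>\<gamma>>0. ae_surface (frontier Out) (\<lambda>x. - (outward_normal Out x \<bullet> k x) \<ge> \<gamma>)) \<and>
     (\<forall>x\<in>frontier Out. norm (k x) = 1)"

definition mollification_setting ::
  "(real^'d) set \<Rightarrow> real^'d \<Rightarrow> real \<Rightarrow> (real^'d) set \<Rightarrow> (real^'d \<Rightarrow> real^'d) \<Rightarrow> real \<Rightarrow> real \<Rightarrow> bool"
where
  "mollification_setting D xD rD Out k \<zeta> \<delta>\<^sub>0 \<longleftrightarrow>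
     transversal_setting D xD rD Out k \<and>
     0 < \<zeta> \<and>
     (\<forall>\<delta>\<in>{0..1}. {u + v | u v. u \<in> shift_map k \<delta> ` Out \<and>
                                v \<in> (if \<delta> = 0 then {0} else ball 0 (3 * \<delta> * \<zeta>))} \<subseteq> Out) \<and>
     0 < \<delta>\<^sub>0 \<and> \<delta>\<^sub>0 \<le> 1 \<and>
     (\<forall>\<delta>\<in>{0..\<delta>\<^sub>0}. \<forall>x\<in>D.
        matrix_norm (shift_jacobian k \<delta> x - mat 1) \<le> 1 / 2 \<and>
        invertible (shift_jacobian k \<delta> x) \<and>
        matrix_norm (matrix_inv (shift_jacobian k \<delta> x)) \<le> 2 \<and>
        \<bar>det (matrix_inv (shift_jacobian k \<delta> x))\<bar> \<le> 2 ^ CARD('d))"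

definition admissible_fields :: "(real^'d) set \<Rightarrow> (real \<Rightarrow> real^'d \<Rightarrow> real^'q^'q) \<Rightarrow> bool" where
  "admissible_fields D B \<longleftrightarrow>
     (\<forall>\<delta>\<in>{0..1}. smooth_on D (B \<delta>)) \<and>
     (\<forall>l. \<exists>c\<ge>0. \<forall>\<delta>\<in>{0..1}.
        (SUP x\<in>D. deriv_norm l (\<lambda>z. B \<delta> z - mat 1) x) \<le> ennreal (c * \<delta>))"

end

theory Submission
  imports Defs
begin

text \<open>For \<open>\<delta> > 0\<close> the average at \<open>x\<close> is the ordinary mollification, at scale \<open>\<delta>\<zeta>\<close>, of the extension by
  zero, evaluated at \<open>\<theta>(x) = x + \<delta> k(x)\<close>. Mollification commutes with distributional derivatives on the
  whole space and produces smooth functions, so the chain rule and Piola's identity give, with \<open>K\<close> the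
  Jacobian of \<open>\<theta>\<close> and \<open>T\<close> the average, the pointwise formulas \<open>\<nabla>(T f) = K\<^sup>T T(\<nabla>f)\<close>,
  \<open>curl (K\<^sup>T T g) = adj K T(curl g)\<close> and \<open>div (adj K T g) = det K T(div g)\<close>. Each limit therefore
  asserts that \<open>A T F\<close> tends to \<open>F\<close> in \<open>L\<^sup>p(D)\<close>, where \<open>F\<close> is an \<open>L\<^sup>p\<close> function on the whole space and
  \<open>A\<close> is within \<open>O(\<delta>)\<close> of the identity. For continuous \<open>F\<close> this is uniform continuity, and density
  reduces the general case to a uniform bound. By Jensen's inequality and Tonelli's theorem that
  bound follows from \<open>\<integral>\<^sub>D F(\<theta>(x) + v) dx \<le> C \<integral> F\<close> for nonnegative \<open>F\<close>, with \<open>C\<close> independent of \<open>\<delta>\<close>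
  and \<open>v\<close>.\<close>

section \<open>Smoothness of the mollification kernel\<close>

text \<open>The shift need not be injective on D, since the bound on its Jacobian holds there only
  and D need not be convex. The uniform constant therefore comes from a covering:
  \<open>shift_jacobian k \<delta> x - mat 1\<close> is linear in \<delta>, so the bound 1/2 at
  \<open>\<delta>\<^sub>0\<close> controls the derivative of k for all \<delta> at once, and by
  uniform continuity this control survives on balls of one fixed radius centred in D. On such a ball
  every shift shrinks distances by a factor of at most 4, and finitely many such balls cover D. The
  averages reach outside D. This is harmless because the spaces Z ask for derivatives of the
  extension by zero on the whole space, so no boundary term arises. Two degeneracies recur. At
  \<delta> = 0 the average is point evaluation and smooths nothing, so whatever rests on
  mollification is checked separately there. And Tonelli's theorem needs joint measurability in (x,
  y), so a Lebesgue measurable F is first replaced by a Borel representative, which for \<delta> > 0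
  leaves the average unchanged at every point.\<close>

definition exp_recip :: "nat \<Rightarrow> real \<Rightarrow> real" where
  "exp_recip m t = (if t > 0 then exp (- (1 / t)) / t ^ m else 0)"

text \<open>With s = 1/t the limit from the right is that of s^m / exp s at infinity; to the left of
  0 the function vanishes identically.\<close>

lemma exp_recip_tendsto_0: "(exp_recip m \<longlongrightarrow> 0) (at 0)"
proof -
  have "((\<lambda>t. inverse t ^ m / exp (inverse t)) \<longlongrightarrow> (0::real)) (at_right 0)"
    by (rule filterlim_compose[OF tendsto_power_div_exp_0 filterlim_inverse_at_top_right])
  moreover have "\<forall>\<^sub>F t in at_right 0. inverse t ^ m / exp (inverse t) = exp_recip m t"
    by (auto simp: eventually_at_filter exp_recip_def exp_minus field_simps intro!: always_eventually)
  ultimately have right: "(exp_recip m \<longlongrightarrow> 0) (at_right 0)"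
    by (rule Lim_transform_eventually)
  have "\<forall>\<^sub>F t in at_left 0. 0 = exp_recip m t"
    by (auto simp: eventually_at_filter exp_recip_def intro!: always_eventually)
  then have "(exp_recip m \<longlongrightarrow> 0) (at_left 0)"
    by (rule Lim_transform_eventually[OF tendsto_const])
  with right show ?thesis
    by (simp add: filterlim_split_at)
qed

lemma DERIV_exp_recip:
  "(exp_recip m has_real_derivative exp_recip (m + 2) t - real m * exp_recip (m + 1) t) (at t)"
proof (rule linorder_cases[of t 0])
  assume t: "t < 0"
  have "((\<lambda>t. 0::real) has_real_derivative 0) (at t)" by simp
  then have "(exp_recip m has_real_derivative 0) (at t)"
    by (rule has_field_derivative_transform_within_open[where S = "{..<0}"])
      (use t in \<open>auto simp: exp_recip_def\<close>)
  then show ?thesis using t by (simp add: exp_recip_def)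
next
  assume t: "t = 0"
  \<comment> \<open>At the origin the difference quotient of the member m is the member m + 1, whose
    limit is known.\<close>
  have "((\<lambda>h. (exp_recip m (0 + h) - exp_recip m 0) / h) \<longlongrightarrow> 0) (at 0)"
  proof (rule Lim_transform_eventually[OF exp_recip_tendsto_0[of "Suc m"]])
    show "\<forall>\<^sub>F h in at 0. exp_recip (Suc m) h = (exp_recip m (0 + h) - exp_recip m 0) / h"
      by (auto simp: eventually_at_filter exp_recip_def field_simps intro!: always_eventually)
  qed
  then show ?thesis using t
    by (simp add: DERIV_def exp_recip_def)
next
  assume t: "0 < t"
  have "((\<lambda>t. exp (- (1 / t)) / t ^ m) has_real_derivative
      exp_recip (m + 2) t - real m * exp_recip (m + 1) t) (at t)"
    using t by (cases m)
      ((auto intro!: derivative_eq_intros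
        simp: exp_recip_def field_simps power2_eq_square simp del: power_Suc)[],
       auto intro!: derivative_eq_intros
        simp: exp_recip_def field_simps power2_eq_square simp del: power_Suc,
       simp_all add: algebra_simps)
  then show ?thesis
    by (rule has_field_derivative_transform_within_open[where S = "{0<..}"])
      (use t in \<open>auto simp: exp_recip_def\<close>)
qed

text \<open>Every member has directional derivatives in the class, which gives \<^const>\<open>smooth_on\<close> at once.\<close>

inductive bump_algebra ::
  "'a::euclidean_space \<Rightarrow> real \<Rightarrow> ('a \<Rightarrow> real) \<Rightarrow> bool" for c e where
  const: "bump_algebra c e (\<lambda>x. a)"
| inner: "bump_algebra c e (\<lambda>x. x \<bullet> v)"
| add: "bump_algebra c e f \<Longrightarrow> bump_algebra c e g \<Longrightarrow> bump_algebra c e (\<lambda>x. f x + g x)"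
| mult: "bump_algebra c e f \<Longrightarrow> bump_algebra c e g \<Longrightarrow> bump_algebra c e (\<lambda>x. f x * g x)"
| bump: "bump_algebra c e (\<lambda>x. exp_recip m (1 - (x - c) \<bullet> (x - c) / e\<^sup>2))"

lemma bump_algebra_has_derivative:
  assumes "bump_algebra c e f"
  shows "\<exists>f'. (\<forall>x. (f has_derivative f' x) (at x)) \<and> (\<forall>h. bump_algebra c e (\<lambda>x. f' x h))"
  using assms
proof induction
  case (const a)
  then show ?case
    by (intro exI[of _ "\<lambda>x h. 0"]) (auto intro: bump_algebra.const)
next
  case (inner v)
  then show ?case
    by (intro exI[of _ "\<lambda>x h. h \<bullet> v"])
      (auto intro!: bump_algebra.const derivative_eq_intros)
next
  case (add f g)
  then obtain f' g' where
    "\<And>x. (f has_derivative f' x) (at x)" "\<And>h. bump_algebra c e (\<lambda>x. f' x h)"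
    "\<And>x. (g has_derivative g' x) (at x)" "\<And>h. bump_algebra c e (\<lambda>x. g' x h)" by blast
  then show ?case
    by (intro exI[of _ "\<lambda>x h. f' x h + g' x h"]) (auto intro!: bump_algebra.add has_derivative_add)
next
  case (mult f g)
  then obtain f' g' where
    "\<And>x. (f has_derivative f' x) (at x)" "\<And>h. bump_algebra c e (\<lambda>x. f' x h)"
    "\<And>x. (g has_derivative g' x) (at x)" "\<And>h. bump_algebra c e (\<lambda>x. g' x h)" by blast
  with mult.hyps show ?case
    by (intro exI[of _ "\<lambda>x h. f x * g' x h + f' x h * g x"])
      (auto intro!: bump_algebra.intros has_derivative_mult)
next
  case (bump m)
  \<comment> \<open>Every difference is written as a sum with a negated constant factor or summand,
    so that the constructors of \<open>bump_algebra\<close> apply literally.\<close>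
  let ?f' = "\<lambda>x h. (exp_recip (m + 2) (1 - (x - c) \<bullet> (x - c) / e\<^sup>2)
      + - real m * exp_recip (m + 1) (1 - (x - c) \<bullet> (x - c) / e\<^sup>2)) * ((-2 / e\<^sup>2) * (x \<bullet> h + - (c \<bullet> h)))"
  have "((\<lambda>x. exp_recip m (1 - (x - c) \<bullet> (x - c) / e\<^sup>2)) has_derivative ?f' x) (at x)" for x
  proof -
    have "((\<lambda>x. 1 - (x - c) \<bullet> (x - c) / e\<^sup>2) has_derivative
        (\<lambda>h. (-2 / e\<^sup>2) * (x \<bullet> h + - (c \<bullet> h)))) (at x)"
      by (auto intro!: derivative_eq_intros ext
          simp: divide_inverse inner_diff_left inner_diff_right inner_commute algebra_simps)
    from has_derivative_compose[OF this
        DERIV_exp_recip[of m, unfolded has_field_derivative_def]]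
    show ?thesis by (simp add: mult.commute)
  qed
  then show ?case
    by (intro exI[of _ ?f'] conjI allI bump_algebra.intros)
qed

lemma iter_deriv_bump_algebra:
  assumes "bump_algebra c e f"
  shows "bump_algebra c e (iter_deriv f hs)"
proof (induction hs)
  case (Cons h hs)
  from bump_algebra_has_derivative[OF this] obtain f' where
    f': "\<And>x. (iter_deriv f hs has_derivative f' x) (at x)" "\<And>h. bump_algebra c e (\<lambda>x. f' x h)"
    by blast
  then have "frechet_derivative (iter_deriv f hs) (at x) = f' x" for x
    by (metis frechet_derivative_at)
  with f' show ?case by simp
qed (use assms in simp)

lemma smooth_on_bump_algebra: "bump_algebra c e f \<Longrightarrow> smooth_on UNIV f"
  unfolding smooth_on_def
  by (meson bump_algebra_has_derivative differentiableI iter_deriv_bump_algebra)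

section \<open>Rescaled and translated kernels as test functions\<close>

definition scaled_mollifier :: "real \<Rightarrow> 'a::euclidean_space \<Rightarrow> 'a \<Rightarrow> real" where
  "scaled_mollifier e c z = mollifier ((z - c) /\<^sub>R e) / e ^ DIM('a)"

lemma bump_algebra_scaled_mollifier:
  assumes "e > 0"
  shows "bump_algebra c e (scaled_mollifier e (c::'a::euclidean_space))"
proof -
  let ?I = "LINT z|lebesgue. bump (z :: 'a)"
  have "bump ((z - c) /\<^sub>R e) = exp_recip 0 (1 - (z - c) \<bullet> (z - c) / e\<^sup>2)" for z :: 'a
  proof -
    have n: "(norm ((z - c) /\<^sub>R e))\<^sup>2 = (z - c) \<bullet> (z - c) / e\<^sup>2"
      by (simp add: power_mult_distrib power2_norm_eq_inner[symmetric] divide_inverse mult.commute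
          power_inverse)
    \<comment> \<open>The kernel distinguishes cases by the norm, \<open>exp_recip\<close> by the
      sign of 1 minus the squared norm.\<close>
    have "norm ((z - c) /\<^sub>R e) < 1 \<longleftrightarrow> (norm ((z - c) /\<^sub>R e))\<^sup>2 < 1"
      using abs_square_less_1[of "norm ((z - c) /\<^sub>R e)"] by simp
    with n show ?thesis
      by (simp add: bump_def exp_recip_def)
  qed
  then have "scaled_mollifier e c =
      (\<lambda>z. exp_recip 0 (1 - (z - c) \<bullet> (z - c) / e\<^sup>2) * (1 / (?I * e ^ DIM('a))))"
    by (auto simp: scaled_mollifier_def mollifier_def fun_eq_iff)
  then show ?thesis
    by (auto intro!: bump_algebra.intros simp del: times_divide_eq_right)
qed

text \<open>Supplies the vector-valued test functions: a rescaled kernel times a fixed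
  direction.\<close>

lemma smooth_on_scaleR_const:
  assumes "smooth_on UNIV f"
  shows "smooth_on UNIV (\<lambda>x. f x *\<^sub>R v)"
proof -
  have eq: "iter_deriv (\<lambda>x. f x *\<^sub>R v) hs = (\<lambda>x. iter_deriv f hs x *\<^sub>R v)" for hs
  proof (induction hs)
    case (Cons h hs)
    have "((\<lambda>x. iter_deriv f hs x *\<^sub>R v) has_derivative
        (\<lambda>h. frechet_derivative (iter_deriv f hs) (at x) h *\<^sub>R v)) (at x)" for x
      using assms by (intro has_derivative_scaleR_left)
        (auto simp: smooth_on_def frechet_derivative_works[symmetric])
    then have "frechet_derivative (\<lambda>x. iter_deriv f hs x *\<^sub>R v) (at x) =
        (\<lambda>h. frechet_derivative (iter_deriv f hs) (at x) h *\<^sub>R v)" for x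
      by (metis frechet_derivative_at)
    then show ?case using Cons by simp
  qed simp
  show ?thesis
    using assms unfolding smooth_on_def eq
    by (auto intro!: differentiable_scaleR)
qed

lemma mollifier_nonneg: "0 \<le> mollifier y"
  by (auto simp: mollifier_def bump_def[abs_def] intro!: divide_nonneg_nonneg Bochner_Integration.integral_nonneg)

lemma mollifier_eq_0: "1 \<le> norm y \<Longrightarrow> mollifier y = 0"
  by (simp add: mollifier_def bump_def)

lemma mollifier_measurable [measurable]: "mollifier \<in> borel_measurable borel"
  unfolding mollifier_def[abs_def] bump_def[abs_def] by measurable

lemma scaled_mollifier_nonneg: "e > 0 \<Longrightarrow> 0 \<le> scaled_mollifier e c z"
  by (simp add: scaled_mollifier_def mollifier_nonneg)

lemma scaled_mollifier_eq_0: "e > 0 \<Longrightarrow> z \<notin> cball c e \<Longrightarrow> scaled_mollifier e c z = 0"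
  by (auto simp: scaled_mollifier_def dist_norm norm_minus_commute inverse_eq_divide
      intro!: mollifier_eq_0)

lemma test_function_scaled_mollifier:
  "e > 0 \<Longrightarrow> test_function UNIV (scaled_mollifier e c)"
  unfolding test_function_def
  by (intro conjI exI[of _ "cball c e"] smooth_on_bump_algebra[OF bump_algebra_scaled_mollifier])
    (auto intro: scaled_mollifier_eq_0)

lemma test_function_scaled_mollifier_scaleR:
  "e > 0 \<Longrightarrow> test_function UNIV (\<lambda>z. scaled_mollifier e c z *\<^sub>R v)"
  unfolding test_function_def
  by (intro conjI exI[of _ "cball c e"] smooth_on_scaleR_const
      smooth_on_bump_algebra[OF bump_algebra_scaled_mollifier])
    (auto simp: scaled_mollifier_eq_0)

section \<open>Continuously differentiable functions\<close>

text \<open>The regularity in which all classical calculus is carried out. Differentiability is part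
  of the definition, beside continuity of the partial derivatives, so that the chain rule applies
  without first deriving one from the other.\<close>

definition C1 :: "(real^'d \<Rightarrow> real) \<Rightarrow> bool" where
  "C1 f \<longleftrightarrow> (\<forall>x. f differentiable (at x)) \<and> (\<forall>i. continuous_on UNIV (partial_deriv i f))"

lemma partial_deriv_eq:
  "(f has_derivative f') (at x) \<Longrightarrow> partial_deriv i f x = f' (axis i 1)"
  unfolding partial_deriv_def by (metis frechet_derivative_at)

lemma C1_has_derivative: "C1 f \<Longrightarrow> (f has_derivative frechet_derivative f (at x)) (at x)"
  by (simp add: C1_def frechet_derivative_works[symmetric])

lemma C1_continuous_on: "C1 f \<Longrightarrow> continuous_on S f"
  by (meson C1_def continuous_at_imp_continuous_on differentiable_imp_continuous_within)

lemma C1_continuous_on_partial_deriv: "C1 f \<Longrightarrow> continuous_on S (partial_deriv i f)"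
  unfolding C1_def using continuous_on_subset by blast

lemma frechet_derivative_eq_partial_deriv:
  fixes f :: "real^'d \<Rightarrow> real"
  assumes "(f has_derivative f') (at x)"
  shows "f' h = (\<Sum>i\<in>UNIV. partial_deriv i f x * h $ i)"
proof -
  have "linear f'" using assms has_derivative_linear by blast
  then have "f' (\<Sum>i\<in>UNIV. h $ i *\<^sub>R axis i 1) = (\<Sum>i\<in>UNIV. h $ i * f' (axis i 1))"
    by (simp add: linear_sum linear_cmul)
  moreover have "(\<Sum>i\<in>UNIV. h $ i *\<^sub>R axis i 1) = h"
    using basis_expansion[of h] by (simp add: scalar_mult_eq_scaleR)
  ultimately show ?thesis
    using partial_deriv_eq[OF assms] by (simp add: mult.commute)
qed

lemma C1_I:
  assumes "\<And>x. (f has_derivative f' x) (at x)" "\<And>i. continuous_on UNIV (\<lambda>x. f' x (axis i 1))"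
  shows "C1 f"
  using assms partial_deriv_eq[OF assms(1)] unfolding C1_def differentiable_def
  by (auto simp: fun_eq_iff)

lemma C1_const: "C1 (\<lambda>x. c)"
  by (rule C1_I) (auto intro: has_derivative_const)

lemma partial_deriv_const: "partial_deriv i (\<lambda>x. c) x = 0"
  by (rule partial_deriv_eq[OF has_derivative_const])

lemma partial_deriv_add:
  assumes "C1 f" "C1 g"
  shows "partial_deriv i (\<lambda>x. f x + g x) x = partial_deriv i f x + partial_deriv i g x"
  using partial_deriv_eq[OF has_derivative_add[OF assms[THEN C1_has_derivative]]]
  by (simp add: partial_deriv_def)

lemma partial_deriv_diff:
  assumes "C1 f" "C1 g"
  shows "partial_deriv i (\<lambda>x. f x - g x) x = partial_deriv i f x - partial_deriv i g x"
  using partial_deriv_eq[OF has_derivative_diff[OF assms[THEN C1_has_derivative]]]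
  by (simp add: partial_deriv_def)

lemma partial_deriv_mult:
  assumes "C1 f" "C1 g"
  shows "partial_deriv i (\<lambda>x. f x * g x) x = f x * partial_deriv i g x + partial_deriv i f x * g x"
  using partial_deriv_eq[OF has_derivative_mult[OF assms[THEN C1_has_derivative]]]
  by (simp add: partial_deriv_def)

lemma partial_deriv_sum:
  assumes "\<And>j. j \<in> I \<Longrightarrow> C1 (f j)"
  shows "partial_deriv i (\<lambda>x. \<Sum>j\<in>I. f j x) x = (\<Sum>j\<in>I. partial_deriv i (f j) x)"
  using partial_deriv_eq[OF has_derivative_sum[OF assms[THEN C1_has_derivative]]]
  by (simp add: partial_deriv_def)

lemma C1_add: "C1 f \<Longrightarrow> C1 g \<Longrightarrow> C1 (\<lambda>x. f x + g x)"
  by (rule C1_I[OF has_derivative_add[OF C1_has_derivative C1_has_derivative]])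
    (auto simp flip: partial_deriv_def intro!: continuous_intros C1_continuous_on_partial_deriv)

lemma C1_diff: "C1 f \<Longrightarrow> C1 g \<Longrightarrow> C1 (\<lambda>x. f x - g x)"
  by (rule C1_I[OF has_derivative_diff[OF C1_has_derivative C1_has_derivative]])
    (auto simp flip: partial_deriv_def intro!: continuous_intros C1_continuous_on_partial_deriv)

lemma C1_mult: "C1 f \<Longrightarrow> C1 g \<Longrightarrow> C1 (\<lambda>x. f x * g x)"
  by (rule C1_I[OF has_derivative_mult[OF C1_has_derivative C1_has_derivative]])
    (auto simp flip: partial_deriv_def
      intro!: continuous_on_add continuous_on_mult intro: C1_continuous_on_partial_deriv C1_continuous_on)

lemma C1_sum: "(\<And>j. j \<in> I \<Longrightarrow> C1 (f j)) \<Longrightarrow> C1 (\<lambda>x. \<Sum>j\<in>I. f j x)"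
  by (induction I rule: infinite_finite_induct) (auto intro: C1_const C1_add)

lemma has_derivative_vec_C1:
  fixes \<theta> :: "real^'d \<Rightarrow> real^'n"
  assumes "\<And>m. C1 (\<lambda>x. \<theta> x $ m)"
  shows "(\<theta> has_derivative (\<lambda>h. \<chi> m. frechet_derivative (\<lambda>x. \<theta> x $ m) (at x) h)) (at x)"
  unfolding has_derivative_componentwise_within[of \<theta>]
  using C1_has_derivative[OF assms] by (auto simp: Basis_vec_def inner_axis)

text \<open>The chain rule in coordinates; continuity of the new partial derivatives is read off the
  formula itself.\<close>

lemma
  assumes f: "C1 f" and \<theta>: "\<And>m. C1 (\<lambda>x. \<theta> x $ m)"
  shows C1_compose: "C1 (\<lambda>x. f (\<theta> x))"
    and partial_deriv_compose:
      "partial_deriv i (\<lambda>x. f (\<theta> x)) x =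
         (\<Sum>m\<in>UNIV. partial_deriv m f (\<theta> x) * partial_deriv i (\<lambda>x. \<theta> x $ m) x)"
proof -
  note d = has_derivative_compose[OF has_derivative_vec_C1[OF \<theta>] C1_has_derivative[OF f]]
  have eq: "frechet_derivative f (at (\<theta> x)) (\<chi> m. frechet_derivative (\<lambda>x. \<theta> x $ m) (at x) (axis i 1))
      = (\<Sum>m\<in>UNIV. partial_deriv m f (\<theta> x) * partial_deriv i (\<lambda>x. \<theta> x $ m) x)" for x i
    by (subst frechet_derivative_eq_partial_deriv[OF C1_has_derivative[OF f]])
      (simp add: partial_deriv_def)
  have c: "continuous_on UNIV \<theta>"
    by (meson continuous_at_imp_continuous_on has_derivative_continuous d has_derivative_vec_C1[OF \<theta>])
  show "C1 (\<lambda>x. f (\<theta> x))"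
    by (rule C1_I[OF d], unfold eq)
      (intro continuous_intros continuous_on_compose2[OF C1_continuous_on_partial_deriv[OF f] c]
        C1_continuous_on_partial_deriv[OF \<theta>], auto)
  show "partial_deriv i (\<lambda>x. f (\<theta> x)) x =
         (\<Sum>m\<in>UNIV. partial_deriv m f (\<theta> x) * partial_deriv i (\<lambda>x. \<theta> x $ m) x)"
    unfolding partial_deriv_eq[OF d] eq ..
qed

section \<open>Smooth maps and their components are continuously differentiable\<close>

lemma iter_deriv_append: "iter_deriv f (gs @ hs) = iter_deriv (iter_deriv f hs) gs"
  by (induction gs) auto

lemma smooth_on_iter_deriv: "smooth_on S f \<Longrightarrow> smooth_on S (iter_deriv f hs)"
  unfolding smooth_on_def iter_deriv_append[symmetric] by blast

lemma smooth_on_partial_deriv: "smooth_on UNIV f \<Longrightarrow> smooth_on UNIV (partial_deriv i f)"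
  using smooth_on_iter_deriv[of UNIV f "[axis i 1]"] by (simp add: partial_deriv_def[abs_def])

lemma smooth_on_continuous_on: "smooth_on S f \<Longrightarrow> continuous_on S f"
  unfolding smooth_on_def
  by (metis continuous_at_imp_continuous_on differentiable_imp_continuous_within iter_deriv.simps(1))

lemma smooth_on_imp_C1: "smooth_on UNIV f \<Longrightarrow> C1 f"
  unfolding C1_def
  by (metis UNIV_I iter_deriv.simps(1) smooth_on_continuous_on smooth_on_def smooth_on_partial_deriv)

lemma smooth_on_component:
  fixes f :: "'a::euclidean_space \<Rightarrow> real^'n"
  assumes "smooth_on UNIV f"
  shows "smooth_on UNIV (\<lambda>x. f x $ i)"
proof -
  have d: "((\<lambda>x. iter_deriv f hs x $ i) has_derivative
      (\<lambda>h. frechet_derivative (iter_deriv f hs) (at x) h $ i)) (at x)" for hs x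
    using assms by (intro bounded_linear.has_derivative[OF bounded_linear_vec_nth])
      (auto simp: smooth_on_def frechet_derivative_works[symmetric])
  have "iter_deriv (\<lambda>x. f x $ i) hs = (\<lambda>x. iter_deriv f hs x $ i)" for hs
  proof (induction hs)
    case (Cons h hs)
    have "frechet_derivative (\<lambda>x. iter_deriv f hs x $ i) (at x) h =
        frechet_derivative (iter_deriv f hs) (at x) h $ i" for x
      using frechet_derivative_at[OF d] by metis
    with Cons show ?case by simp
  qed simp
  with d show ?thesis
    unfolding smooth_on_def differentiable_def by metis
qed

section \<open>Symmetry of second partial derivatives\<close>

lemma C1_DERIV_line:
  assumes "C1 f"
  shows "((\<lambda>s. f (x + s *\<^sub>R axis i 1)) has_real_derivative partial_deriv i f (x + s *\<^sub>R axis i 1)) (at s)"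
proof -
  have "((\<lambda>s. x + s *\<^sub>R axis i 1) has_derivative (\<lambda>h. h *\<^sub>R axis i 1)) (at s)"
    by (auto intro!: derivative_eq_intros)
  from has_derivative_compose[OF this C1_has_derivative[OF assms]] show ?thesis
    using linear_cmul[OF has_derivative_linear[OF C1_has_derivative[OF assms]]]
    by (simp add: has_field_derivative_def partial_deriv_def mult_commute_abs)
qed

lemma C1_mvt:
  assumes "C1 f" "0 < t"
  obtains s where "0 < s" "s < t"
    "f (x + t *\<^sub>R axis i 1) - f x = t * partial_deriv i f (x + s *\<^sub>R axis i 1)"
  using MVT2[OF assms(2), of "\<lambda>s. f (x + s *\<^sub>R axis i 1)", OF C1_DERIV_line[OF assms(1)]] by auto

text \<open>The mean value theorem is used twice: in direction j for the difference of f along two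
  parallel segments, then in direction i for the j-th partial derivative.\<close>

lemma mixed_difference:
  assumes "C1 f" "C1 (partial_deriv j f)" "0 < t"
  obtains s s' where "0 < s" "s < t" "0 < s'" "s' < t"
    "f (x + t *\<^sub>R axis i 1 + t *\<^sub>R axis j 1) - f (x + t *\<^sub>R axis i 1) - f (x + t *\<^sub>R axis j 1) + f x
      = t * t * partial_deriv i (partial_deriv j f) (x + s *\<^sub>R axis j 1 + s' *\<^sub>R axis i 1)"
proof -
  let ?\<phi> = "\<lambda>s. f ((x + t *\<^sub>R axis i 1) + s *\<^sub>R axis j 1) - f (x + s *\<^sub>R axis j 1)"
  obtain s where s: "0 < s" "s < t" "?\<phi> t - ?\<phi> 0 = (t - 0) *
      (partial_deriv j f ((x + t *\<^sub>R axis i 1) + s *\<^sub>R axis j 1) - partial_deriv j f (x + s *\<^sub>R axis j 1))"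
    using MVT2[OF assms(3), of ?\<phi>, OF DERIV_diff[OF C1_DERIV_line[OF assms(1)] C1_DERIV_line[OF assms(1)]]]
    by blast
  obtain s' where s': "0 < s'" "s' < t"
    "partial_deriv j f ((x + s *\<^sub>R axis j 1) + t *\<^sub>R axis i 1) - partial_deriv j f (x + s *\<^sub>R axis j 1)
      = t * partial_deriv i (partial_deriv j f) ((x + s *\<^sub>R axis j 1) + s' *\<^sub>R axis i 1)"
    using C1_mvt[OF assms(2,3)] by blast
  have "x + t *\<^sub>R axis i 1 + s *\<^sub>R axis j 1 = (x + s *\<^sub>R axis j 1) + t *\<^sub>R axis i 1"
    by (simp add: algebra_simps)
  with s s' show ?thesis
    by (intro that[of s s']) (auto simp: algebra_simps)
qed

text \<open>The second difference of f is symmetric in i and j. Divided by the square of the step it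
  equals either mixed derivative at some point near x, so continuity of both forces equality as the
  step tends to 0.\<close>

lemma partial_deriv_commute:
  assumes f: "C1 f" "C1 (partial_deriv i f)" "C1 (partial_deriv j f)"
  shows "partial_deriv i (partial_deriv j f) x = partial_deriv j (partial_deriv i f) x"
proof -
  define T :: "nat \<Rightarrow> real" where "T n = 1 / Suc n" for n
  have T: "T n > 0" for n by (simp add: T_def)
  have T0: "T \<longlonglongrightarrow> 0" unfolding T_def[abs_def] by (rule LIMSEQ_Suc[OF lim_1_over_n])
  have "\<exists>s s' r r'. 0 < s \<and> s < T n \<and> 0 < s' \<and> s' < T n \<and> 0 < r \<and> r < T n \<and> 0 < r' \<and> r' < T n \<and>
     partial_deriv i (partial_deriv j f) (x + s *\<^sub>R axis j 1 + s' *\<^sub>R axis i 1) =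
     partial_deriv j (partial_deriv i f) (x + r *\<^sub>R axis i 1 + r' *\<^sub>R axis j 1)" for n
  proof -
    obtain s s' where s: "0 < s" "s < T n" "0 < s'" "s' < T n"
      "f (x + T n *\<^sub>R axis i 1 + T n *\<^sub>R axis j 1) - f (x + T n *\<^sub>R axis i 1) - f (x + T n *\<^sub>R axis j 1) + f x
      = T n * T n * partial_deriv i (partial_deriv j f) (x + s *\<^sub>R axis j 1 + s' *\<^sub>R axis i 1)"
      using mixed_difference[OF f(1,3) T] by blast
    obtain r r' where r: "0 < r" "r < T n" "0 < r'" "r' < T n"
      "f (x + T n *\<^sub>R axis j 1 + T n *\<^sub>R axis i 1) - f (x + T n *\<^sub>R axis j 1) - f (x + T n *\<^sub>R axis i 1) + f x
      = T n * T n * partial_deriv j (partial_deriv i f) (x + r *\<^sub>R axis i 1 + r' *\<^sub>R axis j 1)"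
      using mixed_difference[OF f(1,2) T] by blast
    have "T n * T n * partial_deriv i (partial_deriv j f) (x + s *\<^sub>R axis j 1 + s' *\<^sub>R axis i 1) =
        T n * T n * partial_deriv j (partial_deriv i f) (x + r *\<^sub>R axis i 1 + r' *\<^sub>R axis j 1)"
      using s(5) r(5) by (simp add: algebra_simps)
    then have "partial_deriv i (partial_deriv j f) (x + s *\<^sub>R axis j 1 + s' *\<^sub>R axis i 1) =
        partial_deriv j (partial_deriv i f) (x + r *\<^sub>R axis i 1 + r' *\<^sub>R axis j 1)"
      using T[of n] by simp
    with s r show ?thesis by blast
  qed
  then obtain s s' r r' where s: "\<And>n. 0 < s n \<and> s n < T n \<and> 0 < s' n \<and> s' n < T n \<and>
      0 < r n \<and> r n < T n \<and> 0 < r' n \<and> r' n < T n"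
    and eq: "\<And>n. partial_deriv i (partial_deriv j f) (x + s n *\<^sub>R axis j 1 + s' n *\<^sub>R axis i 1) =
     partial_deriv j (partial_deriv i f) (x + r n *\<^sub>R axis i 1 + r' n *\<^sub>R axis j 1)"
    by metis
  have lim: "(\<lambda>n. x + u n *\<^sub>R a + v n *\<^sub>R b) \<longlonglongrightarrow> x"
    if "\<And>n. 0 < u n \<and> u n < T n" "\<And>n. 0 < v n \<and> v n < T n" for u v and a b :: "real^'a"
  proof -
    have "u \<longlonglongrightarrow> 0" "v \<longlonglongrightarrow> 0"
      using that by (auto intro!: tendsto_sandwich[OF _ _ tendsto_const T0] always_eventually less_imp_le)
    then have "(\<lambda>n. x + u n *\<^sub>R a + v n *\<^sub>R b) \<longlonglongrightarrow> x + 0 *\<^sub>R a + 0 *\<^sub>R b"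
      by (intro tendsto_intros)
    then show ?thesis by simp
  qed
  have "(\<lambda>n. partial_deriv i (partial_deriv j f) (x + s n *\<^sub>R axis j 1 + s' n *\<^sub>R axis i 1))
      \<longlonglongrightarrow> partial_deriv i (partial_deriv j f) x"
    by (rule continuous_on_tendsto_compose[OF C1_continuous_on_partial_deriv[OF f(3)], where s=UNIV])
      (auto intro!: lim simp: s)
  moreover have "(\<lambda>n. partial_deriv j (partial_deriv i f) (x + r n *\<^sub>R axis i 1 + r' n *\<^sub>R axis j 1))
      \<longlonglongrightarrow> partial_deriv j (partial_deriv i f) x"
    by (rule continuous_on_tendsto_compose[OF C1_continuous_on_partial_deriv[OF f(2)], where s=UNIV])
      (auto intro!: lim simp: s)
  ultimately show ?thesis
    unfolding eq by (rule LIMSEQ_unique)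
qed

section \<open>Weak derivatives\<close>

lemma open_sets_lebesgue: "open S \<Longrightarrow> S \<in> sets lebesgue"
  by (simp add: borel_open)

text \<open>Closedness of K makes its complement open, so f vanishes on a neighbourhood of x and not
  only at x.\<close>

lemma partial_deriv_eq_0_outside:
  assumes "closed K" "\<And>x. x \<notin> K \<Longrightarrow> f x = 0" "x \<notin> K"
  shows "partial_deriv i f x = 0"
proof -
  have "(f has_derivative (\<lambda>h. 0)) (at x)"
    by (rule has_derivative_transform_within_open[where f = "\<lambda>x. 0" and s = "- K"])
      (use assms in auto)
  from partial_deriv_eq[OF this] show ?thesis .
qed

lemma continuous_compact_support_bounded:
  fixes f :: "'a::euclidean_space \<Rightarrow> 'b::euclidean_space"
  assumes "continuous_on UNIV f" "compact K" "\<And>x. x \<notin> K \<Longrightarrow> f x = 0"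
  obtains C where "0 \<le> C" "\<And>x. norm (f x) \<le> C"
proof -
  have "bounded (f ` K)"
    by (intro compact_imp_bounded compact_continuous_image continuous_on_subset[OF assms(1)] assms(2)) simp
  then obtain C where "\<And>x. x \<in> K \<Longrightarrow> norm (f x) \<le> C"
    by (auto simp: bounded_iff)
  then have "norm (f x) \<le> max C 0" for x
    using assms(3)[of x] by (cases "x \<in> K") (simp_all add: le_max_iff_disj)
  then show ?thesis by (intro that[of "max C 0"]) auto
qed

lemma integrable_compact_support:
  fixes f :: "'a::euclidean_space \<Rightarrow> 'b::euclidean_space"
  assumes "continuous_on UNIV f" "compact K" "\<And>x. x \<notin> K \<Longrightarrow> f x = 0"
  shows "integrable lborel f"
proof -
  have "integrable lborel (\<lambda>x. indicator K x *\<^sub>R f x)"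
    by (intro borel_integrable_compact assms(2) continuous_on_subset[OF assms(1)]) simp
  moreover have "(\<lambda>x. indicator K x *\<^sub>R f x) = f"
    using assms(3) by (auto simp: indicator_def fun_eq_iff)
  ultimately show ?thesis by simp
qed

text \<open>By translation invariance of Lebesgue measure every difference quotient has integral 0,
  and dominated convergence carries this over to the derivative.\<close>

lemma integral_partial_deriv_eq_0:
  fixes f :: "real^'d \<Rightarrow> real"
  assumes f: "C1 f" and K: "compact K" "\<And>x. x \<notin> K \<Longrightarrow> f x = 0"
  shows "(LINT x|lborel. partial_deriv i f x) = 0"
proof -
  define T :: "nat \<Rightarrow> real" where "T n = 1 / Suc n" for n
  have T: "T n > 0" "T n \<le> 1" for n by (simp_all add: T_def)
  have T0: "T \<longlonglongrightarrow> 0" unfolding T_def[abs_def] by (rule LIMSEQ_Suc[OF lim_1_over_n])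
  define q where "q n x = (f (x + T n *\<^sub>R axis i 1) - f x) / T n" for n x
  \<comment> \<open>The steps are at most 1, so all difference quotients vanish outside this unit
    neighbourhood of K; inside, the mean value theorem bounds them by the maximum of the
    derivative.\<close>
  define K' where "K' = {x + y |x y. x \<in> K \<and> y \<in> cball (0::real^'d) 1}"
  have K': "compact K'" unfolding K'_def by (intro compact_sums K compact_cball)
  have [measurable]: "f \<in> borel_measurable borel"
    by (intro borel_measurable_continuous_onI C1_continuous_on f)
  have [measurable]: "partial_deriv i f \<in> borel_measurable borel"
    by (intro borel_measurable_continuous_onI C1_continuous_on_partial_deriv f)
  obtain C where C: "0 \<le> C" "\<And>x. norm (partial_deriv i f x) \<le> C"
    using continuous_compact_support_bounded[OF C1_continuous_on_partial_deriv[OF f] K(1)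
        partial_deriv_eq_0_outside[OF compact_imp_closed[OF K(1)] K(2)]] by blast
  have int_f: "integrable lborel f"
    by (rule integrable_compact_support[OF C1_continuous_on[OF f] K])
  have int_t: "integrable lborel (\<lambda>x. f (x + c))" for c
    using int_f integrable_distr_eq[of "(+) c" lborel borel f]
    by (simp add: lborel_distr_plus add.commute)
  have eq_t: "(LINT x|lborel. f (x + c)) = (LINT x|lborel. f x)" for c
    using integral_distr[of "(+) c" lborel borel f]
    by (simp add: lborel_distr_plus add.commute)
  have bound: "norm (q n x) \<le> C * indicator K' x" for n x
  proof (cases "x \<in> K'")
    case True
    obtain s where "f (x + T n *\<^sub>R axis i 1) - f x = T n * partial_deriv i f (x + s *\<^sub>R axis i 1)"
      using C1_mvt[OF f T(1)] by blast
    then show ?thesis using True C T(1)[of n] by (simp add: q_def)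
  next
    case False
    have "x \<notin> K"
      using False unfolding K'_def by force
    moreover have "x + T n *\<^sub>R axis i 1 \<notin> K"
    proof
      assume "x + T n *\<^sub>R axis i 1 \<in> K"
      moreover have "- (T n *\<^sub>R axis i 1) \<in> cball (0::real^'d) 1"
        using T[of n] by simp
      ultimately have "(x + T n *\<^sub>R axis i 1) + - (T n *\<^sub>R axis i 1) \<in> K'"
        unfolding K'_def by blast
      with False show False by simp
    qed
    ultimately show ?thesis using K(2) False by (simp add: q_def)
  qed
  have lim: "(\<lambda>n. q n x) \<longlonglongrightarrow> partial_deriv i f x" for x
  proof -
    have "((\<lambda>h. (f (x + h *\<^sub>R axis i 1) - f x) / h) \<longlongrightarrow> partial_deriv i f x) (at 0)"
      using C1_DERIV_line[OF f, of x i 0] by (simp add: DERIV_def)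
    moreover have "filterlim T (at 0) sequentially"
      by (intro filterlim_atI T0 always_eventually) (simp add: T_def)
    ultimately show ?thesis unfolding q_def by (rule filterlim_compose)
  qed
  have "(\<lambda>n. LINT x|lborel. q n x) \<longlonglongrightarrow> (LINT x|lborel. partial_deriv i f x)"
  proof (rule integral_dominated_convergence)
    show "integrable lborel (\<lambda>x. C * indicator K' x)"
      using emeasure_compact_finite[OF K'] K' by (intro integrable_mult_right integrable_real_indicator)
        (auto simp: less_top borel_compact)
    show "q n \<in> borel_measurable lborel" for n
      unfolding q_def[abs_def] by measurable
    show "AE x in lborel. norm (q n x) \<le> C * indicator K' x" for n
      by (intro AE_I2 bound)
    show "AE x in lborel. (\<lambda>n. q n x) \<longlonglongrightarrow> partial_deriv i f x"
      by (intro AE_I2 lim)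
  qed simp
  moreover have "(LINT x|lborel. q n x) = 0" for n
    unfolding q_def by (simp add: int_f int_t eq_t)
  ultimately show ?thesis
    using LIMSEQ_unique[OF _ tendsto_const] by simp
qed

lemma integral_lebesgue_on_eq:
  assumes "S \<in> sets lebesgue" "\<And>x. x \<notin> S \<Longrightarrow> f x = 0"
  shows "(LINT x|lebesgue_on S. f x) = (LINT x|lebesgue. (f x :: 'b::euclidean_space))"
proof -
  have "(\<lambda>x. indicator S x *\<^sub>R f x) = f"
    using assms(2) by (auto simp: indicator_def)
  then show ?thesis using assms(1) by (simp add: integral_restrict_space)
qed

lemma continuous_locally_integrable:
  assumes "continuous_on UNIV f"
  shows "locally_integrable S f"
  unfolding locally_integrable_def
proof (intro allI impI)
  fix K assume K: "compact K \<and> K \<subseteq> S"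
  have "integrable lborel (\<lambda>x. indicator K x *\<^sub>R f x)"
    using K by (intro borel_integrable_compact continuous_on_subset[OF assms]) auto
  then have "integrable lebesgue (\<lambda>x. indicator K x *\<^sub>R f x)"
    by (simp add: integrable_completion borel_measurable_integrable)
  then show "integrable (lebesgue_on K) f"
    using K by (subst integrable_restrict_space) (auto simp: lmeasurable_compact fmeasurableD)
qed

text \<open>Covers all pairings in the weak formulations: a locally integrable factor against a
  bounded one that lives on a compact subset of S.\<close>

lemma integrable_inner_compact_support:
  fixes u :: "'a::euclidean_space \<Rightarrow> 'b::euclidean_space"
  assumes u: "locally_integrable S u" and \<phi>: "continuous_on UNIV \<phi>"
    and K: "compact K" "K \<subseteq> S" "\<And>x. x \<notin> K \<Longrightarrow> \<phi> x = 0" and S: "S \<in> sets lebesgue"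
  shows "integrable (lebesgue_on S) (\<lambda>x. u x \<bullet> \<phi> x)"
proof -
  obtain C where C: "0 \<le> C" "\<And>x. norm (\<phi> x) \<le> C"
    using continuous_compact_support_bounded[OF \<phi> K(1,3)] by blast
  have "integrable (lebesgue_on K) u"
    using u K by (simp add: locally_integrable_def)
  then have int: "integrable lebesgue (\<lambda>x. indicator K x *\<^sub>R u x)"
    using K by (subst (asm) integrable_restrict_space) (auto simp: lmeasurable_compact fmeasurableD)
  have [measurable]: "\<phi> \<in> borel_measurable lebesgue"
    using \<phi> by (intro measurable_completion) (auto intro: borel_measurable_continuous_onI)
  have "integrable lebesgue (\<lambda>x. (indicator K x *\<^sub>R u x) \<bullet> \<phi> x)"
  proof (rule Bochner_Integration.integrable_bound)
    show "integrable lebesgue (\<lambda>x. C * norm (indicator K x *\<^sub>R u x))"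
      using int by (intro integrable_mult_right integrable_norm)
    show "(\<lambda>x. (indicator K x *\<^sub>R u x) \<bullet> \<phi> x) \<in> borel_measurable lebesgue"
      using borel_measurable_integrable[OF int] by measurable
    show "AE x in lebesgue. norm ((indicator K x *\<^sub>R u x) \<bullet> \<phi> x) \<le> norm (C * norm (indicator K x *\<^sub>R u x))"
    proof (rule AE_I2)
      fix x
      have "norm ((indicator K x *\<^sub>R u x) \<bullet> \<phi> x) \<le> norm (indicator K x *\<^sub>R u x) * norm (\<phi> x)"
        unfolding real_norm_def by (rule Cauchy_Schwarz_ineq2)
      also have "\<dots> \<le> norm (indicator K x *\<^sub>R u x) * C"
        using C by (intro mult_left_mono) auto
      finally show "norm ((indicator K x *\<^sub>R u x) \<bullet> \<phi> x) \<le> norm (C * norm (indicator K x *\<^sub>R u x))"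
        using C by (simp add: abs_mult mult.commute)
    qed
  qed
  moreover have "(\<lambda>x. (indicator K x *\<^sub>R u x) \<bullet> \<phi> x) = (\<lambda>x. indicator S x *\<^sub>R (u x \<bullet> \<phi> x))"
  proof
    fix x show "(indicator K x *\<^sub>R u x) \<bullet> \<phi> x = indicator S x *\<^sub>R (u x \<bullet> \<phi> x)"
      using K(2) K(3)[of x] by (cases "x \<in> K") (auto simp: indicator_def)
  qed
  ultimately show ?thesis
    using S by (subst integrable_restrict_space) auto
qed

text \<open>Compact support of \<open>\<phi>\<close> passes to the product with u. The integral of
  the derivative of the product over S is therefore one over the whole space, where it
  vanishes.\<close>

lemma integration_by_parts:
  fixes u \<phi> :: "real^'d \<Rightarrow> real"
  assumes u: "C1 u" and \<phi>: "C1 \<phi>" and K: "compact K" "K \<subseteq> S" "\<And>x. x \<notin> K \<Longrightarrow> \<phi> x = 0"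
    and S: "S \<in> sets lebesgue"
  shows "integrable (lebesgue_on S) (\<lambda>x. u x * partial_deriv i \<phi> x)"
    and "integrable (lebesgue_on S) (\<lambda>x. partial_deriv i u x * \<phi> x)"
    and "(LINT x|lebesgue_on S. u x * partial_deriv i \<phi> x) = - (LINT x|lebesgue_on S. partial_deriv i u x * \<phi> x)"
proof -
  have K': "\<And>x. x \<notin> K \<Longrightarrow> partial_deriv i \<phi> x = 0"
    by (rule partial_deriv_eq_0_outside[OF compact_imp_closed[OF K(1)] K(3)])
  show i: "integrable (lebesgue_on S) (\<lambda>x. u x * partial_deriv i \<phi> x)"
    using integrable_inner_compact_support[OF continuous_locally_integrable[OF C1_continuous_on[OF u]]
        C1_continuous_on_partial_deriv[OF \<phi>] K(1,2) K' S] by simp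
  show j: "integrable (lebesgue_on S) (\<lambda>x. partial_deriv i u x * \<phi> x)"
    using integrable_inner_compact_support[OF continuous_locally_integrable[OF
        C1_continuous_on_partial_deriv[OF u]] C1_continuous_on[OF \<phi>] K S] by simp
  have "(LINT x|lebesgue_on S. u x * partial_deriv i \<phi> x) + (LINT x|lebesgue_on S. partial_deriv i u x * \<phi> x)
      = (LINT x|lebesgue_on S. partial_deriv i (\<lambda>x. u x * \<phi> x) x)"
    using i j by (simp add: partial_deriv_mult u \<phi>)
  also have "\<dots> = (LINT x|lebesgue. partial_deriv i (\<lambda>x. u x * \<phi> x) x)"
    using K K' by (intro integral_lebesgue_on_eq S) (simp add: partial_deriv_mult u \<phi> subset_iff, metis mult_eq_0_iff add_0)
  also have "\<dots> = (LINT x|lborel. partial_deriv i (\<lambda>x. u x * \<phi> x) x)"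
    by (intro integral_completion)
      (auto intro!: borel_measurable_continuous_onI C1_continuous_on_partial_deriv C1_mult u \<phi>)
  also have "\<dots> = 0"
    by (rule integral_partial_deriv_eq_0[OF C1_mult[OF u \<phi>] K(1)]) (simp add: K)
  finally show "(LINT x|lebesgue_on S. u x * partial_deriv i \<phi> x) = - (LINT x|lebesgue_on S. partial_deriv i u x * \<phi> x)"
    by simp
qed

lemma test_function_componentE:
  fixes \<psi> :: "real^'d \<Rightarrow> real^'n"
  assumes "test_function S \<psi>"
  obtains K where "compact K" "K \<subseteq> S" "\<And>x. x \<notin> K \<Longrightarrow> \<psi> x = 0" "\<And>i. C1 (\<lambda>x. \<psi> x $ i)"
    "continuous_on UNIV \<psi>" "\<And>x i j. x \<notin> K \<Longrightarrow> partial_deriv i (\<lambda>x. \<psi> x $ j) x = 0"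
proof -
  obtain K where K: "smooth_on UNIV \<psi>" "compact K" "K \<subseteq> S" "\<And>x. x \<notin> K \<Longrightarrow> \<psi> x = 0"
    using assms by (auto simp: test_function_def)
  moreover have "partial_deriv i (\<lambda>x. \<psi> x $ j) x = 0" if "x \<notin> K" for x i j
    by (rule partial_deriv_eq_0_outside[OF compact_imp_closed[OF K(2)] _ that]) (simp add: K)
  ultimately show ?thesis
    by (intro that[of K]) (auto intro: smooth_on_imp_C1 smooth_on_component smooth_on_continuous_on)
qed

lemma test_functionE:
  fixes \<phi> :: "real^'d \<Rightarrow> real"
  assumes "test_function S \<phi>"
  obtains K where "compact K" "K \<subseteq> S" "\<And>x. x \<notin> K \<Longrightarrow> \<phi> x = 0" "C1 \<phi>"
    "\<And>x i. x \<notin> K \<Longrightarrow> partial_deriv i \<phi> x = 0"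
proof -
  obtain K where K: "smooth_on UNIV \<phi>" "compact K" "K \<subseteq> S" "\<And>x. x \<notin> K \<Longrightarrow> \<phi> x = 0"
    using assms by (auto simp: test_function_def)
  moreover have "partial_deriv i \<phi> x = 0" if "x \<notin> K" for x i
    by (rule partial_deriv_eq_0_outside[OF compact_imp_closed[OF K(2)] _ that]) (simp add: K)
  ultimately show ?thesis
    by (intro that[of K]) (auto intro: smooth_on_imp_C1)
qed

lemma continuous_on_vecI:
  fixes f :: "'a::topological_space \<Rightarrow> real^'n"
  shows "(\<And>i. continuous_on S (\<lambda>x. f x $ i)) \<Longrightarrow> continuous_on S f"
  using continuous_on_vec_lambda[of S "\<lambda>i x. f x $ i"] by simp

lemma continuous_on_gradient: "C1 u \<Longrightarrow> continuous_on S (gradient u)"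
  unfolding gradient_def by (intro continuous_on_vec_lambda C1_continuous_on_partial_deriv)

lemma continuous_on_divergence: "(\<And>i. C1 (\<lambda>x. u x $ i)) \<Longrightarrow> continuous_on S (divergence u)"
  unfolding divergence_def by (intro continuous_on_sum C1_continuous_on_partial_deriv)

lemma continuous_on_curl: "(\<And>i. C1 (\<lambda>x. u x $ i)) \<Longrightarrow> continuous_on S (curl u)"
proof (rule continuous_on_vecI)
  fix i assume u: "\<And>i. C1 (\<lambda>x. u x $ i)"
  have "\<forall>i. continuous_on S (\<lambda>x. curl u x $ i)"
    unfolding forall_3 curl_def vector_3
    by (intro conjI continuous_on_diff C1_continuous_on_partial_deriv u)
  then show "continuous_on S (\<lambda>x. curl u x $ i)" ..
qed

section \<open>Classical derivatives are weak derivatives\<close>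

lemma has_weak_gradient_C1:
  assumes u: "C1 u" and S: "open S"
  shows "has_weak_gradient S u (gradient u)"
  unfolding has_weak_gradient_def
proof (intro conjI allI impI continuous_locally_integrable C1_continuous_on[OF u]
    continuous_on_gradient[OF u])
  fix \<psi> :: "real^'a \<Rightarrow> real^'a" assume "test_function S \<psi>"
  then obtain K where K: "compact K" "K \<subseteq> S" "\<And>x. x \<notin> K \<Longrightarrow> \<psi> x = 0" "\<And>i. C1 (\<lambda>x. \<psi> x $ i)"
    by (rule test_function_componentE) blast
  have "\<And>i x. x \<notin> K \<Longrightarrow> \<psi> x $ i = 0" using K by simp
  note ibp = integration_by_parts[OF u K(4) K(1,2) this open_sets_lebesgue[OF S]]
  have "(LINT x|lebesgue_on S. u x * divergence \<psi> x) =
      (LINT x|lebesgue_on S. (\<Sum>i\<in>UNIV. u x * partial_deriv i (\<lambda>x. \<psi> x $ i) x))"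
    by (simp add: divergence_def sum_distrib_left)
  also have "\<dots> = (\<Sum>i\<in>UNIV. - (LINT x|lebesgue_on S. partial_deriv i u x * \<psi> x $ i))"
    by (subst Bochner_Integration.integral_sum) (simp_all add: ibp)
  also have "\<dots> = - (LINT x|lebesgue_on S. (\<Sum>i\<in>UNIV. partial_deriv i u x * \<psi> x $ i))"
    by (subst Bochner_Integration.integral_sum) (simp_all add: ibp sum_negf)
  finally show "(LINT x|lebesgue_on S. u x * divergence \<psi> x) = - (LINT x|lebesgue_on S. gradient u x \<bullet> \<psi> x)"
    by (simp add: inner_vec_def gradient_def)
qed

lemma has_weak_divergence_C1:
  assumes u: "\<And>i. C1 (\<lambda>x. u x $ i)" and S: "open S"
  shows "has_weak_divergence S u (divergence u)"
  unfolding has_weak_divergence_def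
proof (intro conjI allI impI continuous_locally_integrable continuous_on_vecI C1_continuous_on[OF u]
    continuous_on_divergence[OF u])
  fix \<phi> :: "real^'a \<Rightarrow> real" assume "test_function S \<phi>"
  then obtain K where K: "compact K" "K \<subseteq> S" "\<And>x. x \<notin> K \<Longrightarrow> \<phi> x = 0" "C1 \<phi>"
    by (rule test_functionE) blast
  note ibp = integration_by_parts[OF u K(4) K(1,2,3) open_sets_lebesgue[OF S]]
  have "(LINT x|lebesgue_on S. u x \<bullet> gradient \<phi> x) =
      (LINT x|lebesgue_on S. (\<Sum>i\<in>UNIV. u x $ i * partial_deriv i \<phi> x))"
    by (simp add: gradient_def inner_vec_def)
  also have "\<dots> = (\<Sum>i\<in>UNIV. - (LINT x|lebesgue_on S. partial_deriv i (\<lambda>x. u x $ i) x * \<phi> x))"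
    by (subst Bochner_Integration.integral_sum) (simp_all add: ibp)
  also have "\<dots> = - (LINT x|lebesgue_on S. (\<Sum>i\<in>UNIV. partial_deriv i (\<lambda>x. u x $ i) x * \<phi> x))"
    by (subst Bochner_Integration.integral_sum) (simp_all add: ibp sum_negf)
  finally show "(LINT x|lebesgue_on S. u x \<bullet> gradient \<phi> x) = - (LINT x|lebesgue_on S. divergence u x * \<phi> x)"
    by (simp add: divergence_def sum_distrib_right)
qed

lemma has_weak_curl_C1:
  assumes u: "\<And>i. C1 (\<lambda>x. u x $ i)" and S: "open S"
  shows "has_weak_curl S u (curl u)"
  unfolding has_weak_curl_def
proof (intro conjI allI impI continuous_locally_integrable)
  show "continuous_on UNIV u" by (intro continuous_on_vecI C1_continuous_on[OF u])
  show "continuous_on UNIV (curl u)" by (intro continuous_on_curl u)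
  fix \<psi> :: "real^3 \<Rightarrow> real^3" assume "test_function S \<psi>"
  then obtain K where K: "compact K" "K \<subseteq> S" "\<And>x. x \<notin> K \<Longrightarrow> \<psi> x = 0" "\<And>i. C1 (\<lambda>x. \<psi> x $ i)"
    by (rule test_function_componentE) blast
  have "\<And>i x. x \<notin> K \<Longrightarrow> \<psi> x $ i = 0" using K by simp
  note ibp = integration_by_parts[OF u K(4) K(1,2) this open_sets_lebesgue[OF S]]
  \<comment> \<open>Named products, so that the six integrations by parts become sign changes from
    \<open>I\<close> to \<open>J\<close> and the sum regroups from the curl of the test field to the
    curl of u.\<close>
  define I where "I k i j x = u x $ k * partial_deriv i (\<lambda>x. \<psi> x $ j) x" for k i j x
  define J where "J k i j x = partial_deriv i (\<lambda>x. u x $ k) x * \<psi> x $ j" for k i j x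
  have int [simp]: "integrable (lebesgue_on S) (I k i j)" for k i j
    unfolding I_def[abs_def] by (rule ibp(1))
  have int' [simp]: "integrable (lebesgue_on S) (J k i j)" for k i j
    unfolding J_def[abs_def] by (rule ibp(2))
  have eq: "(LINT x|lebesgue_on S. I k i j x) = - (LINT x|lebesgue_on S. J k i j x)" for k i j
    unfolding I_def J_def by (rule ibp(3))
  have "(LINT x|lebesgue_on S. u x \<bullet> curl \<psi> x) = (LINT x|lebesgue_on S.
      I 1 2 3 x - I 1 3 2 x + (I 2 3 1 x - I 2 1 3 x) + (I 3 1 2 x - I 3 2 1 x))"
    by (simp add: curl_def inner_vec_def sum_3 I_def right_diff_distrib)
  also have "\<dots> = (LINT x|lebesgue_on S.
      J 3 2 1 x - J 2 3 1 x + (J 1 3 2 x - J 3 1 2 x) + (J 2 1 3 x - J 1 2 3 x))"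
    by (simp add: eq)
  also have "\<dots> = (LINT x|lebesgue_on S. curl u x \<bullet> \<psi> x)"
    by (simp add: curl_def inner_vec_def sum_3 J_def left_diff_distrib)
  finally show "(LINT x|lebesgue_on S. u x \<bullet> curl \<psi> x) = (LINT x|lebesgue_on S. curl u x \<bullet> \<psi> x)" .
qed

text \<open>The gradient, the curl and the divergence are treated at once: \<open>L\<close> is the formal adjoint acting
  on test functions, that is \<^const>\<open>divergence\<close>, \<^const>\<open>curl\<close> or \<^const>\<open>gradient\<close>, and \<open>s\<close> is the
  sign in the integration by parts formula.\<close>

definition weak_deriv :: "(('a::euclidean_space \<Rightarrow> 'c::euclidean_space) \<Rightarrow> 'a \<Rightarrow> 'b::euclidean_space) \<Rightarrow>
    real \<Rightarrow> 'a set \<Rightarrow> ('a \<Rightarrow> 'b) \<Rightarrow> ('a \<Rightarrow> 'c) \<Rightarrow> bool" where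
  "weak_deriv L s S u w \<longleftrightarrow> locally_integrable S u \<and> locally_integrable S w \<and>
     (\<forall>\<psi>. test_function S \<psi> \<longrightarrow>
        (LINT x|lebesgue_on S. u x \<bullet> L \<psi> x) = s * (LINT x|lebesgue_on S. w x \<bullet> \<psi> x))"

text \<open>What the unified arguments use of L: \<open>\<psi>\<close> and \<open>L \<psi>\<close>
  are continuous and vanish outside a common compact subset of S. This makes both integrals in
  \<open>weak_deriv\<close> finite and insensitive to enlarging S.\<close>

definition local_operator ::
    "(('a::euclidean_space \<Rightarrow> 'c::euclidean_space) \<Rightarrow> 'a \<Rightarrow> 'b::euclidean_space) \<Rightarrow> bool" where
  "local_operator L \<longleftrightarrow> (\<forall>S \<psi>. test_function S \<psi> \<longrightarrow> (\<exists>K. compact K \<and> K \<subseteq> S \<and>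
     continuous_on UNIV \<psi> \<and> continuous_on UNIV (L \<psi>) \<and> (\<forall>x. x \<notin> K \<longrightarrow> \<psi> x = 0 \<and> L \<psi> x = 0)))"

lemma has_weak_gradient_eq: "has_weak_gradient = weak_deriv divergence (-1)"
  by (simp add: fun_eq_iff has_weak_gradient_def weak_deriv_def)

lemma has_weak_curl_eq: "has_weak_curl = weak_deriv curl 1"
  by (simp add: fun_eq_iff has_weak_curl_def weak_deriv_def)

lemma has_weak_divergence_eq: "has_weak_divergence = weak_deriv gradient (-1)"
  by (simp add: fun_eq_iff has_weak_divergence_def weak_deriv_def)

lemma local_operator_divergence: "local_operator (divergence :: (real^'d \<Rightarrow> real^'d) \<Rightarrow> _)"
  unfolding local_operator_def
proof (intro allI impI)
  fix S and \<psi> :: "real^'d \<Rightarrow> real^'d" assume "test_function S \<psi>"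
  then obtain K where K: "compact K" "K \<subseteq> S" "\<And>x. x \<notin> K \<Longrightarrow> \<psi> x = 0" "\<And>i. C1 (\<lambda>x. \<psi> x $ i)"
     "continuous_on UNIV \<psi>" "\<And>x i j. x \<notin> K \<Longrightarrow> partial_deriv i (\<lambda>x. \<psi> x $ j) x = 0"
    by (rule test_function_componentE) blast
  with continuous_on_divergence[OF K(4)]
  show "\<exists>K. compact K \<and> K \<subseteq> S \<and> continuous_on UNIV \<psi> \<and> continuous_on UNIV (divergence \<psi>) \<and>
      (\<forall>x. x \<notin> K \<longrightarrow> \<psi> x = 0 \<and> divergence \<psi> x = 0)"
    by (intro exI[of _ K]) (simp add: divergence_def)
qed

lemma local_operator_curl: "local_operator curl"
  unfolding local_operator_def
proof (intro allI impI)
  fix S and \<psi> :: "real^3 \<Rightarrow> real^3" assume "test_function S \<psi>"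
  then obtain K where K: "compact K" "K \<subseteq> S" "\<And>x. x \<notin> K \<Longrightarrow> \<psi> x = 0" "\<And>i. C1 (\<lambda>x. \<psi> x $ i)"
     "continuous_on UNIV \<psi>" "\<And>x i j. x \<notin> K \<Longrightarrow> partial_deriv i (\<lambda>x. \<psi> x $ j) x = 0"
    by (rule test_function_componentE) blast
  with continuous_on_curl[OF K(4)]
  show "\<exists>K. compact K \<and> K \<subseteq> S \<and> continuous_on UNIV \<psi> \<and> continuous_on UNIV (curl \<psi>) \<and>
      (\<forall>x. x \<notin> K \<longrightarrow> \<psi> x = 0 \<and> curl \<psi> x = 0)"
    by (intro exI[of _ K]) (simp add: curl_def vec_eq_iff forall_3)
qed

lemma local_operator_gradient: "local_operator (gradient :: (real^'d \<Rightarrow> real) \<Rightarrow> _)"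
  unfolding local_operator_def
proof (intro allI impI)
  fix S and \<phi> :: "real^'d \<Rightarrow> real" assume "test_function S \<phi>"
  then obtain K where K: "compact K" "K \<subseteq> S" "\<And>x. x \<notin> K \<Longrightarrow> \<phi> x = 0" "C1 \<phi>"
     "\<And>x i. x \<notin> K \<Longrightarrow> partial_deriv i \<phi> x = 0"
    by (rule test_functionE) blast
  with continuous_on_gradient[OF K(4)] C1_continuous_on[OF K(4)]
  show "\<exists>K. compact K \<and> K \<subseteq> S \<and> continuous_on UNIV \<phi> \<and> continuous_on UNIV (gradient \<phi>) \<and>
      (\<forall>x. x \<notin> K \<longrightarrow> \<phi> x = 0 \<and> gradient \<phi> x = 0)"
    by (intro exI[of _ K]) (simp add: gradient_def vec_eq_iff)
qed

lemma local_operatorE: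
  assumes "local_operator L" "test_function S \<psi>"
  obtains K where "compact K" "K \<subseteq> S" "continuous_on UNIV \<psi>" "continuous_on UNIV (L \<psi>)"
    "\<And>x. x \<notin> K \<Longrightarrow> \<psi> x = 0" "\<And>x. x \<notin> K \<Longrightarrow> L \<psi> x = 0"
  using assms unfolding local_operator_def by metis

text \<open>The two defining identities are subtracted; splitting the integrals is where the compact
  supports enter.\<close>

lemma weak_deriv_diff:
  fixes L :: "('a::euclidean_space \<Rightarrow> 'c::euclidean_space) \<Rightarrow> 'a \<Rightarrow> 'b::euclidean_space"
  assumes L: "local_operator L" and w: "weak_deriv L s S u G" "weak_deriv L s S v H" and S: "open S"
  shows "weak_deriv L s S (\<lambda>x. u x - v x) (\<lambda>x. G x - H x)"
  unfolding weak_deriv_def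
proof (intro conjI allI impI)
  fix \<psi> :: "'a \<Rightarrow> 'c" assume \<psi>: "test_function S \<psi>"
  obtain K where K: "compact K" "K \<subseteq> S" "continuous_on UNIV \<psi>" "continuous_on UNIV (L \<psi>)"
    "\<And>x. x \<notin> K \<Longrightarrow> \<psi> x = 0" "\<And>x. x \<notin> K \<Longrightarrow> L \<psi> x = 0"
    by (rule local_operatorE[OF L \<psi>]) blast
  note i = integrable_inner_compact_support[OF _ K(3) K(1,2,5) open_sets_lebesgue[OF S]]
    integrable_inner_compact_support[OF _ K(4) K(1,2,6) open_sets_lebesgue[OF S]]
  show "(LINT x|lebesgue_on S. (u x - v x) \<bullet> L \<psi> x) = s * (LINT x|lebesgue_on S. (G x - H x) \<bullet> \<psi> x)"
    using w \<psi> by (simp add: weak_deriv_def inner_diff_left i right_diff_distrib)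
qed (use w in \<open>simp_all add: weak_deriv_def locally_integrable_def\<close>)

lemma locally_integrable_cong:
  "(\<And>x. x \<in> S \<Longrightarrow> u x = v x) \<Longrightarrow> locally_integrable S u \<longleftrightarrow> locally_integrable S v"
  unfolding locally_integrable_def
  by (intro all_cong1 imp_cong refl Bochner_Integration.integrable_cong) auto

text \<open>Permits exchanging functions that agree on D only, such as a function and its extension
  by zero.\<close>

lemma weak_deriv_cong:
  assumes "\<And>x. x \<in> S \<Longrightarrow> u x = v x"
  shows "weak_deriv L s S u G \<longleftrightarrow> weak_deriv L s S v G"
proof -
  have "(LINT x|lebesgue_on S. u x \<bullet> L \<psi> x) = (LINT x|lebesgue_on S. v x \<bullet> L \<psi> x)" for \<psi>
    using assms by (auto intro!: Bochner_Integration.integral_cong)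
  moreover have "locally_integrable S u \<longleftrightarrow> locally_integrable S v"
    using assms by (rule locally_integrable_cong)
  ultimately show ?thesis unfolding weak_deriv_def by simp
qed

text \<open>A test function on S is one on the whole space, and its support inside S makes the
  integrals agree. This provides the derivative on D of the limit function, and that of the average
  at \<delta> = 0.\<close>

lemma weak_deriv_subset:
  fixes L :: "('a::euclidean_space \<Rightarrow> 'c::euclidean_space) \<Rightarrow> 'a \<Rightarrow> 'b::euclidean_space"
  assumes L: "local_operator L" and w: "weak_deriv L s UNIV u G" and S: "open S"
  shows "weak_deriv L s S u G"
  unfolding weak_deriv_def
proof (intro conjI allI impI)
  fix \<psi> :: "'a \<Rightarrow> 'c" assume \<psi>: "test_function S \<psi>"
  obtain K where K: "K \<subseteq> S" "\<And>x. x \<notin> K \<Longrightarrow> \<psi> x = 0" "\<And>x. x \<notin> K \<Longrightarrow> L \<psi> x = 0"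
    by (rule local_operatorE[OF L \<psi>]) blast
  have "(LINT x|lebesgue_on S. u x \<bullet> L \<psi> x) = (LINT x|lebesgue. u x \<bullet> L \<psi> x)"
    "(LINT x|lebesgue_on S. G x \<bullet> \<psi> x) = (LINT x|lebesgue. G x \<bullet> \<psi> x)"
    using K by (auto intro!: integral_lebesgue_on_eq open_sets_lebesgue S simp: subset_eq)
  moreover have "test_function UNIV \<psi>" using \<psi> unfolding test_function_def by blast
  ultimately show "(LINT x|lebesgue_on S. u x \<bullet> L \<psi> x) = s * (LINT x|lebesgue_on S. G x \<bullet> \<psi> x)"
    using w by (simp add: weak_deriv_def lebesgue_on_UNIV_eq)
qed (use w in \<open>auto simp: weak_deriv_def locally_integrable_def\<close>)

section \<open>Mollification of integrable functions\<close>

definition conv :: "real \<Rightarrow> ('a::euclidean_space \<Rightarrow> 'b::euclidean_space) \<Rightarrow> 'a \<Rightarrow> 'b" where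
  "conv e F c = (LINT z|lebesgue. scaled_mollifier e c z *\<^sub>R F z)"

text \<open>The transformation theorem for separate scalings of the coordinates, specialised to a
  common factor e.\<close>

lemma
  fixes c :: "'a::euclidean_space"
  assumes e: "e \<noteq> 0"
  shows lebesgue_affine: "lebesgue = density (distr lebesgue lebesgue (\<lambda>y. c + e *\<^sub>R y))
      (\<lambda>_. ennreal (\<bar>e\<bar> ^ DIM('a)))"
    and measurable_affine: "(\<lambda>y. c + e *\<^sub>R y) \<in> lebesgue \<rightarrow>\<^sub>M lebesgue"
proof -
  have eq: "(\<Sum>j\<in>Basis. (e * (y \<bullet> j)) *\<^sub>R j) = e *\<^sub>R y" for y :: 'a
    by (simp add: scaleR_scaleR[symmetric] scaleR_sum_right[symmetric] euclidean_representation
        del: scaleR_scaleR)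
  show "lebesgue = density (distr lebesgue lebesgue (\<lambda>y. c + e *\<^sub>R y))
      (\<lambda>_. ennreal (\<bar>e\<bar> ^ DIM('a)))"
    using lebesgue_affine_euclidean[of "\<lambda>_::'a. e" c] e by (simp add: eq ennreal_power)
  show "(\<lambda>y. c + e *\<^sub>R y) \<in> lebesgue \<rightarrow>\<^sub>M lebesgue"
    using lebesgue_affine_measurable[of "\<lambda>_::'a. e" c] e by (simp add: eq)
qed

lemma scaled_mollifier_measurable [measurable]: "scaled_mollifier e c \<in> borel_measurable borel"
  unfolding scaled_mollifier_def[abs_def] by measurable

lemma scaled_mollifier_measurable_lebesgue [measurable]:
  "scaled_mollifier e c \<in> borel_measurable lebesgue"
  by (rule measurable_completion) simp

text \<open>Substitution z = c + e y; the Jacobian factor cancels the power of e in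
  \<open>scaled_mollifier\<close>. The dependence on c moves from F into the kernel, where it can be
  differentiated. Measurability of F suffices, because both integrals take the default value 0 when
  their integrands are not integrable.\<close>

lemma conv_eq:
  fixes F :: "'a::euclidean_space \<Rightarrow> 'b::euclidean_space"
  assumes e: "e > 0" and [measurable]: "F \<in> borel_measurable lebesgue"
  shows "(LINT y|lebesgue. mollifier y *\<^sub>R F (c + e *\<^sub>R y)) = conv e F c"
proof -
  have [measurable]: "(\<lambda>y. c + e *\<^sub>R y) \<in> lebesgue \<rightarrow>\<^sub>M lebesgue"
    using e by (intro measurable_affine) simp
  have "conv e F c = (LINT z|density (distr lebesgue lebesgue (\<lambda>y. c + e *\<^sub>R y))
      (\<lambda>_. ennreal (\<bar>e\<bar> ^ DIM('a))). scaled_mollifier e c z *\<^sub>R F z)"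
    using e lebesgue_affine[of e c] by (simp add: conv_def)
  also have "\<dots> = (LINT z|distr lebesgue lebesgue (\<lambda>y. c + e *\<^sub>R y).
      (\<bar>e\<bar> ^ DIM('a)) *\<^sub>R scaled_mollifier e c z *\<^sub>R F z)"
    by (rule integral_density) (use e in simp_all)
  also have "\<dots> = (LINT y|lebesgue. (\<bar>e\<bar> ^ DIM('a)) *\<^sub>R
      scaled_mollifier e c (c + e *\<^sub>R y) *\<^sub>R F (c + e *\<^sub>R y))"
    by (rule integral_distr) simp_all
  also have "\<dots> = (LINT y|lebesgue. mollifier y *\<^sub>R F (c + e *\<^sub>R y))"
    using e by (simp add: scaled_mollifier_def)
  finally show ?thesis by simp
qed

lemma integrable_scaleR_bounded:
  fixes F :: "'a::euclidean_space \<Rightarrow> 'b::euclidean_space"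
  assumes F: "integrable lebesgue F" and [measurable]: "g \<in> borel_measurable lebesgue"
    and C: "\<And>x. norm (g x) \<le> C"
  shows "integrable lebesgue (\<lambda>x. g x *\<^sub>R F x)"
proof (rule Bochner_Integration.integrable_bound)
  show "integrable lebesgue (\<lambda>x. C * norm (F x))"
    using F by (intro integrable_mult_right integrable_norm)
  show "(\<lambda>x. g x *\<^sub>R F x) \<in> borel_measurable lebesgue"
    using borel_measurable_integrable[OF F] by measurable
  have "0 \<le> C" using C norm_ge_zero order_trans by blast
  then show "AE x in lebesgue. norm (g x *\<^sub>R F x) \<le> norm (C * norm (F x))"
    using C by (auto simp: abs_mult intro!: AE_I2 mult_right_mono)
qed

lemma integrable_scaled_mollifier:
  fixes F :: "'a::euclidean_space \<Rightarrow> 'b::euclidean_space"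
  assumes F: "locally_integrable UNIV F" and e: "e > 0"
  shows "integrable lebesgue (\<lambda>z. scaled_mollifier e c z *\<^sub>R F z)"
proof -
  have t: "smooth_on UNIV (scaled_mollifier e c)"
    using test_function_scaled_mollifier[OF e, of c] by (simp add: test_function_def)
  obtain C where C: "\<And>z. norm (scaled_mollifier e c z) \<le> C"
    using continuous_compact_support_bounded[OF smooth_on_continuous_on[OF t] compact_cball[of c e]
        scaled_mollifier_eq_0[OF e]] by blast
  have "integrable (lebesgue_on (cball c e)) F"
    using F by (simp add: locally_integrable_def)
  then have "integrable lebesgue (\<lambda>z. indicator (cball c e) z *\<^sub>R F z)"
    by (subst (asm) integrable_restrict_space) auto
  from integrable_scaleR_bounded[OF this scaled_mollifier_measurable_lebesgue C]
  have "integrable lebesgue (\<lambda>z. scaled_mollifier e c z *\<^sub>R indicator (cball c e) z *\<^sub>R F z)" .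
  moreover have "(\<lambda>z. scaled_mollifier e c z *\<^sub>R indicator (cball c e) z *\<^sub>R F z) =
      (\<lambda>z. scaled_mollifier e c z *\<^sub>R F z)"
    using scaled_mollifier_eq_0[OF e, of _ c] by (auto simp: fun_eq_iff indicator_def)
  ultimately show ?thesis by (simp del: scaleR_scaleR)
qed

lemma conv_component:
  fixes F :: "'a::euclidean_space \<Rightarrow> real^'n"
  assumes "locally_integrable UNIV F" "e > 0"
  shows "conv e F c $ i = conv e (\<lambda>z. F z $ i) c"
  unfolding conv_def
  using integral_bounded_linear[OF bounded_linear_vec_nth integrable_scaled_mollifier[OF assms]]
  by simp

text \<open>For points at distance below 1, either both lie in the compact unit neighbourhood of K
  or g vanishes at both.\<close>

lemma continuous_compact_support_uniform:
  fixes g :: "'a::euclidean_space \<Rightarrow> real"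
  assumes g: "continuous_on UNIV g" and K: "compact K" "\<And>x. x \<notin> K \<Longrightarrow> g x = 0" and "0 < \<epsilon>"
  obtains r where "0 < r" "\<And>x y. norm (x - y) < r \<Longrightarrow> \<bar>g x - g y\<bar> \<le> \<epsilon>"
proof -
  define K' where "K' = {x + y |x y. x \<in> K \<and> y \<in> cball (0::'a) 1}"
  have "compact K'" unfolding K'_def by (intro compact_sums K compact_cball)
  then have "uniformly_continuous_on K' g"
    by (intro compact_uniformly_continuous continuous_on_subset[OF g]) auto
  then obtain r where r: "r > 0" "\<And>x y. x \<in> K' \<Longrightarrow> y \<in> K' \<Longrightarrow> dist y x < r \<Longrightarrow> dist (g y) (g x) < \<epsilon>"
    using \<open>0 < \<epsilon>\<close> unfolding uniformly_continuous_on_def by metis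
  have in_K': "x \<in> K'" if "x \<in> K \<or> y \<in> K" "norm (x - y) < 1" for x y
  proof -
    have "x = x + 0" "x = y + (x - y)" by simp_all
    then show ?thesis using that unfolding K'_def by fastforce
  qed
  have "\<bar>g x - g y\<bar> \<le> \<epsilon>" if "norm (x - y) < min r 1" for x y
  proof (cases "x \<in> K \<or> y \<in> K")
    case True
    then have "x \<in> K'" "y \<in> K'"
      using that in_K'[of x y] in_K'[of y x] by (auto simp: norm_minus_commute)
    then show ?thesis using r(2)[of y x] that by (simp add: dist_norm)
  next
    case False
    then show ?thesis using K(2) \<open>0 < \<epsilon>\<close> by simp
  qed
  with r(1) show ?thesis by (intro that[of "min r 1"]) auto
qed

section \<open>Differentiation of an integral against a translated kernel\<close>

context
  fixes g :: "real^'d \<Rightarrow> real" and K and F :: "real^'d \<Rightarrow> real"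
  assumes K: "compact K" "\<And>x. x \<notin> K \<Longrightarrow> g x = 0" and F: "integrable lebesgue F"
begin

lemma integrable_translated_kernel:
  assumes g: "continuous_on UNIV g"
  shows "integrable lebesgue (\<lambda>z. g (z - c) * F z)"
proof -
  obtain C where C: "\<And>z. norm (g z) \<le> C"
    using continuous_compact_support_bounded[OF g K] by blast
  have "(\<lambda>z. g (z - c)) \<in> borel_measurable lebesgue"
    by (intro measurable_completion)
      (auto intro!: borel_measurable_continuous_onI continuous_on_compose2[OF g] continuous_intros)
  from integrable_scaleR_bounded[OF F this C] show ?thesis by simp
qed

lemma continuous_translated_kernel:
  assumes g: "continuous_on UNIV g"
  shows "continuous_on UNIV (\<lambda>c. LINT z|lebesgue. g (z - c) * F z)"
proof -
  define I where "I = (LINT z|lebesgue. \<bar>F z\<bar>)"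
  have I: "I \<ge> 0" unfolding I_def by (rule Bochner_Integration.integral_nonneg) simp
  have "\<exists>r>0. \<forall>c'. dist c' c < r \<longrightarrow> dist (LINT z|lebesgue. g (z - c') * F z) (LINT z|lebesgue. g (z - c) * F z) < \<epsilon>"
    if "\<epsilon> > 0" for c \<epsilon>
  proof -
    \<comment> \<open>The increment is bounded by the modulus of continuity of g times I; dividing
      by I + 1 covers I = 0.\<close>
    have "\<epsilon> / (I + 1) > 0" using that I by simp
    then obtain r where r: "r > 0" "\<And>x y. norm (x - y) < r \<Longrightarrow> \<bar>g x - g y\<bar> \<le> \<epsilon> / (I + 1)"
      using continuous_compact_support_uniform[OF g K] by blast
    have "dist (LINT z|lebesgue. g (z - c') * F z) (LINT z|lebesgue. g (z - c) * F z) < \<epsilon>"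
      if "dist c' c < r" for c'
    proof -
      have "dist (LINT z|lebesgue. g (z - c') * F z) (LINT z|lebesgue. g (z - c) * F z)
          = \<bar>LINT z|lebesgue. (g (z - c') - g (z - c)) * F z\<bar>"
        by (simp add: dist_real_def left_diff_distrib integrable_translated_kernel[OF g])
      also have "\<dots> \<le> (LINT z|lebesgue. \<epsilon> / (I + 1) * \<bar>F z\<bar>)"
      proof (rule integral_abs_bound_integral)
        show "integrable lebesgue (\<lambda>z. (g (z - c') - g (z - c)) * F z)"
          by (simp add: left_diff_distrib integrable_translated_kernel[OF g])
        show "integrable lebesgue (\<lambda>z. \<epsilon> / (I + 1) * \<bar>F z\<bar>)"
          using F by (intro integrable_mult_right integrable_abs)
        show "\<bar>(g (z - c') - g (z - c)) * F z\<bar> \<le> \<epsilon> / (I + 1) * \<bar>F z\<bar>" for z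
          unfolding abs_mult using that r(2)[of "z - c'" "z - c"]
          by (intro mult_right_mono) (auto simp: dist_norm norm_minus_commute)
      qed
      also have "\<dots> = \<epsilon> / (I + 1) * I" by (simp add: I_def)
      also have "\<dots> < \<epsilon>" using \<open>\<epsilon> > 0\<close> I by (simp add: field_simps)
      finally show ?thesis .
    qed
    with r(1) show ?thesis by blast
  qed
  then show ?thesis by (auto simp: continuous_on_iff)
qed

end

text \<open>The mean value theorem on the segment from w to w - h. The plus sign before the sum
  reflects that z - c moves against c. Uniformity in w is what allows integration over z
  afterwards.\<close>

lemma C1_linearization:
  fixes g :: "real^'d \<Rightarrow> real"
  assumes g: "C1 g" and r: "\<And>i x y. norm (x - y) < r \<Longrightarrow> \<bar>partial_deriv i g x - partial_deriv i g y\<bar> \<le> \<epsilon>"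
    and h: "norm h < r"
  shows "\<bar>g (w - h) - g w + (\<Sum>i\<in>UNIV. partial_deriv i g w * h $ i)\<bar> \<le> real CARD('d) * \<epsilon> * norm h"
proof -
  let ?D = "\<lambda>x. \<Sum>i\<in>UNIV. partial_deriv i g x * h $ i"
  have der: "((\<lambda>s. g (w - s *\<^sub>R h)) has_real_derivative - ?D (w - s *\<^sub>R h)) (at s)" for s
  proof -
    have "((\<lambda>s. w - s *\<^sub>R h) has_derivative (\<lambda>t. t *\<^sub>R (- h))) (at s)"
      by (auto intro!: derivative_eq_intros)
    from has_derivative_compose[OF this C1_has_derivative[OF g]]
    have "((\<lambda>s. g (w - s *\<^sub>R h)) has_derivative
        (\<lambda>t. t * frechet_derivative g (at (w - s *\<^sub>R h)) (- h))) (at s)"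
      using linear_cmul[OF has_derivative_linear[OF C1_has_derivative[OF g]]] by (simp del: scaleR_minus_right)
    moreover have "frechet_derivative g (at (w - s *\<^sub>R h)) (- h) = - ?D (w - s *\<^sub>R h)"
      by (subst frechet_derivative_eq_partial_deriv[OF C1_has_derivative[OF g]]) (simp add: sum_negf)
    ultimately show ?thesis
      unfolding has_field_derivative_def by (auto elim!: has_derivative_eq_rhs simp: fun_eq_iff)
  qed
  obtain s where s: "0 < s" "s < 1" "g (w - 1 *\<^sub>R h) - g (w - 0 *\<^sub>R h) = (1 - 0) * - ?D (w - s *\<^sub>R h)"
    using MVT2[of 0 1 "\<lambda>s. g (w - s *\<^sub>R h)", OF _ der] by auto
  have "norm (w - (w - s *\<^sub>R h)) < r"
    using s h by (simp add: order_le_less_trans[OF mult_left_le_one_le])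
  then have b: "\<bar>partial_deriv i g w - partial_deriv i g (w - s *\<^sub>R h)\<bar> \<le> \<epsilon>" for i
    by (rule r)
  have "0 \<le> \<epsilon>" using b abs_ge_zero order_trans by blast
  have "g (w - h) - g w + ?D w = (\<Sum>i\<in>UNIV. (partial_deriv i g w - partial_deriv i g (w - s *\<^sub>R h)) * h $ i)"
    using s(3) by (simp add: left_diff_distrib sum_subtractf)
  also have "\<bar>\<dots>\<bar> \<le> (\<Sum>i\<in>(UNIV::'d set). \<epsilon> * norm h)"
    using b \<open>0 \<le> \<epsilon>\<close> component_le_norm_cart
    by (intro order_trans[OF sum_abs] sum_mono) (auto simp: abs_mult intro!: mult_mono)
  finally show ?thesis by (simp add: mult.assoc)
qed

text \<open>The uniform linearization of g, multiplied by F and integrated, bounds the remainder by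
  a small multiple of the integral of |F|. This yields the total derivative, not only the partial
  ones.\<close>

lemma
  fixes g F :: "real^'d \<Rightarrow> real"
  assumes g: "C1 g" and K: "compact K" "\<And>x. x \<notin> K \<Longrightarrow> g x = 0" and F: "integrable lebesgue F"
  shows C1_translated_kernel: "C1 (\<lambda>c. LINT z|lebesgue. g (z - c) * F z)"
    and partial_deriv_translated_kernel: "partial_deriv i (\<lambda>c. LINT z|lebesgue. g (z - c) * F z) c =
      - (LINT z|lebesgue. partial_deriv i g (z - c) * F z)"
proof -
  have K': "partial_deriv i g x = 0" if "x \<notin> K" for i x
    by (rule partial_deriv_eq_0_outside[OF compact_imp_closed[OF K(1)] K(2) that])
  note int = integrable_translated_kernel[OF K F C1_continuous_on[OF g]]
  note int' = integrable_translated_kernel[OF K(1) K' F C1_continuous_on_partial_deriv[OF g]]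
  define M where "M c = (LINT z|lebesgue. g (z - c) * F z)" for c
  define N where "N i c = (LINT z|lebesgue. partial_deriv i g (z - c) * F z)" for i c
  define I where "I = (LINT z|lebesgue. \<bar>F z\<bar>)"
  have I: "I \<ge> 0" unfolding I_def by (rule Bochner_Integration.integral_nonneg) simp
  have der: "(M has_derivative (\<lambda>h. - (\<Sum>i\<in>UNIV. N i c * h $ i))) (at c)" for c
    unfolding has_derivative_at_alt
  proof (intro conjI allI impI)
    show "bounded_linear (\<lambda>h. - (\<Sum>i\<in>UNIV. N i c * h $ i))"
      by (intro bounded_linear_minus bounded_linear_sum bounded_linear_const_mult bounded_linear_vec_nth)
    fix \<epsilon> :: real assume "\<epsilon> > 0"
    \<comment> \<open>Each of the d coordinates contributes once, and the integral of |F| is I; I +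
      1 again avoids division by 0.\<close>
    define \<epsilon>' where "\<epsilon>' = \<epsilon> / (CARD('d) * (I + 1))"
    have \<epsilon>': "\<epsilon>' > 0" using \<open>\<epsilon> > 0\<close> I by (simp add: \<epsilon>'_def)
    have "\<forall>i. \<exists>r>0. \<forall>x y. norm (x - y) < r \<longrightarrow> \<bar>partial_deriv i g x - partial_deriv i g y\<bar> \<le> \<epsilon>'"
      using continuous_compact_support_uniform[OF C1_continuous_on_partial_deriv[OF g] K(1) K' \<epsilon>'] by metis
    then obtain R where R: "\<And>i. R i > 0"
      "\<And>i x y. norm (x - y) < R i \<Longrightarrow> \<bar>partial_deriv i g x - partial_deriv i g y\<bar> \<le> \<epsilon>'" by metis
    define r where "r = Min (range R)"
    have "r > 0" using R(1) by (simp add: r_def)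
    have r: "\<bar>partial_deriv i g x - partial_deriv i g y\<bar> \<le> \<epsilon>'" if "norm (x - y) < r" for i x y
      using that by (intro R(2)) (simp add: r_def)
    have "norm (M y - M c - - (\<Sum>i\<in>UNIV. N i c * (y - c) $ i)) \<le> \<epsilon> * norm (y - c)"
      if y: "norm (y - c) < r" for y
    proof -
      let ?R = "\<lambda>z. g (z - c - (y - c)) - g (z - c) + (\<Sum>i\<in>UNIV. partial_deriv i g (z - c) * (y - c) $ i)"
      have R_eq: "?R z * F z = g (z - y) * F z - g (z - c) * F z
          + (\<Sum>i\<in>UNIV. (partial_deriv i g (z - c) * F z) * (y - c) $ i)" for z
        by (simp only: distrib_right left_diff_distrib sum_distrib_right) (simp add: mult_ac)
      have iR: "integrable lebesgue (\<lambda>z. ?R z * F z)"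
        unfolding R_eq by (intro Bochner_Integration.integrable_add Bochner_Integration.integrable_diff
            Bochner_Integration.integrable_sum integrable_mult_left int int')
      have "M y - M c - - (\<Sum>i\<in>UNIV. N i c * (y - c) $ i) = (LINT z|lebesgue. ?R z * F z)"
        unfolding R_eq by (simp add: M_def N_def int int' Bochner_Integration.integral_sum)
      also have "norm \<dots> \<le> (LINT z|lebesgue. (real CARD('d) * \<epsilon>' * norm (y - c)) * \<bar>F z\<bar>)"
        unfolding real_norm_def
      proof (rule integral_abs_bound_integral[OF iR])
        show "integrable lebesgue (\<lambda>z. (real CARD('d) * \<epsilon>' * norm (y - c)) * \<bar>F z\<bar>)"
          using F by (intro integrable_mult_right integrable_abs)
        show "\<bar>?R z * F z\<bar> \<le> (real CARD('d) * \<epsilon>' * norm (y - c)) * \<bar>F z\<bar>" for z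
          unfolding abs_mult by (intro mult_right_mono C1_linearization[OF g r y]) auto
      qed
      also have "\<dots> = \<epsilon> * norm (y - c) * (I / (I + 1))"
        by (simp add: I_def[symmetric] \<epsilon>'_def)
      also have "\<dots> \<le> \<epsilon> * norm (y - c) * 1"
        using I \<open>\<epsilon> > 0\<close> by (intro mult_left_mono) auto
      finally show ?thesis by simp
    qed
    with \<open>r > 0\<close> show "\<exists>d>0. \<forall>y. norm (y - c) < d \<longrightarrow>
        norm (M y - M c - - (\<Sum>i\<in>UNIV. N i c * (y - c) $ i)) \<le> \<epsilon> * norm (y - c)" by blast
  qed
  have eq: "- (\<Sum>j\<in>UNIV. N j c * axis i 1 $ j) = - N i c" for i c
    by (simp add: axis_def if_distrib sum.delta cong: if_cong)
  have "C1 M"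
    by (rule C1_I[OF der], unfold eq, unfold N_def)
      (intro continuous_on_minus continuous_translated_kernel[OF K(1) K' F] C1_continuous_on_partial_deriv[OF g])
  then show "C1 (\<lambda>c. LINT z|lebesgue. g (z - c) * F z)" by (simp add: M_def[abs_def])
  show "partial_deriv i (\<lambda>c. LINT z|lebesgue. g (z - c) * F z) c =
      - (LINT z|lebesgue. partial_deriv i g (z - c) * F z)"
    using partial_deriv_eq[OF der, of i c] unfolding eq unfolding M_def[abs_def] N_def .
qed

lemma scaled_mollifier_translate: "scaled_mollifier e c z = scaled_mollifier e 0 (z - c)"
  by (simp add: scaled_mollifier_def)

lemma C1_scaled_mollifier: "e > 0 \<Longrightarrow> C1 (scaled_mollifier e c)"
  using test_function_scaled_mollifier smooth_on_imp_C1 by (auto simp: test_function_def)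

lemma partial_deriv_scaled_mollifier:
  assumes "e > 0"
  shows "partial_deriv i (scaled_mollifier e c) z = partial_deriv i (scaled_mollifier e 0) (z - c)"
proof -
  have "((\<lambda>z. z - c) has_derivative (\<lambda>h. h)) (at z)"
    by (auto intro!: derivative_eq_intros)
  from partial_deriv_eq[OF has_derivative_compose[OF this C1_has_derivative[OF C1_scaled_mollifier[OF assms, of 0]]]]
  moreover have "(\<lambda>x. scaled_mollifier e 0 (x - c)) = scaled_mollifier e c"
    by (simp add: fun_eq_iff scaled_mollifier_def)
  ultimately show ?thesis
    by (simp add: partial_deriv_def)
qed

text \<open>The centre enters the kernel through z - c, whence the minus sign when the derivative is
  taken in z instead.\<close>

lemma
  fixes F :: "real^'d \<Rightarrow> real"
  assumes e: "e > 0" and F: "integrable lebesgue F"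
  shows C1_conv: "C1 (conv e F)"
    and partial_deriv_conv:
      "partial_deriv i (conv e F) c = - (LINT z|lebesgue. F z * partial_deriv i (scaled_mollifier e c) z)"
    and integrable_partial_deriv_scaled_mollifier:
      "integrable lebesgue (\<lambda>z. F z * partial_deriv i (scaled_mollifier e c) z)"
proof -
  have eq: "conv e F = (\<lambda>c. LINT z|lebesgue. scaled_mollifier e 0 (z - c) * F z)"
    by (simp add: conv_def[abs_def] scaled_mollifier_translate[symmetric])
  note K = C1_scaled_mollifier[OF e, of 0] compact_cball[of 0 e] scaled_mollifier_eq_0[OF e, of _ 0]
  have K': "partial_deriv i (scaled_mollifier e 0) z = 0" if "z \<notin> cball 0 e" for i and z :: "real^'d"
    by (rule partial_deriv_eq_0_outside[OF closed_cball _ that]) (rule K(3))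
  show "C1 (conv e F)"
    unfolding eq by (rule C1_translated_kernel[OF K F])
  show "partial_deriv i (conv e F) c = - (LINT z|lebesgue. F z * partial_deriv i (scaled_mollifier e c) z)"
    using partial_deriv_translated_kernel[OF K F, of i c]
    by (simp add: partial_deriv_scaled_mollifier[OF e, of i c] eq mult.commute)
  show "integrable lebesgue (\<lambda>z. F z * partial_deriv i (scaled_mollifier e c) z)"
    using integrable_translated_kernel[OF compact_cball[of 0 e] K' F C1_continuous_on_partial_deriv[OF K(1)]]
    by (simp add: partial_deriv_scaled_mollifier[OF e, of i c] mult.commute)
qed

text \<open>The test field is the kernel times the i-th unit vector, whose divergence is the i-th
  derivative of the kernel. The sign from differentiating in the centre cancels the one in the
  definition of the weak gradient.\<close>

lemma gradient_conv:
  fixes u :: "real^'d \<Rightarrow> real"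
  assumes w: "has_weak_gradient UNIV u G" and e: "e > 0" and u: "integrable lebesgue u"
  shows "gradient (conv e u) c = conv e G c"
proof -
  have G: "locally_integrable UNIV G" using w by (simp add: has_weak_gradient_def)
  have "partial_deriv i (conv e u) c = conv e G c $ i" for i
  proof -
    let ?\<psi> = "\<lambda>z. scaled_mollifier e c z *\<^sub>R axis i (1::real)"
    have "partial_deriv j (\<lambda>z. ?\<psi> z $ j) z = partial_deriv j (scaled_mollifier e c) z * axis i 1 $ j" for j z
      using partial_deriv_mult[OF C1_scaled_mollifier[OF e] C1_const, of j c "axis i 1 $ j" z]
      by (simp add: partial_deriv_const)
    then have "divergence ?\<psi> z = (\<Sum>j\<in>UNIV. partial_deriv j (scaled_mollifier e c) z * axis i 1 $ j)" for z
      by (simp only: divergence_def)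
    then have "divergence ?\<psi> z = partial_deriv i (scaled_mollifier e c) z" for z
      by (simp add: axis_def if_distrib sum.delta cong: if_cong)
    moreover have "(LINT z|lebesgue. u z * divergence ?\<psi> z) = - (LINT z|lebesgue. G z \<bullet> ?\<psi> z)"
      using w test_function_scaled_mollifier_scaleR[OF e, of c "axis i 1"]
      unfolding has_weak_gradient_def lebesgue_on_UNIV_eq by blast
    ultimately show ?thesis
      unfolding partial_deriv_conv[OF e u] conv_component[OF G e]
      by (simp add: conv_def inner_axis mult.commute)
  qed
  then show ?thesis by (simp add: gradient_def vec_eq_iff)
qed

text \<open>Here the kernel itself is the test function; again two minus signs cancel.\<close>

lemma divergence_conv:
  fixes v :: "real^'d \<Rightarrow> real^'d"
  assumes w: "has_weak_divergence UNIV v w" and e: "e > 0" and v: "\<And>i. integrable lebesgue (\<lambda>z. v z $ i)"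
  shows "(\<Sum>i\<in>UNIV. partial_deriv i (conv e (\<lambda>z. v z $ i)) c) = conv e w c"
proof -
  have "(LINT z|lebesgue. v z \<bullet> gradient (scaled_mollifier e c) z) =
      - (LINT z|lebesgue. w z * scaled_mollifier e c z)"
    using w test_function_scaled_mollifier[OF e, of c]
    by (simp add: has_weak_divergence_def lebesgue_on_UNIV_eq)
  moreover have "(LINT z|lebesgue. v z \<bullet> gradient (scaled_mollifier e c) z) =
      (\<Sum>i\<in>UNIV. LINT z|lebesgue. v z $ i * partial_deriv i (scaled_mollifier e c) z)"
    by (simp add: inner_vec_def gradient_def Bochner_Integration.integral_sum
        integrable_partial_deriv_scaled_mollifier[OF e v])
  ultimately show ?thesis
    by (simp add: partial_deriv_conv[OF e v] conv_def mult.commute sum_negf)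
qed

text \<open>The i-th component results from testing with the kernel times the i-th unit vector. The
  weak curl carries no sign, and the minus from differentiating in the centre is absorbed by the
  antisymmetry of the curl.\<close>

lemma curl_conv:
  fixes v w :: "real^3 \<Rightarrow> real^3"
  assumes w: "has_weak_curl UNIV v w" and e: "e > 0" and v: "\<And>i. integrable lebesgue (\<lambda>z. v z $ i)"
  shows "curl (\<lambda>c. \<chi> i. conv e (\<lambda>z. v z $ i) c) c = conv e w c"
proof -
  have W: "locally_integrable UNIV w" using w by (simp add: has_weak_curl_def)
  define s where "s j z = partial_deriv j (scaled_mollifier e c) z" for j z
  note int = integrable_partial_deriv_scaled_mollifier[OF e v, of _ _ c, folded s_def]
  have dpsi: "partial_deriv j (\<lambda>z. (scaled_mollifier e c z *\<^sub>R axis i (1::real)) $ l) z = s j z * axis i 1 $ l"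
    for i j l :: 3 and z
    using partial_deriv_mult[OF C1_scaled_mollifier[OF e] C1_const, of j c "axis i 1 $ l" z]
    by (simp add: partial_deriv_const s_def)
  have key: "(LINT z|lebesgue. v z \<bullet> curl (\<lambda>z. scaled_mollifier e c z *\<^sub>R axis i 1) z) = conv e w c $ i" for i
  proof -
    have "(LINT z|lebesgue. v z \<bullet> curl (\<lambda>z. scaled_mollifier e c z *\<^sub>R axis i 1) z) =
        (LINT z|lebesgue. w z \<bullet> scaled_mollifier e c z *\<^sub>R axis i 1)"
      using w test_function_scaled_mollifier_scaleR[OF e, of c "axis i 1"]
      unfolding has_weak_curl_def lebesgue_on_UNIV_eq by blast
    then show ?thesis
      unfolding conv_component[OF W e] by (simp add: conv_def inner_axis)
  qed
  have "\<forall>i. curl (\<lambda>c. \<chi> i. conv e (\<lambda>z. v z $ i) c) c $ i = conv e w c $ i"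
    unfolding key[symmetric] curl_def dpsi forall_3
    by (simp add: inner_vec_def sum_3 axis_def partial_deriv_conv[OF e v] s_def[symmetric] int)
  then show ?thesis by (simp add: vec_eq_iff)
qed

section \<open>Transformation of derivatives under the shift\<close>

lemma
  fixes l :: "'d::finite"
  shows C1_component: "C1 (\<lambda>x::real^'d. x $ l)"
    and partial_deriv_component: "partial_deriv i (\<lambda>x::real^'d. x $ l) x = (if i = l then 1 else 0)"
proof -
  have d: "((\<lambda>x::real^'d. x $ l) has_derivative (\<lambda>h. h $ l)) (at x)" for x
    by (rule bounded_linear_imp_has_derivative[OF bounded_linear_vec_nth])
  show "C1 (\<lambda>x::real^'d. x $ l)" by (rule C1_I[OF d]) simp
  show "partial_deriv i (\<lambda>x::real^'d. x $ l) x = (if i = l then 1 else 0)"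
    using partial_deriv_eq[OF d] by (simp add: axis_def)
qed

context
  fixes k :: "real^'d \<Rightarrow> real^'d" and \<delta> :: real
  assumes k: "smooth_on UNIV k"
begin

lemma C1_k: "C1 (\<lambda>x. k x $ l)"
  by (intro smooth_on_imp_C1 smooth_on_component k)

lemma C1_partial_deriv_k: "C1 (partial_deriv i (\<lambda>x. k x $ l))"
  by (intro smooth_on_imp_C1 smooth_on_component smooth_on_partial_deriv k)

lemma C1_shift_map: "C1 (\<lambda>x. shift_map k \<delta> x $ l)"
  unfolding shift_map_def by (auto intro!: C1_add C1_mult C1_const C1_component C1_k)

lemma partial_deriv_shift_map:
  "partial_deriv i (\<lambda>x. shift_map k \<delta> x $ l) =
     (\<lambda>x. (if i = l then 1 else 0) + \<delta> * partial_deriv i (\<lambda>x. k x $ l) x)"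
proof
  fix x
  show "partial_deriv i (\<lambda>x. shift_map k \<delta> x $ l) x =
      (if i = l then 1 else 0) + \<delta> * partial_deriv i (\<lambda>x. k x $ l) x"
    unfolding shift_map_def
    by (simp add: partial_deriv_add[OF C1_component C1_mult[OF C1_const C1_k]]
        partial_deriv_mult[OF C1_const C1_k] partial_deriv_component partial_deriv_const)
qed

lemma C1_partial_deriv_shift_map: "C1 (partial_deriv i (\<lambda>x. shift_map k \<delta> x $ l))"
  unfolding partial_deriv_shift_map by (intro C1_add C1_mult C1_const C1_partial_deriv_k)

lemma partial_deriv_shift_map_commute:
  "partial_deriv i (partial_deriv j (\<lambda>x. shift_map k \<delta> x $ l)) x =
   partial_deriv j (partial_deriv i (\<lambda>x. shift_map k \<delta> x $ l)) x"
  by (intro partial_deriv_commute C1_shift_map C1_partial_deriv_shift_map)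

lemma shift_jacobian_component:
  "shift_jacobian k \<delta> x $ l $ i = partial_deriv i (\<lambda>x. shift_map k \<delta> x $ l) x"
  by (simp add: shift_jacobian_def jacobian_def matrix_def partial_deriv_def
      frechet_derivative_at[OF has_derivative_vec_C1[OF C1_shift_map], symmetric])

text \<open>The chain rule sums over the rows of the Jacobian, hence the transpose.\<close>

lemma gradient_shift:
  assumes "C1 M"
  shows "gradient (\<lambda>x. M (shift_map k \<delta> x)) x =
    transpose (shift_jacobian k \<delta> x) *v gradient M (shift_map k \<delta> x)"
  by (simp add: vec_eq_iff gradient_def matrix_vector_mult_def transpose_def shift_jacobian_component
      partial_deriv_compose[OF assms C1_shift_map] mult.commute)

end

section \<open>Adjugate and determinant of 3 x 3 matrices\<close>

definition adjugate3 :: "real^3^3 \<Rightarrow> real^3^3" where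
  "adjugate3 A = vector
     [vector [A$2$2 * A$3$3 - A$2$3 * A$3$2, A$1$3 * A$3$2 - A$1$2 * A$3$3, A$1$2 * A$2$3 - A$1$3 * A$2$2],
      vector [A$2$3 * A$3$1 - A$2$1 * A$3$3, A$1$1 * A$3$3 - A$1$3 * A$3$1, A$1$3 * A$2$1 - A$1$1 * A$2$3],
      vector [A$2$1 * A$3$2 - A$2$2 * A$3$1, A$1$2 * A$3$1 - A$1$1 * A$3$2, A$1$1 * A$2$2 - A$1$2 * A$2$1]]"

lemma adjugate3_mult: "A ** adjugate3 A = det A *\<^sub>R mat 1"
  by (simp add: vec_eq_iff matrix_matrix_mult_def sum_3 forall_3 adjugate3_def det_3 mat_def algebra_simps)

text \<open>The adjugate is polynomial in the entries, so it can be differentiated and expanded in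
  \<delta> directly, in contrast to the inverse.\<close>

lemma det_matrix_inv_eq_adjugate3:
  assumes "invertible A"
  shows "det A *\<^sub>R matrix_inv A = adjugate3 A"
proof -
  have "matrix_inv A ** A = mat 1"
    using someI_ex[OF assms[unfolded invertible_def]] by (simp add: matrix_inv_def)
  then have "adjugate3 A = matrix_inv A ** A ** adjugate3 A"
    by simp
  also have "\<dots> = matrix_inv A ** (det A *\<^sub>R mat 1)"
    by (simp add: matrix_mul_assoc[symmetric] adjugate3_mult)
  also have "\<dots> = det A *\<^sub>R matrix_inv A"
    by (simp add: vec_eq_iff matrix_matrix_mult_def mat_def sum_3 forall_3)
  finally show ?thesis by simp
qed

text \<open>An exact polynomial in t without remainder. With N the derivative of k and t = \<delta>
  it shows that the adjugate of the Jacobian is the identity up to O(\<delta>).\<close>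

lemma adjugate3_perturbation:
  "adjugate3 (mat 1 + t *\<^sub>R N) = mat 1 + t *\<^sub>R (trace N *\<^sub>R mat 1 - N) + t\<^sup>2 *\<^sub>R adjugate3 N"
  by (simp add: vec_eq_iff forall_3 adjugate3_def trace_def sum_3 mat_def algebra_simps power2_eq_square)

lemma det_perturbation:
  "det (mat 1 + t *\<^sub>R N :: real^3^3) = 1 + t * trace N + t\<^sup>2 * trace (adjugate3 N) + t^3 * det N"
  by (simp add: det_3 adjugate3_def trace_def sum_3 mat_def algebra_simps power2_eq_square power3_eq_cube)

context
  fixes k :: "real^3 \<Rightarrow> real^3" and \<delta> :: real and M :: "real^3 \<Rightarrow> real^3"
  assumes k: "smooth_on UNIV k" and M: "\<And>l. C1 (\<lambda>x. M x $ l)"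
begin

lemma C1_covariant: "C1 (\<lambda>x. (transpose (shift_jacobian k \<delta> x) *v M (shift_map k \<delta> x)) $ i)"
  by (simp add: matrix_vector_mult_def transpose_def shift_jacobian_component[OF k])
    (intro C1_sum C1_mult C1_partial_deriv_shift_map[OF k] C1_compose[OF M C1_shift_map[OF k]])

text \<open>Symmetry of the second derivatives of the shift does the work in both formulas. In the
  curl, the terms with second derivatives are symmetric in the two indices and cancel in pairs,
  which leaves 2 x 2 minors, that is, entries of the adjugate. In the divergence, they cancel within
  each column of the adjugate, and the product of the matrix with its adjugate leaves the
  determinant.\<close>

lemma
  shows curl_covariant:
      "curl (\<lambda>x. transpose (shift_jacobian k \<delta> x) *v M (shift_map k \<delta> x)) x =
        adjugate3 (shift_jacobian k \<delta> x) *v curl M (shift_map k \<delta> x)"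
    and C1_contravariant: "C1 (\<lambda>x. (adjugate3 (shift_jacobian k \<delta> x) *v M (shift_map k \<delta> x)) $ i)"
    and divergence_contravariant:
      "divergence (\<lambda>x. adjugate3 (shift_jacobian k \<delta> x) *v M (shift_map k \<delta> x)) x =
        det (shift_jacobian k \<delta> x) * divergence M (shift_map k \<delta> x)"
proof -
  define a where "a l i x = partial_deriv i (\<lambda>x. shift_map k \<delta> x $ l) x" for l i x
  define m where "m l x = M (shift_map k \<delta> x) $ l" for l x
  have C1_a: "C1 (a l i)" for l i
    using C1_partial_deriv_shift_map[OF k] by (simp add: a_def[abs_def])
  have C1_m: "C1 (m l)" for l
    unfolding m_def[abs_def] by (rule C1_compose[OF M C1_shift_map[OF k]])
  have jac: "shift_jacobian k \<delta> x $ l $ i = a l i x" for x l i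
    by (simp add: shift_jacobian_component[OF k] a_def)
  have dm: "partial_deriv j (m l) x = (\<Sum>n\<in>UNIV. partial_deriv n (\<lambda>x. M x $ l) (shift_map k \<delta> x) * a n j x)" for j l
    unfolding m_def[abs_def] a_def by (rule partial_deriv_compose[OF M C1_shift_map[OF k]])
  have da: "partial_deriv j (a l i) x = partial_deriv i (a l j) x" for i j l
    using partial_deriv_shift_map_commute[OF k] by (simp add: a_def[abs_def])
  have d: "partial_deriv j (\<lambda>x. (transpose (shift_jacobian k \<delta> x) *v M (shift_map k \<delta> x)) $ i) x =
      (\<Sum>l\<in>UNIV. a l i x * partial_deriv j (m l) x + partial_deriv j (a l i) x * m l x)" for i j
    by (simp add: matrix_vector_mult_def transpose_def jac m_def[symmetric]
        partial_deriv_sum C1_mult C1_a C1_m partial_deriv_mult)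
  show "curl (\<lambda>x. transpose (shift_jacobian k \<delta> x) *v M (shift_map k \<delta> x)) x =
      adjugate3 (shift_jacobian k \<delta> x) *v curl M (shift_map k \<delta> x)"
    \<comment> \<open>The symmetry \<open>da\<close> enters only in the instances that lower the
      index of the outer derivative, so that rewriting terminates in a normal form.\<close>
    unfolding curl_def d dm da[of 2 _ 1] da[of 3 _ 1] da[of 3 _ 2]
    by (simp add: vec_eq_iff forall_3 adjugate3_def matrix_vector_mult_def sum_3 jac algebra_simps)
  define b where "b i l x = adjugate3 (shift_jacobian k \<delta> x) $ i $ l" for i l x
  have b: "\<forall>i l. C1 (b i l)"
    unfolding forall_3 b_def[abs_def] adjugate3_def
    by (simp add: jac C1_diff C1_mult C1_a)
  then have C1_b: "C1 (b i l)" for i l by blast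
  have eq: "(\<lambda>x. (adjugate3 (shift_jacobian k \<delta> x) *v M (shift_map k \<delta> x)) $ i) = (\<lambda>x. \<Sum>l\<in>UNIV. b i l x * m l x)" for i
    by (simp add: matrix_vector_mult_def b_def m_def)
  show "C1 (\<lambda>x. (adjugate3 (shift_jacobian k \<delta> x) *v M (shift_map k \<delta> x)) $ i)"
    unfolding eq by (intro C1_sum C1_mult C1_b C1_m)
  \<comment> \<open>Piola's identity: each column of the adjugate of a Jacobian is divergence
    free.\<close>
  have piola: "(\<Sum>i\<in>UNIV. partial_deriv i (b i l) x) = 0" for l
  proof -
    have "\<forall>l. (\<Sum>i\<in>UNIV. partial_deriv i (b i l) x) = 0"
      unfolding forall_3 b_def[abs_def] adjugate3_def
      by (simp add: jac sum_3 partial_deriv_diff partial_deriv_mult C1_mult C1_a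
          da[of 2 _ 1] da[of 3 _ 1] da[of 3 _ 2] algebra_simps)
    then show ?thesis by blast
  qed
  have "divergence (\<lambda>x. adjugate3 (shift_jacobian k \<delta> x) *v M (shift_map k \<delta> x)) x
      = (\<Sum>i\<in>UNIV. \<Sum>l\<in>UNIV. b i l x * partial_deriv i (m l) x + partial_deriv i (b i l) x * m l x)"
    unfolding divergence_def eq by (simp add: partial_deriv_sum C1_mult C1_b C1_m partial_deriv_mult)
  also have "\<dots> = (\<Sum>i\<in>UNIV. \<Sum>l\<in>UNIV. b i l x * partial_deriv i (m l) x)
      + (\<Sum>l\<in>UNIV. (\<Sum>i\<in>UNIV. partial_deriv i (b i l) x) * m l x)"
    by (simp add: sum.distrib sum_distrib_right sum.swap[of "\<lambda>i l. partial_deriv i (b i l) x * m l x"])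
  also have "\<dots> = (\<Sum>i\<in>UNIV. \<Sum>l\<in>UNIV. b i l x * partial_deriv i (m l) x)"
    by (simp add: piola)
  also have "\<dots> = det (shift_jacobian k \<delta> x) * divergence M (shift_map k \<delta> x)"
    by (simp add: dm b_def adjugate3_def sum_3 jac det_3 divergence_def algebra_simps)
  finally show "divergence (\<lambda>x. adjugate3 (shift_jacobian k \<delta> x) *v M (shift_map k \<delta> x)) x =
        det (shift_jacobian k \<delta> x) * divergence M (shift_map k \<delta> x)" .
qed

end

section \<open>Change of variables inequality for the shift\<close>

text \<open>The change of variables theorems of the library require a well-ordered index type, whereas
  here the index type of \<open>real^'d\<close> is only finite; covering by small cubes avoids them.\<close>

lemma measure_preimage_expanding_le:
  fixes f :: "'a::euclidean_space \<Rightarrow> 'a"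
  assumes L: "0 \<le> L" "\<And>x y. x \<in> P \<Longrightarrow> y \<in> P \<Longrightarrow> norm (x - y) \<le> L * norm (f x - f y)"
    and A: "A \<in> lmeasurable" "A \<subseteq> cbox (- (R *\<^sub>R One)) (R *\<^sub>R One)" and "0 < R"
    and meas: "P \<inter> f -` A \<in> sets lebesgue"
  shows "emeasure lebesgue (P \<inter> f -` A) \<le> ennreal ((2 * L * DIM('a)) ^ DIM('a) * measure lebesgue A)"
proof (rule ennreal_le_epsilon)
  let ?d = "DIM('a)"
  define c where "c = (2 * L * ?d) ^ ?d"
  have c: "0 \<le> c" using L(1) by (simp add: c_def)
  fix e0 :: real assume "0 < e0"
  \<comment> \<open>The factor c + 1 keeps c times e below \<open>e0\<close> also when c =
    0.\<close>
  define e where "e = e0 / (c + 1)"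
  have e: "0 < e" "c * e \<le> e0"
    using c \<open>0 < e0\<close> by (auto simp: e_def field_simps)
  \<comment> \<open>The members are cubes with edge 2 R / 2^n, because the surrounding box is itself
    a cube.\<close>
  obtain \<D> where \<D>: "countable \<D>"
    "\<And>K. K \<in> \<D> \<Longrightarrow> K \<subseteq> cbox (- (R *\<^sub>R One)) (R *\<^sub>R One) \<and> K \<noteq> {} \<and> (\<exists>c d. K = cbox c d)"
    "pairwise (\<lambda>A B. interior A \<inter> interior B = {}) \<D>"
    "\<And>u v. cbox u v \<in> \<D> \<Longrightarrow> \<exists>n. \<forall>i\<in>(Basis::'a set). v \<bullet> i - u \<bullet> i = ((R *\<^sub>R One) \<bullet> i - (- (R *\<^sub>R One)) \<bullet> i) / 2 ^ n"
    "A \<subseteq> \<Union>\<D>" "\<Union>\<D> \<in> lmeasurable" "measure lebesgue (\<Union>\<D>) \<le> measure lebesgue A + e"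
    using measurable_outer_intervals_bounded[OF A e(1)] by metis
  have cover: "\<exists>Q. Q \<in> lmeasurable \<and> P \<inter> f -` K \<subseteq> Q \<and> measure lebesgue Q \<le> c * measure lebesgue K"
    if KD: "K \<in> \<D>" for K
  proof (cases "P \<inter> f -` K = {}")
    case True
    then show ?thesis using c by (intro exI[of _ "{}"]) auto
  next
    case False
    then obtain x where x: "x \<in> P" "f x \<in> K" by blast
    obtain u v where K: "K = cbox u v" using \<D>(2)[OF KD] by blast
    then obtain n where n: "\<And>i. i \<in> Basis \<Longrightarrow> v \<bullet> i - u \<bullet> i = 2 * R / 2 ^ n"
      using \<D>(4)[of u v] KD by auto
    define t where "t = 2 * R / 2 ^ n"
    have t: "t > 0" using \<open>0 < R\<close> by (simp add: t_def)
    have n: "v \<bullet> i - u \<bullet> i = t" if "i \<in> Basis" for i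
      using n[OF that] by (simp add: t_def)
    \<comment> \<open>Two points of P with images in a cube of edge t have images at distance at
      most d t, so they lie within L d t of each other. A cube of edge 2 L d t about one such point
      x contains them all, and the ratio of the volumes is c.\<close>
    define Q where "Q = cbox (x - (L * ?d * t) *\<^sub>R One) (x + (L * ?d * t) *\<^sub>R One)"
    have "P \<inter> f -` K \<subseteq> Q"
    proof
      fix y assume y: "y \<in> P \<inter> f -` K"
      have "norm (f y - f x) \<le> (\<Sum>i\<in>Basis. \<bar>(f y - f x) \<bullet> i\<bar>)"
        by (rule norm_le_l1)
      also have "\<dots> \<le> (\<Sum>i\<in>(Basis::'a set). t)"
      proof (rule sum_mono)
        fix i :: 'a assume i: "i \<in> Basis"
        have "u \<bullet> i \<le> f x \<bullet> i" "f x \<bullet> i \<le> v \<bullet> i" "u \<bullet> i \<le> f y \<bullet> i" "f y \<bullet> i \<le> v \<bullet> i"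
          using x y i by (auto simp: K mem_box)
        then show "\<bar>(f y - f x) \<bullet> i\<bar> \<le> t"
          using n[OF i] by (simp add: inner_diff_left)
      qed
      also have "\<dots> = ?d * t" by simp
      finally have "norm (y - x) \<le> L * (?d * t)"
        using L(2)[of y x] x y mult_left_mono[OF _ L(1)] order_trans by blast
      then have "\<bar>(y - x) \<bullet> i\<bar> \<le> L * ?d * t" if "i \<in> Basis" for i
        using Basis_le_norm[OF that, of "y - x"] by (simp add: mult.assoc)
      then show "y \<in> Q"
        unfolding Q_def mem_box by (auto simp: inner_diff_left inner_add_left abs_le_iff diff_le_eq add.commute)
    qed
    moreover have "measure lebesgue Q = c * measure lebesgue K"
    proof -
      have "u \<bullet> i \<le> v \<bullet> i" if "i \<in> Basis" for i
        using n[OF that] t by simp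
      moreover have "(\<Prod>i\<in>Basis. (v - u) \<bullet> i) = (\<Prod>i\<in>(Basis::'a set). t)"
        using n by (intro prod.cong) (auto simp: inner_diff_left)
      ultimately have "measure lebesgue K = t ^ ?d"
        by (simp add: K content_cbox)
      moreover have "measure lebesgue Q = (2 * L * ?d * t) ^ ?d"
        using L(1) t by (simp add: Q_def content_cbox inner_diff_left inner_add_left algebra_simps)
      ultimately show ?thesis by (simp add: c_def power_mult_distrib)
    qed
    ultimately show ?thesis by (intro exI[of _ Q]) (auto simp: Q_def)
  qed
  then obtain Q where Q: "\<And>K. K \<in> \<D> \<Longrightarrow> Q K \<in> lmeasurable" "\<And>K. K \<in> \<D> \<Longrightarrow> P \<inter> f -` K \<subseteq> Q K"
    "\<And>K. K \<in> \<D> \<Longrightarrow> measure lebesgue (Q K) \<le> c * measure lebesgue K" by metis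
  \<comment> \<open>Distinct cubes have disjoint interiors, so their volumes add up over finite
    subfamilies; the countable union inherits the bound as a limit.\<close>
  have fin: "measure lebesgue (\<Union>K\<in>\<E>. Q K) \<le> c * (measure lebesgue A + e)"
    if \<E>: "finite \<E>" "\<E> \<subseteq> \<D>" for \<E>
  proof -
    have box: "\<exists>c d. K = cbox c d" if "K \<in> \<E>" for K using \<D>(2) \<E> that by blast
    have "measure lebesgue (\<Union>K\<in>\<E>. Q K) \<le> (\<Sum>K\<in>\<E>. measure lebesgue (Q K))"
      using \<E> Q(1) by (intro measure_UNION_le) auto
    also have "\<dots> \<le> (\<Sum>K\<in>\<E>. c * measure lebesgue K)"
      using \<E> Q(3) by (intro sum_mono) auto
    also have "\<dots> = c * measure lebesgue (\<Union>\<E>)"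
    proof -
      have "measure lebesgue (\<Union>\<E>) = (\<Sum>K\<in>\<E>. measure lebesgue K)"
      proof (rule measure_negligible_finite_Union[OF \<E>(1)])
        show "K \<in> lmeasurable" if "K \<in> \<E>" for K using box[OF that] by auto
        show "pairwise (\<lambda>S T. negligible (S \<inter> T)) \<E>"
        proof (rule pairwiseI)
          fix S T assume ST: "S \<in> \<E>" "T \<in> \<E>" "S \<noteq> T"
          then have "interior (S \<inter> T) = {}"
            using \<D>(3) \<E>(2) by (auto simp: pairwise_def)
          moreover have "convex (S \<inter> T)"
            using box[OF ST(1)] box[OF ST(2)] by (auto intro: convex_Int convex_box)
          ultimately show "negligible (S \<inter> T)"
            using negligible_convex_interior by blast
        qed
      qed
      then show ?thesis by (simp add: sum_distrib_left)
    qed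
    also have "\<dots> \<le> c * measure lebesgue (\<Union>\<D>)"
    proof (intro mult_left_mono c measure_mono_fmeasurable \<D>(6))
      show "\<Union>\<E> \<subseteq> \<Union>\<D>" using \<E> by blast
      show "\<Union>\<E> \<in> sets lebesgue" 
      proof (intro sets.finite_Union \<E>(1) subsetI)
        fix K assume "K \<in> \<E>"
        then obtain c d where "K = cbox c d" using box by blast
        then show "K \<in> sets lebesgue" by simp
      qed
    qed
    also have "\<dots> \<le> c * (measure lebesgue A + e)"
      by (intro mult_left_mono c \<D>(7))
    finally show ?thesis .
  qed
  have sub: "P \<inter> f -` A \<subseteq> (\<Union>K\<in>\<D>. Q K)"
    using \<D>(5) Q(2) by fastforce
  have l: "(\<Union>K\<in>\<D>. Q K) \<in> lmeasurable \<and> measure lebesgue (\<Union>K\<in>\<D>. Q K) \<le> c * (measure lebesgue A + e)"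
  proof (cases "\<D> = {}")
    case True
    then show ?thesis using c e(1) by simp
  next
    case False
    let ?S = "\<lambda>n. Q (from_nat_into \<D> n)"
    have eq: "(\<Union>K\<in>\<D>. Q K) = (\<Union>n. ?S n)"
      using range_from_nat_into[OF False \<D>(1)] by (metis image_image)
    have S: "?S n \<in> lmeasurable" for n by (intro Q(1) from_nat_into False)
    have "measure lebesgue (\<Union>i\<le>n. ?S i) \<le> c * (measure lebesgue A + e)" for n
      using fin[of "from_nat_into \<D> ` {..n}"] from_nat_into[OF False] by (auto simp: image_image)
    then show ?thesis unfolding eq
      using fmeasurable_countable_Union[of ?S, OF S] measure_countable_Union_le[of ?S, OF S] by blast
  qed
  have "emeasure lebesgue (P \<inter> f -` A) \<le> emeasure lebesgue (\<Union>K\<in>\<D>. Q K)"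
    using l by (intro emeasure_mono sub) auto
  also have "\<dots> \<le> ennreal (c * (measure lebesgue A + e))"
    using l by (auto intro!: ennreal_leI simp: emeasure_eq_measure2)
  also have "ennreal (c * (measure lebesgue A + e)) \<le> ennreal (c * measure lebesgue A + e0)"
    using e by (intro ennreal_leI) (simp add: distrib_left)
  also have "\<dots> = ennreal (c * measure lebesgue A) + ennreal e0"
    using c \<open>0 < e0\<close> by (intro ennreal_plus) auto
  finally show "emeasure lebesgue (P \<inter> f -` A) \<le> ennreal ((2 * L * ?d) ^ ?d * measure lebesgue A) + ennreal e0"
    by (simp add: c_def)
qed

text \<open>The Jacobian bound is stated at \<open>\<delta>\<^sub>0\<close>, the largest parameter:
  the perturbation is linear in \<delta>, so this bound carries those for all smaller
  parameters.\<close>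

locale averaging =
  fixes D :: "(real^'d) set" and k :: "real^'d \<Rightarrow> real^'d" and \<zeta> \<delta>\<^sub>0 :: real
  assumes open_D: "open D" and bounded_D: "bounded D" and smooth_k: "smooth_on UNIV k"
    and \<zeta>: "0 < \<zeta>" and \<delta>\<^sub>0: "0 < \<delta>\<^sub>0" "\<delta>\<^sub>0 \<le> 1"
    and jacobian_close: "\<And>x. x \<in> D \<Longrightarrow> matrix_norm (shift_jacobian k \<delta>\<^sub>0 x - mat 1) \<le> 1 / 2"
begin

lemma shift_jacobian_eq:
  "shift_jacobian k \<delta> x = mat 1 + \<delta> *\<^sub>R (\<chi> l i. partial_deriv i (\<lambda>x. k x $ l) x)"
  by (simp add: vec_eq_iff shift_jacobian_component[OF smooth_k] partial_deriv_shift_map[OF smooth_k] mat_def)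

lemma k_has_derivative: "(k has_derivative (*v) (\<chi> l i. partial_deriv i (\<lambda>x. k x $ l) x)) (at x)"
proof -
  have "(\<lambda>h. \<chi> m. frechet_derivative (\<lambda>x. k x $ m) (at x) h) =
      (*v) (\<chi> l i. partial_deriv i (\<lambda>x. k x $ l) x)"
    by (auto simp: fun_eq_iff vec_eq_iff matrix_vector_mult_def
        frechet_derivative_eq_partial_deriv[OF C1_has_derivative[OF C1_k[OF smooth_k]]])
  with has_derivative_vec_C1[OF C1_k[OF smooth_k]] show ?thesis by metis
qed

lemma continuous_on_k: "continuous_on S k"
  using k_has_derivative by (meson continuous_at_imp_continuous_on has_derivative_continuous)

text \<open>The derivative of k is at most 1/(2 \<open>\<delta>\<^sub>0\<close>) on D and, by
  uniform continuity, at most 3/(4 \<open>\<delta>\<^sub>0\<close>) on balls of a fixed radius about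
  points of D, even where these leave D. Balls are convex, so \<delta> k has Lipschitz constant 3/4
  on them and the shift keeps at least a quarter of each distance.\<close>

lemma locally_expanding:
  obtains r where "0 < r" "\<And>c x y \<delta>. c \<in> D \<Longrightarrow> \<delta> \<in> {0..\<delta>\<^sub>0} \<Longrightarrow> x \<in> ball c r \<Longrightarrow> y \<in> ball c r \<Longrightarrow>
    norm (x - y) \<le> 4 * norm (shift_map k \<delta> x - shift_map k \<delta> y)"
proof -
  define N :: "real^'d \<Rightarrow> real^'d^'d" where "N x = (\<chi> l i. partial_deriv i (\<lambda>x. k x $ l) x)" for x
  define S where "S = {x + y |x y. x \<in> closure D \<and> y \<in> cball (0::real^'d) 1}"
  have S: "compact S"
    unfolding S_def using bounded_D by (intro compact_sums compact_cball) (simp add: compact_closure)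
  \<comment> \<open>Entries that vary by at most \<open>\<eta>\<close> change the operator norm by
    at most d^2 times \<open>\<eta>\<close>, which is 1/(4 \<open>\<delta>\<^sub>0\<close>), the gap
    between the bound on D and the bound on the balls.\<close>
  define \<eta> where "\<eta> = 1 / (4 * \<delta>\<^sub>0 * (CARD('d) * CARD('d)))"
  have \<eta>: "\<eta> > 0" using \<delta>\<^sub>0 by (simp add: \<eta>_def)
  \<comment> \<open>The pair p addresses an entry of the derivative of k: row \<open>fst p\<close>,
    column \<open>snd p\<close>.\<close>
  have "\<exists>r>0. \<forall>x\<in>S. \<forall>y\<in>S. dist x y < r \<longrightarrow> dist (partial_deriv (snd p) (\<lambda>x. k x $ fst p) x) (partial_deriv (snd p) (\<lambda>x. k x $ fst p) y) < \<eta>" for p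
    using compact_uniformly_continuous[OF C1_continuous_on_partial_deriv[OF C1_k[OF smooth_k]] S] \<eta>
    unfolding uniformly_continuous_on_def by (metis dist_commute)
  then obtain R where R: "\<And>p. R p > 0"
    "\<And>p x y. x \<in> S \<Longrightarrow> y \<in> S \<Longrightarrow> dist x y < R p \<Longrightarrow>
      dist (partial_deriv (snd p) (\<lambda>x. k x $ fst p) x) (partial_deriv (snd p) (\<lambda>x. k x $ fst p) y) < \<eta>" by metis
  define r where "r = min 1 (Min (range R))"
  have r: "r > 0" "r \<le> 1" "\<And>p. r \<le> R p" using R(1) by (auto simp: r_def min.coboundedI2)
  have in_S: "x \<in> S" if "c \<in> D" "x \<in> ball c r" for c x
  proof -
    have "x = c + (x - c)" "c \<in> closure D" "x - c \<in> cball 0 1"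
      using that r(2) closure_subset by (auto simp: dist_norm norm_minus_commute)
    then show ?thesis unfolding S_def by blast
  qed
  have N: "onorm ((*v) (N x)) \<le> 3 / (4 * \<delta>\<^sub>0)" if c: "c \<in> D" and x: "x \<in> ball c r" for c x
  proof -
    have "onorm ((*v) (N x - N c)) \<le> real CARD('d) * real CARD('d) * \<eta>"
    proof (rule onorm_le_matrix_component)
      fix i j
      have "dist x c < R (i, j)" using x r(3)[of "(i, j)"] by (simp add: dist_commute)
      with R(2)[of x c "(i, j)"] in_S[OF c x] in_S[OF c, of c] r(1)
      show "\<bar>(N x - N c) $ i $ j\<bar> \<le> \<eta>" by (simp add: N_def dist_real_def)
    qed
    also have "\<dots> = 1 / (4 * \<delta>\<^sub>0)" by (simp add: \<eta>_def)
    finally have 1: "onorm ((*v) (N x - N c)) \<le> 1 / (4 * \<delta>\<^sub>0)" .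
    have 2: "norm (N c *v h) \<le> 1 / (2 * \<delta>\<^sub>0) * norm h" for h
    proof -
      have "norm (\<delta>\<^sub>0 *\<^sub>R N c *v h) \<le> onorm ((*v) (\<delta>\<^sub>0 *\<^sub>R N c)) * norm h"
        by (rule onorm[OF matrix_vector_mul_bounded_linear])
      also have "\<dots> \<le> 1 / 2 * norm h"
        using jacobian_close[OF c]
        by (intro mult_right_mono) (simp_all add: shift_jacobian_eq matrix_norm_def N_def)
      finally show ?thesis
        using \<delta>\<^sub>0 by (simp add: scaleR_matrix_vector_assoc[symmetric] field_simps)
    qed
    show ?thesis
    proof (rule onorm_le)
      fix h
      have "norm (N x *v h) \<le> norm ((N x - N c) *v h) + norm (N c *v h)"
        using norm_triangle_ineq[of "(N x - N c) *v h" "N c *v h"]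
        by (simp add: matrix_vector_mult_diff_rdistrib)
      also have "\<dots> \<le> 1 / (4 * \<delta>\<^sub>0) * norm h + 1 / (2 * \<delta>\<^sub>0) * norm h"
        using onorm[OF matrix_vector_mul_bounded_linear, of "N x - N c" h] mult_right_mono[OF 1, of "norm h"] 2[of h]
        by (intro add_mono) auto
      also have "\<dots> = 3 / (4 * \<delta>\<^sub>0) * norm h"
        using \<delta>\<^sub>0 by (simp add: field_simps)
      finally show "norm (N x *v h) \<le> 3 / (4 * \<delta>\<^sub>0) * norm h" .
    qed
  qed
  have "norm (x - y) \<le> 4 * norm (shift_map k \<delta> x - shift_map k \<delta> y)"
    if "c \<in> D" "\<delta> \<in> {0..\<delta>\<^sub>0}" "x \<in> ball c r" "y \<in> ball c r" for c x y \<delta>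
  proof -
    have "norm (k x - k y) \<le> 3 / (4 * \<delta>\<^sub>0) * norm (x - y)"
      by (rule differentiable_bound[OF convex_ball[of c r] has_derivative_at_withinI[OF k_has_derivative]
            N[unfolded N_def] that(3,4)]) (use that in auto)
    then have "\<delta> * norm (k x - k y) \<le> \<delta>\<^sub>0 * (3 / (4 * \<delta>\<^sub>0) * norm (x - y))"
      using that(2) by (intro mult_mono) auto
    then have "norm (\<delta> *\<^sub>R (k x - k y)) \<le> 3 / 4 * norm (x - y)"
      using \<delta>\<^sub>0 that(2) by simp
    moreover have "norm (x - y) \<le> norm ((x - y) + \<delta> *\<^sub>R (k x - k y)) + norm (\<delta> *\<^sub>R (k x - k y))"
      using norm_triangle_ineq4[of "(x - y) + \<delta> *\<^sub>R (k x - k y)" "\<delta> *\<^sub>R (k x - k y)"] by simp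
    moreover have "(x - y) + \<delta> *\<^sub>R (k x - k y) = shift_map k \<delta> x - shift_map k \<delta> y"
      by (simp add: shift_map_def algebra_simps)
    ultimately show ?thesis by simp
  qed
  with r(1) show ?thesis by (rule that)
qed

lemma shift_map_measurable [measurable]: "shift_map k \<delta> \<in> borel_measurable borel"
  unfolding shift_map_def[abs_def]
  by (intro borel_measurable_continuous_onI continuous_intros continuous_on_k)

lemma sets_D [measurable]: "D \<in> sets borel"
  using open_D by simp

text \<open>The shift need not be injective on \<open>D\<close>, but it is so on finitely many pieces covering \<open>D\<close>,
  with inverses of Lipschitz constant 4.\<close>

lemma emeasure_preimage_le_ex:
  "\<exists>C\<ge>0. \<forall>\<delta>\<in>{0..\<delta>\<^sub>0}. \<forall>v. \<forall>A\<in>sets borel.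
    emeasure lborel (D \<inter> (\<lambda>x. shift_map k \<delta> x + v) -` A) \<le> ennreal C * emeasure lborel A"
proof -
  obtain r where r: "0 < r" "\<And>c x y \<delta>. c \<in> D \<Longrightarrow> \<delta> \<in> {0..\<delta>\<^sub>0} \<Longrightarrow> x \<in> ball c r \<Longrightarrow> y \<in> ball c r \<Longrightarrow>
    norm (x - y) \<le> 4 * norm (shift_map k \<delta> x - shift_map k \<delta> y)"
    by (rule locally_expanding) blast
  have "compact (closure D)" using bounded_D by (simp add: compact_closure)
  moreover have "closure D \<subseteq> (\<Union>c\<in>D. ball c r)"
  proof
    fix x assume "x \<in> closure D"
    then obtain c where "c \<in> D" "dist c x < r" using r(1) by (auto simp: closure_approachable)
    then show "x \<in> (\<Union>c\<in>D. ball c r)" by auto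
  qed
  ultimately obtain I where I: "I \<subseteq> D" "finite I" "closure D \<subseteq> (\<Union>c\<in>I. ball c r)"
    using compactE_image[of "closure D" D "\<lambda>c. ball c r"] by auto
  \<comment> \<open>The constant of the covering estimate for expansion constant 4, valid on a
    single ball; the number of balls multiplies it.\<close>
  define C :: real where "C = (2 * 4 * real DIM(real^'d)) ^ DIM(real^'d)"
  have "emeasure lborel (D \<inter> (\<lambda>x. shift_map k \<delta> x + v) -` A) \<le> ennreal (card I * C) * emeasure lborel A"
    if \<delta>: "\<delta> \<in> {0..\<delta>\<^sub>0}" and A[measurable]: "A \<in> sets borel" for \<delta> v A
  proof -
    let ?f = "\<lambda>x. shift_map k \<delta> x + v"
    have "compact (?f ` closure D)"
      using bounded_D unfolding shift_map_def
      by (intro compact_continuous_image continuous_intros continuous_on_k) (simp add: compact_closure)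
    then obtain R where R: "R > 0" "\<And>x. x \<in> closure D \<Longrightarrow> norm (?f x) \<le> R"
      by (auto dest!: compact_imp_bounded simp: bounded_pos)
    \<comment> \<open>The covering estimate asks for a bounded target; the box contains the whole
      image of D, so nothing of the preimage is lost.\<close>
    define A' where "A' = A \<inter> cbox (- (R *\<^sub>R One)) (R *\<^sub>R One)"
    have A'[measurable]: "A' \<in> sets borel" by (simp add: A'_def)
    have A'l: "A' \<in> lmeasurable"
      by (rule fmeasurableI2[of "cbox (- (R *\<^sub>R One)) (R *\<^sub>R One)"]) (auto simp: A'_def)
    have sub: "D \<inter> ?f -` A \<subseteq> (\<Union>c\<in>I. (D \<inter> ball c r) \<inter> ?f -` A')"
    proof
      fix x assume x: "x \<in> D \<inter> ?f -` A"
      then have "norm (?f x) \<le> R" using R(2) closure_subset by blast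
      then have "- R \<le> ?f x \<bullet> i" "?f x \<bullet> i \<le> R" if "i \<in> Basis" for i
        using Basis_le_norm[OF that, of "?f x"] by linarith+
      then have "?f x \<in> cbox (- (R *\<^sub>R One)) (R *\<^sub>R One)"
        by (simp add: mem_box)
      moreover obtain c where "c \<in> I" "x \<in> ball c r" using x I(3) closure_subset by blast
      ultimately show "x \<in> (\<Union>c\<in>I. (D \<inter> ball c r) \<inter> ?f -` A')"
        using x unfolding A'_def by blast
    qed
    have m: "(D \<inter> ball c r) \<inter> ?f -` A' \<in> sets borel" for c
    proof -
      have "?f -` A' \<inter> space borel \<in> sets borel" by measurable
      then show ?thesis by (simp add: sets.Int)
    qed
    have piece: "emeasure lborel ((D \<inter> ball c r) \<inter> ?f -` A') \<le> ennreal C * emeasure lborel A" if "c \<in> I" for c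
    proof -
      have "emeasure lebesgue ((D \<inter> ball c r) \<inter> ?f -` A') \<le> ennreal (C * measure lebesgue A')"
        unfolding C_def
      proof (rule measure_preimage_expanding_le[OF _ _ A'l _ R(1)])
        show "norm (x - y) \<le> 4 * norm (?f x - ?f y)" if "x \<in> D \<inter> ball c r" "y \<in> D \<inter> ball c r" for x y
          using r(2)[of c \<delta> x y] that \<open>c \<in> I\<close> I(1) \<delta> by auto
        show "(D \<inter> ball c r) \<inter> ?f -` A' \<in> sets lebesgue" using m by simp
      qed (auto simp: A'_def)
      also have "\<dots> = ennreal C * emeasure lebesgue A'"
        using A'l by (simp add: ennreal_mult C_def emeasure_eq_measure2)
      also have "\<dots> \<le> ennreal C * emeasure lebesgue A"
        by (intro mult_left_mono emeasure_mono) (auto simp: A'_def)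
      finally show ?thesis using m by simp
    qed
    have "emeasure lborel (D \<inter> ?f -` A) \<le> emeasure lborel (\<Union>c\<in>I. (D \<inter> ball c r) \<inter> ?f -` A')"
      by (intro emeasure_mono sub) (use m I(2) in \<open>simp only: sets_lborel sets.finite_UN\<close>)
    also have "\<dots> \<le> (\<Sum>c\<in>I. emeasure lborel ((D \<inter> ball c r) \<inter> ?f -` A'))"
      using m I(2) by (intro emeasure_subadditive_finite) auto
    also have "\<dots> \<le> (\<Sum>c\<in>I. ennreal C * emeasure lborel A)"
      by (intro sum_mono piece)
    also have "\<dots> = ennreal (card I * C) * emeasure lborel A"
      by (simp add: ennreal_mult C_def ennreal_of_nat_eq_real_of_nat mult.assoc)
    finally show ?thesis .
  qed
  then show ?thesis by (intro exI[of _ "card I * C"]) (auto simp: C_def)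
qed

text \<open>Chosen once for the whole locale, so that later estimates share one constant independent
  of \<delta> and v.\<close>

definition overlap :: real where
  "overlap = (SOME C. 0 \<le> C \<and> (\<forall>\<delta>\<in>{0..\<delta>\<^sub>0}. \<forall>v. \<forall>A\<in>sets borel.
    emeasure lborel (D \<inter> (\<lambda>x. shift_map k \<delta> x + v) -` A) \<le> ennreal C * emeasure lborel A))"

lemma
  shows overlap_nonneg: "0 \<le> overlap"
    and emeasure_preimage_le: "\<lbrakk>\<delta> \<in> {0..\<delta>\<^sub>0}; A \<in> sets borel\<rbrakk> \<Longrightarrow>
      emeasure lborel (D \<inter> (\<lambda>x. shift_map k \<delta> x + v) -` A) \<le> ennreal overlap * emeasure lborel A"
  using someI_ex[OF emeasure_preimage_le_ex, folded overlap_def] by blast+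

text \<open>By the preimage estimate, the image of Lebesgue measure on D under the translated shift
  is at most \<open>overlap\<close> times Lebesgue measure; integrals of nonnegative functions
  inherit the inequality.\<close>

lemma nn_integral_shift_le:
  fixes F :: "real^'d \<Rightarrow> ennreal"
  assumes \<delta>: "\<delta> \<in> {0..\<delta>\<^sub>0}" and F[measurable]: "F \<in> borel_measurable borel"
  shows "(\<integral>\<^sup>+x. F (shift_map k \<delta> x + v) * indicator D x \<partial>lborel) \<le> ennreal overlap * (\<integral>\<^sup>+x. F x \<partial>lborel)"
proof -
  let ?f = "\<lambda>x. shift_map k \<delta> x + v"
  let ?M = "distr (restrict_space lborel D) borel ?f"
  have f: "?f \<in> restrict_space lborel D \<rightarrow>\<^sub>M borel"
    by (intro measurable_restrict_space1) measurable
  have le: "?M \<le> scale_measure (ennreal overlap) lborel"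
  proof (subst le_measure)
    show "\<forall>A\<in>sets ?M. emeasure ?M A \<le> emeasure (scale_measure (ennreal overlap) lborel) A"
    proof
      fix A assume "A \<in> sets ?M"
      then have A: "A \<in> sets borel" by simp
      have "emeasure ?M A = emeasure lborel (D \<inter> ?f -` A)"
        using A f by (simp add: emeasure_distr space_restrict_space emeasure_restrict_space Int_commute)
      with emeasure_preimage_le[OF \<delta> A, of v] show "emeasure ?M A \<le> emeasure (scale_measure (ennreal overlap) lborel) A" by simp
    qed
  qed simp
  have "(\<integral>\<^sup>+x. F (?f x) * indicator D x \<partial>lborel) = (\<integral>\<^sup>+x. F (?f x) \<partial>restrict_space lborel D)"
    by (simp add: nn_integral_restrict_space)
  also have "\<dots> = (\<integral>\<^sup>+x. F x \<partial>?M)"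
    using f by (simp add: nn_integral_distr)
  also have "\<dots> \<le> (\<integral>\<^sup>+x. F x \<partial>scale_measure (ennreal overlap) lborel)"
    by (rule nn_integral_mono_measure[OF _ le]) simp
  also have "\<dots> = ennreal overlap * (\<integral>\<^sup>+x. F x \<partial>lborel)"
    by (simp add: nn_integral_scale_measure)
  finally show ?thesis .
qed

end

section \<open>Averages in \<open>L\<^sup>p\<close>\<close>

text \<open>A Bochner integral with a nonzero value can only come from an integrable
  function.\<close>

lemma integrable_mollifier: "integrable lborel (mollifier :: 'a::euclidean_space \<Rightarrow> real)"
proof -
  have "integrable lebesgue (mollifier :: 'a \<Rightarrow> real)"
    using integral_mollifier[where 'a='a] not_integrable_integral_eq by fastforce
  then show ?thesis by (simp add: integrable_completion)
qed

lemma integral_mollifier_lborel: "(LINT y|lborel. mollifier (y::'a::euclidean_space)) = 1"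
  using integral_mollifier[where 'a='a] by (simp add: integral_completion)

lemma nn_integral_mollifier: "(\<integral>\<^sup>+y. ennreal (mollifier (y::'a::euclidean_space)) \<partial>lborel) = 1"
  using nn_integral_eq_integral[OF integrable_mollifier[where 'a='a]]
  by (simp add: mollifier_nonneg integral_mollifier_lborel)

section \<open>Power inequalities and Jensen's inequality for the kernel\<close>

lemma powr_above_tangent:
  fixes a t r :: real
  assumes "1 \<le> r" "0 < a" "0 \<le> t"
  shows "a powr r + r * a powr (r - 1) * (t - a) \<le> t powr r"
proof (cases "r = 1")
  case False
  \<comment> \<open>The conjugate exponent of r, which degenerates for r = 1. Young's inequality for
    the product of t and a^(r - 1) becomes the tangent inequality after multiplication by r.\<close>
  define q where "q = r / (r - 1)"
  have q: "q > 1" "1 / r + 1 / q = 1" using False assms(1) by (auto simp: q_def field_simps)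
  have "t * a powr (r - 1) \<le> t powr r / r + (a powr (r - 1)) powr q / q"
    using q False assms by (intro Youngs_inequality) auto
  also have "(a powr (r - 1)) powr q = a powr r"
    using False by (simp add: powr_powr q_def)
  also have "a powr r / q = a powr r - a powr r / r"
    using False assms(1) by (simp add: q_def field_simps)
  finally have "r * (t * a powr (r - 1)) \<le> r * (t powr r / r + (a powr r - a powr r / r))"
    using assms(1) by (intro mult_left_mono) auto
  moreover have "a powr (r - 1) * a = a powr r"
    using assms(2) by (simp add: powr_diff)
  ultimately show ?thesis
    using assms(1) by (simp add: algebra_simps)
qed (use assms in simp)

lemma le_one_plus_powr:
  fixes t r :: real
  assumes "1 \<le> r"
  shows "t \<le> 1 + t powr r"
proof (cases "t \<le> 1")
  case False
  then have "t powr 1 \<le> t powr r" using assms by (intro powr_mono) auto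
  then show ?thesis using False by simp
qed (simp add: add_increasing2)

text \<open>The sum is at most three times its largest term; the crude constant suffices. Two
  summands are treated with 0 as the third.\<close>

lemma powr_add3_le:
  fixes a b c r :: real
  assumes "0 \<le> a" "0 \<le> b" "0 \<le> c" "0 \<le> r"
  shows "(a + b + c) powr r \<le> 3 powr r * (a powr r + b powr r + c powr r)"
proof -
  define m where "m = max a (max b c)"
  have "(a + b + c) powr r \<le> (3 * m) powr r"
    using assms by (intro powr_mono2) (auto simp: m_def)
  also have "\<dots> = 3 powr r * m powr r"
    by (simp add: powr_mult)
  also have "m powr r \<le> a powr r + b powr r + c powr r"
    by (auto simp: m_def max_def)
  finally show ?thesis by simp
qed

text \<open>The tangent inequality at the weighted mean a of |g| is integrated against the kernel;
  the kernel has mass 1, so the linear term drops out. Without integrability the left-hand side is 0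
  by the default value of the integral, and an infinite right-hand side is trivial.\<close>

lemma mollifier_jensen:
  fixes g :: "'a::euclidean_space \<Rightarrow> 'b::euclidean_space"
  assumes [measurable]: "g \<in> borel_measurable borel" and r: "1 \<le> r"
  shows "ennreal (norm (LINT y|lebesgue. mollifier y *\<^sub>R g y) powr r) \<le>
    (\<integral>\<^sup>+y. ennreal (mollifier y) * ennreal (norm (g y) powr r) \<partial>lborel)"
proof (cases "integrable lborel (\<lambda>y. mollifier y *\<^sub>R g y)
    \<and> (\<integral>\<^sup>+y. ennreal (mollifier y) * ennreal (norm (g y) powr r) \<partial>lborel) < \<infinity>")
  case True
  have eq: "(LINT y|lebesgue. mollifier y *\<^sub>R g y) = (LINT y|lborel. mollifier y *\<^sub>R g y)"
    by (rule integral_completion) simp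
  define a where "a = (LINT y|lborel. mollifier y * norm (g y))"
  have int1: "integrable lborel (\<lambda>y. mollifier y * norm (g y))"
    using integrable_norm[OF conjunct1[OF True]] by (simp add: mollifier_nonneg)
  have int2: "integrable lborel (\<lambda>y. mollifier y * norm (g y) powr r)"
    using True by (intro integrableI_bounded) (auto simp: mollifier_nonneg ennreal_mult abs_mult)
  have na: "norm (LINT y|lborel. mollifier y *\<^sub>R g y) \<le> a"
    using integral_norm_bound[of lborel "\<lambda>y. mollifier y *\<^sub>R g y"] by (simp add: a_def mollifier_nonneg)
  have "norm (LINT y|lborel. mollifier y *\<^sub>R g y) powr r \<le> (LINT y|lborel. mollifier y * norm (g y) powr r)"
  proof (cases "a > 0")
    case a: True
    have "norm (LINT y|lborel. mollifier y *\<^sub>R g y) powr r \<le> a powr r"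
      using na r by (intro powr_mono2) auto
    also have "\<dots> = (LINT y|lborel. a powr r * mollifier y
        + (r * a powr (r - 1)) * (mollifier y * norm (g y)) - (r * a powr (r - 1) * a) * mollifier y)"
      by (simp add: integrable_mollifier int1 integral_mollifier_lborel a_def[symmetric])
    also have "\<dots> \<le> (LINT y|lborel. mollifier y * norm (g y) powr r)"
    proof (rule integral_mono)
      fix y :: 'a
      have "mollifier y * (a powr r + r * a powr (r - 1) * (norm (g y) - a)) \<le> mollifier y * norm (g y) powr r"
        by (intro mult_left_mono powr_above_tangent r a mollifier_nonneg) simp
      then show "a powr r * mollifier y + (r * a powr (r - 1)) * (mollifier y * norm (g y))
          - (r * a powr (r - 1) * a) * mollifier y \<le> mollifier y * norm (g y) powr r"
        by (simp add: algebra_simps)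
    qed (intro Bochner_Integration.integrable_add Bochner_Integration.integrable_diff
        integrable_mult_right integrable_mollifier int1 int2)+
    finally show ?thesis .
  next
    case False
    then have "norm (LINT y|lborel. mollifier y *\<^sub>R g y) = 0"
      using na norm_ge_zero[of "LINT y|lborel. mollifier y *\<^sub>R g y"] by linarith
    then show ?thesis
      by (simp add: mollifier_nonneg)
  qed
  then have "ennreal (norm (LINT y|lebesgue. mollifier y *\<^sub>R g y) powr r)
      \<le> ennreal (LINT y|lborel. mollifier y * norm (g y) powr r)"
    unfolding eq by (rule ennreal_leI)
  also have "\<dots> = (\<integral>\<^sup>+y. ennreal (mollifier y * norm (g y) powr r) \<partial>lborel)"
    using int2 by (intro nn_integral_eq_integral[symmetric]) (auto simp: mollifier_nonneg)
  finally show ?thesis by (simp add: mollifier_nonneg ennreal_mult)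
next
  case False
  then consider "\<not> integrable lborel (\<lambda>y. mollifier y *\<^sub>R g y)"
    | "(\<integral>\<^sup>+y. ennreal (mollifier y) * ennreal (norm (g y) powr r) \<partial>lborel) = \<infinity>"
    by (metis infinity_ennreal_def less_top)
  then show ?thesis
  proof cases
    case 1
    then have "(LINT y|lebesgue. mollifier y *\<^sub>R g y) = 0"
      by (simp add: integral_completion not_integrable_integral_eq)
    then show ?thesis by simp
  next
    case 2
    then show ?thesis by (simp only: top_greatest infinity_ennreal_def)
  qed
qed

abbreviation powr_integral :: "'a measure \<Rightarrow> real \<Rightarrow> ('a \<Rightarrow> 'b::real_normed_vector) \<Rightarrow> ennreal" where
  "powr_integral M r f \<equiv> \<integral>\<^sup>+x. ennreal (norm (f x) powr r) \<partial>M"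

abbreviation powr_integral_on ::
    "'a::euclidean_space set \<Rightarrow> real \<Rightarrow> ('a \<Rightarrow> 'b::real_normed_vector) \<Rightarrow> ennreal" where
  "powr_integral_on S r f \<equiv> \<integral>\<^sup>+x. ennreal (norm (f x) powr r) * indicator S x \<partial>lborel"

text \<open>Jensen in y followed by Tonelli: the average over y is no worse than the worst slice,
  and only slices with |y| < 1 carry weight.\<close>

lemma mollifier_average_le:
  fixes H :: "real^'d \<Rightarrow> real^'d \<Rightarrow> 'b::euclidean_space"
  assumes [measurable]: "case_prod H \<in> borel_measurable (borel \<Otimes>\<^sub>M borel)" "D \<in> sets borel"
    and r: "1 \<le> r"
    and S: "\<And>y. norm y < 1 \<Longrightarrow> powr_integral_on D r (\<lambda>x. H x y) \<le> S"
  shows "powr_integral_on D r (\<lambda>x. LINT y|lebesgue. mollifier y *\<^sub>R H x y) \<le> S"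
proof -
  have [measurable]: "case_prod H \<in> borel_measurable (lborel \<Otimes>\<^sub>M lborel)"
    using assms(1) by simp
  have [measurable]: "H x \<in> borel_measurable borel" for x
    using assms(1) by measurable
  have "powr_integral_on D r (\<lambda>x. LINT y|lebesgue. mollifier y *\<^sub>R H x y)
    \<le> (\<integral>\<^sup>+x. (\<integral>\<^sup>+y. ennreal (mollifier y) * ennreal (norm (H x y) powr r) \<partial>lborel) * indicator D x \<partial>lborel)"
    by (intro nn_integral_mono mult_right_mono mollifier_jensen r) simp_all
  also have "\<dots> = (\<integral>\<^sup>+x. (\<integral>\<^sup>+y. ennreal (mollifier y) * ennreal (norm (H x y) powr r) * indicator D x \<partial>lborel) \<partial>lborel)"
    by (simp add: nn_integral_multc)
  also have "\<dots> = (\<integral>\<^sup>+y. (\<integral>\<^sup>+x. ennreal (mollifier y) * ennreal (norm (H x y) powr r) * indicator D x \<partial>lborel) \<partial>lborel)"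
    by (rule lborel_pair.Fubini'[symmetric]) measurable
  also have "\<dots> = (\<integral>\<^sup>+y. ennreal (mollifier y) * powr_integral_on D r (\<lambda>x. H x y) \<partial>lborel)"
    by (simp add: mult.assoc nn_integral_cmult)
  also have "\<dots> \<le> (\<integral>\<^sup>+y. ennreal (mollifier y) * S \<partial>(lborel :: (real^'d) measure))"
  proof (rule nn_integral_mono)
    fix y :: "real^'d"
    show "ennreal (mollifier y) * powr_integral_on D r (\<lambda>x. H x y) \<le> ennreal (mollifier y) * S"
      using S[of y] mollifier_eq_0[of y] by (cases "norm y < 1") (auto intro: mult_left_mono)
  qed
  also have "\<dots> = S"
    by (simp add: nn_integral_multc nn_integral_mollifier)
  finally show ?thesis .
qed

text \<open>Truncation at a large radius changes F little. Continuous functions that converge to F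
  almost everywhere, truncated at the same radius, then converge in the mean by dominated
  convergence; on a ball the constant bound is integrable.\<close>

lemma Lp_continuous_approx:
  fixes F :: "'a::euclidean_space \<Rightarrow> 'b::euclidean_space"
  assumes [measurable]: "F \<in> borel_measurable borel" and r: "1 \<le> r"
    and fin: "powr_integral lborel r F < \<infinity>" and \<epsilon>: "0 < \<epsilon>"
  obtains g where "continuous_on UNIV g"
    "powr_integral_on (cball 0 R) r (\<lambda>x. F x - g x) < ennreal \<epsilon>"
proof -
  \<comment> \<open>Radial retraction onto the ball of radius m; \<open>T'\<close> shifts the index
    so that the radius is positive and the map continuous.\<close>
  define T :: "nat \<Rightarrow> 'b \<Rightarrow> 'b" where "T m v = (real m / max (real m) (norm v)) *\<^sub>R v" for m v
  define T' where "T' m = T (Suc m)" for m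
  have T_cont: "continuous_on UNIV (T' m)" for m
    unfolding T'_def T_def by (intro continuous_intros) (auto simp: max_def)
  have T_norm: "norm (T' m v) \<le> Suc m" for m v
  proof -
    let ?M = "max (real (Suc m)) (norm v)"
    have "norm (T' m v) = real (Suc m) / ?M * norm v"
      by (simp add: T'_def T_def)
    also have "\<dots> \<le> real (Suc m) / ?M * ?M"
      by (intro mult_left_mono) auto
    also have "\<dots> = Suc m"
      by (auto simp: max_def)
    finally show ?thesis .
  qed
  have [measurable]: "T' m \<in> borel_measurable borel" for m
    by (intro borel_measurable_continuous_onI T_cont)
  have [measurable]: "cball (0::'a) R \<in> sets borel" by simp
  have T_diff: "norm (v - T' m v) \<le> norm v" for m v
  proof -
    have "v - T' m v = (1 - real (Suc m) / max (real (Suc m)) (norm v)) *\<^sub>R v"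
      by (simp add: T'_def T_def scaleR_left_diff_distrib)
    moreover have "0 \<le> real (Suc m) / max (real (Suc m)) (norm v)"
      "real (Suc m) / max (real (Suc m)) (norm v) \<le> 1"
      by (auto simp: divide_le_eq_1 le_max_iff_disj)
    then have "\<bar>1 - real (Suc m) / max (real (Suc m)) (norm v)\<bar> \<le> 1"
      by linarith
    ultimately show ?thesis by (simp add: mult_left_le_one_le)
  qed
  have T_lim: "(\<lambda>m. T' m v) \<longlonglongrightarrow> v" for v
  proof (rule tendsto_eventually)
    obtain N where N: "norm v \<le> real N" using real_arch_simple by blast
    have "T' m v = v" if "m \<ge> N" for m
      using that N by (auto simp: T'_def T_def max_def)
    then show "\<forall>\<^sub>F m in sequentially. T' m v = v"
      unfolding eventually_sequentially by blast
  qed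
  have lim0: "(\<lambda>n. ennreal (norm (u n) powr r)) \<longlonglongrightarrow> 0" if "u \<longlonglongrightarrow> 0" for u :: "nat \<Rightarrow> 'b"
  proof -
    have "(\<lambda>n. norm (u n) powr r) \<longlonglongrightarrow> 0 powr r"
      using that r by (intro tendsto_powr') (auto intro: tendsto_norm_zero)
    then show ?thesis by (intro tendsto_ennrealI[where x=0, simplified]) simp
  qed
  define \<epsilon>' where "\<epsilon>' = \<epsilon> / (3 powr r * 2)"
  have \<epsilon>': "\<epsilon>' > 0" using \<epsilon> by (simp add: \<epsilon>'_def)
  have "(\<lambda>m. \<integral>\<^sup>+x. ennreal (norm (F x - T' m (F x)) powr r) * indicator (cball 0 R) x \<partial>lborel) \<longlonglongrightarrow> (\<integral>\<^sup>+x. 0 \<partial>(lborel :: 'a measure))"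
  proof (rule nn_integral_dominated_convergence[where w = "\<lambda>x. ennreal (norm (F x) powr r)"])
    show "AE x in lborel. ennreal (norm (F x - T' m (F x)) powr r) * indicator (cball 0 R) x \<le> ennreal (norm (F x) powr r)" for m
      using r T_diff by (intro AE_I2) (auto simp: indicator_def intro!: ennreal_leI powr_mono2)
    show "AE x in lborel. (\<lambda>m. ennreal (norm (F x - T' m (F x)) powr r) * indicator (cball 0 R) x) \<longlonglongrightarrow> 0"
    proof (rule AE_I2)
      fix x
      have "(\<lambda>m. F x - T' m (F x)) \<longlonglongrightarrow> F x - F x" by (intro tendsto_intros T_lim)
      then have "(\<lambda>m. ennreal (norm (F x - T' m (F x)) powr r)) \<longlonglongrightarrow> 0" by (intro lim0) simp
      then show "(\<lambda>m. ennreal (norm (F x - T' m (F x)) powr r) * indicator (cball 0 R) x) \<longlonglongrightarrow> 0"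
        by (cases "x \<in> cball 0 R") (simp_all add: indicator_def)
    qed
    show "(\<lambda>x. ennreal (norm (F x - T' m (F x)) powr r) * indicator (cball 0 R) x) \<in> borel_measurable lborel" for m
      by measurable
  qed (use fin in simp_all)
  then have "\<forall>\<^sub>F m in sequentially. powr_integral_on (cball 0 R) r (\<lambda>x. F x - T' m (F x)) < ennreal \<epsilon>'"
    using \<epsilon>' by (intro order_tendstoD(2)) auto
  then obtain m where m: "powr_integral_on (cball 0 R) r (\<lambda>x. F x - T' m (F x)) < ennreal \<epsilon>'"
    by (meson eventually_happens trivial_limit_sequentially)
  have "F measurable_on UNIV"
    by (rule lebesgue_measurable_imp_measurable_on) (auto intro: measurable_completion)
  then obtain N h where N: "negligible N" and h: "\<And>n. continuous_on UNIV (h n)"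
    "\<And>x. x \<notin> N \<Longrightarrow> (\<lambda>n. h n x) \<longlonglongrightarrow> F x"
    unfolding measurable_on_def by auto
  have [measurable]: "h n \<in> borel_measurable borel" for n
    by (intro borel_measurable_continuous_onI h)
  have "N \<in> null_sets lebesgue" using N by (simp add: negligible_iff_null_sets)
  then have AE_N: "AE x in lborel. x \<notin> N"
    by (metis AE_completion_iff AE_not_in)
  define K where "K = (2 * real (Suc m)) powr r"
  have "(\<lambda>n. \<integral>\<^sup>+x. ennreal (norm (T' m (F x) - T' m (h n x)) powr r) * indicator (cball 0 R) x \<partial>lborel) \<longlonglongrightarrow> (\<integral>\<^sup>+x. 0 \<partial>(lborel :: 'a measure))"
  proof (rule nn_integral_dominated_convergence[where w = "\<lambda>x. ennreal K * indicator (cball 0 R) x"])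
    show "AE x in lborel. ennreal (norm (T' m (F x) - T' m (h n x)) powr r) * indicator (cball 0 R) x \<le> ennreal K * indicator (cball 0 R) x" for n
    proof (intro AE_I2 mult_right_mono ennreal_leI)
      fix x
      have "norm (T' m (F x) - T' m (h n x)) \<le> 2 * real (Suc m)"
        using norm_triangle_ineq4[of "T' m (F x)" "T' m (h n x)"] T_norm[of m "F x"] T_norm[of m "h n x"] by simp
      then show "norm (T' m (F x) - T' m (h n x)) powr r \<le> K"
        using r unfolding K_def by (intro powr_mono2) auto
    qed simp
    show "(\<integral>\<^sup>+x. ennreal K * indicator (cball 0 R) x \<partial>(lborel :: 'a measure)) < \<infinity>"
      using emeasure_compact_finite[OF compact_cball, of "0::'a" R]
      by (simp add: nn_integral_cmult ennreal_mult_less_top less_top)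
    show "AE x in lborel. (\<lambda>n. ennreal (norm (T' m (F x) - T' m (h n x)) powr r) * indicator (cball 0 R) x) \<longlonglongrightarrow> 0"
      using AE_N
    proof eventually_elim
      fix x assume "x \<notin> N"
      then have "(\<lambda>n. T' m (h n x)) \<longlonglongrightarrow> T' m (F x)"
        by (intro continuous_on_tendsto_compose[OF T_cont h(2)]) auto
      then have "(\<lambda>n. T' m (F x) - T' m (h n x)) \<longlonglongrightarrow> T' m (F x) - T' m (F x)"
        by (intro tendsto_intros)
      then have "(\<lambda>n. ennreal (norm (T' m (F x) - T' m (h n x)) powr r)) \<longlonglongrightarrow> 0" by (intro lim0) simp
      then show "(\<lambda>n. ennreal (norm (T' m (F x) - T' m (h n x)) powr r) * indicator (cball 0 R) x) \<longlonglongrightarrow> 0"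
        by (cases "x \<in> cball 0 R") (simp_all add: indicator_def)
    qed
    show "(\<lambda>x. ennreal (norm (T' m (F x) - T' m (h n x)) powr r) * indicator (cball 0 R) x) \<in> borel_measurable lborel" for n
      by measurable
  qed simp_all
  then have "\<forall>\<^sub>F n in sequentially. powr_integral_on (cball 0 R) r (\<lambda>x. T' m (F x) - T' m (h n x)) < ennreal \<epsilon>'"
    using \<epsilon>' by (intro order_tendstoD(2)) auto
  then obtain n where n: "powr_integral_on (cball 0 R) r (\<lambda>x. T' m (F x) - T' m (h n x)) < ennreal \<epsilon>'"
    by (meson eventually_happens trivial_limit_sequentially)
  have "powr_integral_on (cball 0 R) r (\<lambda>x. F x - T' m (h n x))
    \<le> (\<integral>\<^sup>+x. ennreal (3 powr r) * (ennreal (norm (F x - T' m (F x)) powr r) * indicator (cball 0 R) x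
        + ennreal (norm (T' m (F x) - T' m (h n x)) powr r) * indicator (cball 0 R) x) \<partial>lborel)"
  proof (rule nn_integral_mono)
    fix x
    have "norm (F x - T' m (h n x)) \<le> norm (F x - T' m (F x)) + norm (T' m (F x) - T' m (h n x))"
      using norm_triangle_ineq[of "F x - T' m (F x)" "T' m (F x) - T' m (h n x)"] by simp
    then have "norm (F x - T' m (h n x)) powr r \<le> (norm (F x - T' m (F x)) + norm (T' m (F x) - T' m (h n x)) + 0) powr r"
      using r by (intro powr_mono2) auto
    also have "\<dots> \<le> 3 powr r * (norm (F x - T' m (F x)) powr r + norm (T' m (F x) - T' m (h n x)) powr r + 0 powr r)"
      using r by (intro powr_add3_le) auto
    finally show "ennreal (norm (F x - T' m (h n x)) powr r) * indicator (cball 0 R) x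
        \<le> ennreal (3 powr r) * (ennreal (norm (F x - T' m (F x)) powr r) * indicator (cball 0 R) x
        + ennreal (norm (T' m (F x) - T' m (h n x)) powr r) * indicator (cball 0 R) x)"
      by (cases "x \<in> cball 0 R") (auto simp: ennreal_mult[symmetric] ennreal_plus[symmetric] simp del: ennreal_plus intro!: ennreal_leI)
  qed
  also have "\<dots> = ennreal (3 powr r) * (powr_integral_on (cball 0 R) r (\<lambda>x. F x - T' m (F x))
     + powr_integral_on (cball 0 R) r (\<lambda>x. T' m (F x) - T' m (h n x)))"
    by (simp add: nn_integral_cmult nn_integral_add)
  also have "\<dots> < ennreal (3 powr r) * (ennreal \<epsilon>' + ennreal \<epsilon>')"
    using m n by (intro ennreal_mult_strict_left_mono add_strict_mono) auto
  also have "\<dots> = ennreal \<epsilon>"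
    using \<epsilon>' by (simp add: ennreal_mult[symmetric] ennreal_plus[symmetric] \<epsilon>'_def del: ennreal_plus)
  finally have "powr_integral_on (cball 0 R) r (\<lambda>x. F x - T' m (h n x)) < ennreal \<epsilon>" .
  moreover have "continuous_on UNIV (\<lambda>x. T' m (h n x))"
    by (rule continuous_on_compose2[OF T_cont h(1)]) auto
  ultimately show ?thesis by (rule that[rotated])
qed

section \<open>The averaging operator on functions defined everywhere\<close>

definition avg :: "(real^'d \<Rightarrow> real^'d) \<Rightarrow> real \<Rightarrow> real \<Rightarrow> (real^'d \<Rightarrow> 'b::euclidean_space) \<Rightarrow> real^'d \<Rightarrow> 'b" where
  "avg k \<zeta> \<delta> F x = (LINT y|lebesgue. mollifier y *\<^sub>R F (shift_map k \<delta> x + (\<delta> * \<zeta>) *\<^sub>R y))"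

lemma avg_zero: "avg k \<zeta> 0 F x = F x"
  using integrable_mollifier[where 'a = "real^'b"]
  by (simp add: avg_def shift_map_def integral_mollifier integrable_completion)

lemma avg_eq_conv:
  assumes "0 < \<delta>" "0 < \<zeta>" "F \<in> borel_measurable lebesgue"
  shows "avg k \<zeta> \<delta> F x = conv (\<delta> * \<zeta>) F (shift_map k \<delta> x)"
  unfolding avg_def using assms by (intro conv_eq) auto

text \<open>For \<delta> > 0 the average integrates F against a density, so null sets are invisible
  at every single x. At \<delta> = 0 the average is F itself, which is why \<delta> is positive
  here.\<close>

lemma avg_cong_AE:
  assumes "0 < \<delta>" "0 < \<zeta>" and [measurable]: "F \<in> borel_measurable lebesgue" "F' \<in> borel_measurable lebesgue"
    and "AE z in lebesgue. F z = F' z"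
  shows "avg k \<zeta> \<delta> F x = avg k \<zeta> \<delta> F' x"
  unfolding avg_eq_conv[OF assms(1,2,3)] avg_eq_conv[OF assms(1,2,4)] conv_def
proof (rule integral_cong_AE)
  show "AE z in lebesgue. scaled_mollifier (\<delta> * \<zeta>) (shift_map k \<delta> x) z *\<^sub>R F z =
      scaled_mollifier (\<delta> * \<zeta>) (shift_map k \<delta> x) z *\<^sub>R F' z"
    using assms(5) by eventually_elim simp
qed measurable

lemma locally_integrable_integrable:
  assumes "integrable lebesgue F"
  shows "locally_integrable S F"
  unfolding locally_integrable_def
proof (intro allI impI)
  fix K assume "compact K \<and> K \<subseteq> S"
  then have "K \<in> sets lebesgue" by (simp add: lmeasurable_compact fmeasurableD)
  then show "integrable (lebesgue_on K) F"
    using assms integrable_mult_indicator[of K lebesgue F]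
    by (subst integrable_restrict_space) auto
qed

lemma avg_component:
  fixes F :: "real^'d \<Rightarrow> real^'n"
  assumes "0 \<le> \<delta>" "0 < \<zeta>" and F: "integrable lebesgue F"
  shows "avg k \<zeta> \<delta> F x $ i = avg k \<zeta> \<delta> (\<lambda>z. F z $ i) x"
proof (cases "\<delta> = 0")
  case False
  have m: "F \<in> borel_measurable lebesgue" "(\<lambda>z. F z $ i) \<in> borel_measurable lebesgue"
    using F borel_measurable_integrable integrable_bounded_linear[OF bounded_linear_vec_nth F] by blast+
  show ?thesis
    using False assms(1,2) avg_eq_conv[OF _ _ m(1)] avg_eq_conv[OF _ _ m(2)]
      conv_component[OF locally_integrable_integrable[OF F]] by simp
qed (simp add: avg_zero)

lemma avg_linear:
  fixes F G :: "real^'d \<Rightarrow> 'b::euclidean_space"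
  assumes "0 \<le> \<delta>" "0 < \<zeta>" and F: "integrable lebesgue F" and G: "integrable lebesgue G"
  shows "avg k \<zeta> \<delta> (\<lambda>z. a *\<^sub>R F z + b *\<^sub>R G z) x = a *\<^sub>R avg k \<zeta> \<delta> F x + b *\<^sub>R avg k \<zeta> \<delta> G x"
proof (cases "\<delta> = 0")
  case False
  then have e: "\<delta> * \<zeta> > 0" "\<delta> > 0" using assms by auto
  note [measurable] = borel_measurable_integrable[OF F] borel_measurable_integrable[OF G]
  note int = integrable_scaled_mollifier[OF locally_integrable_integrable[OF F] e(1)]
    integrable_scaled_mollifier[OF locally_integrable_integrable[OF G] e(1)]
  have "(LINT z|lebesgue. scaled_mollifier (\<delta> * \<zeta>) c z *\<^sub>R (a *\<^sub>R F z + b *\<^sub>R G z)) =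
      (LINT z|lebesgue. a *\<^sub>R (scaled_mollifier (\<delta> * \<zeta>) c z *\<^sub>R F z) + b *\<^sub>R (scaled_mollifier (\<delta> * \<zeta>) c z *\<^sub>R G z))" for c
    by (simp add: scaleR_add_right mult.commute)
  also have "\<dots> c = a *\<^sub>R conv (\<delta> * \<zeta>) F c + b *\<^sub>R conv (\<delta> * \<zeta>) G c" for c
    using int[of c] by (simp add: conv_def del: scaleR_scaleR)
  finally show ?thesis
    using e(2) assms(2) by (simp add: avg_eq_conv conv_def)
qed (simp add: avg_zero)

text \<open>The rescaled kernel is a probability density, so an essential bound of F bounds the
  average at every point. This is the estimate for p = \<infinity>.\<close>

lemma norm_avg_le:
  fixes F :: "real^'d \<Rightarrow> 'b::euclidean_space"
  assumes \<delta>: "0 < \<delta>" "0 < \<zeta>" and F: "integrable lebesgue F"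
    and m: "AE z in lebesgue. norm (F z) \<le> m"
  shows "norm (avg k \<zeta> \<delta> F x) \<le> m"
proof -
  let ?s = "scaled_mollifier (\<delta> * \<zeta>) (shift_map k \<delta> x)"
  have e: "\<delta> * \<zeta> > 0" using \<delta> by simp
  have int1: "integrable lebesgue ?s"
    using integrable_scaled_mollifier[where F = "\<lambda>_. 1::real", OF continuous_locally_integrable e] by simp
  have "(LINT z|lebesgue. ?s z) = 1"
    using conv_eq[OF e, of "\<lambda>_. 1::real" "shift_map k \<delta> x"] by (simp add: conv_def integral_mollifier)
  moreover have "norm (avg k \<zeta> \<delta> F x) \<le> (LINT z|lebesgue. norm (?s z *\<^sub>R F z))"
    unfolding avg_eq_conv[OF \<delta> borel_measurable_integrable[OF F]] conv_def by (rule integral_norm_bound)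
  moreover have "\<dots> \<le> (LINT z|lebesgue. ?s z * m)"
  proof (rule integral_mono_AE)
    show "integrable lebesgue (\<lambda>z. norm (?s z *\<^sub>R F z))"
      by (intro integrable_norm integrable_scaled_mollifier locally_integrable_integrable F e)
    show "AE z in lebesgue. norm (?s z *\<^sub>R F z) \<le> ?s z * m"
      using m by eventually_elim (auto simp: scaled_mollifier_nonneg[OF e] intro: mult_left_mono)
  qed (use int1 in simp)
  ultimately show ?thesis by simp
qed

text \<open>For a Borel function, the composition with the shifted and scaled argument is jointly
  measurable in x and y, as Tonelli's theorem demands.\<close>

lemma lebesgue_measurable_borel_representative:
  fixes F :: "'a::euclidean_space \<Rightarrow> 'b::euclidean_space"
  assumes F: "F \<in> borel_measurable lebesgue"
  obtains F' where "F' \<in> borel_measurable borel" "AE x in lborel. F x = F' x"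
proof -
  have "\<exists>g\<in>borel_measurable lborel. AE x in lborel. F x \<bullet> b = g x" for b
    using F by (intro completion_ex_borel_measurable_real) auto
  then obtain g where g: "\<And>b. g b \<in> borel_measurable borel" "\<And>b. AE x in lborel. F x \<bullet> b = g b x"
    by (metis measurable_lborel2)
  have "AE x in lborel. \<forall>b\<in>Basis. F x \<bullet> b = g b x"
    using g(2) by (intro AE_finite_allI) auto
  then have "AE x in lborel. F x = (\<Sum>b\<in>Basis. g b x *\<^sub>R b)"
    by eventually_elim (metis (no_types, lifting) euclidean_representation sum.cong)
  moreover have "(\<lambda>x. \<Sum>b\<in>Basis. g b x *\<^sub>R b) \<in> borel_measurable borel"
    using g(1) by measurable
  ultimately show ?thesis by (rule that[rotated])
qed

text \<open>|F| is at most 1 + |F|^r, and the kernel is both integrable, for the first summand, and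
  bounded, for the second.\<close>

lemma integrable_mollifier_affine:
  fixes F :: "'a::euclidean_space \<Rightarrow> 'b::euclidean_space"
  assumes [measurable]: "F \<in> borel_measurable borel" and r: "1 \<le> r" and e: "0 < e"
    and fin: "powr_integral lborel r F < \<infinity>"
  shows "integrable lborel (\<lambda>y. mollifier y *\<^sub>R F (c + e *\<^sub>R y))"
proof (rule integrableI_bounded)
  obtain C where C: "\<And>y::'a. mollifier y \<le> C" "0 \<le> C"
  proof -
    have "test_function UNIV (scaled_mollifier 1 (0::'a))" by (rule test_function_scaled_mollifier) simp
    moreover have "scaled_mollifier 1 (0::'a) = mollifier" by (simp add: fun_eq_iff scaled_mollifier_def)
    ultimately have "continuous_on UNIV (mollifier :: 'a \<Rightarrow> real)"
      by (simp add: test_function_def smooth_on_continuous_on)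
    from continuous_compact_support_bounded[OF this compact_cball[of 0 1] mollifier_eq_0]
    obtain C where "0 \<le> C" "\<And>y::'a. norm (mollifier y) \<le> C" by auto
    then show ?thesis using that[of C] abs_le_D1 by auto
  qed
  have fin': "(\<integral>\<^sup>+y. ennreal (norm (F (c + e *\<^sub>R y)) powr r) \<partial>lborel) < \<infinity>"
  proof -
    have "powr_integral lborel r F =
        (\<integral>\<^sup>+x. ennreal (norm (F x) powr r) \<partial>density (distr lborel borel (\<lambda>x. c + e *\<^sub>R x)) (\<lambda>_. ennreal (\<bar>e\<bar> ^ DIM('a))))"
      using lborel_affine[of e c] e by simp
    also have "\<dots> = ennreal (\<bar>e\<bar> ^ DIM('a)) * (\<integral>\<^sup>+y. ennreal (norm (F (c + e *\<^sub>R y)) powr r) \<partial>lborel)"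
      by (simp add: nn_integral_density nn_integral_distr nn_integral_cmult)
    finally show ?thesis using fin e by (auto simp: ennreal_mult_less_top)
  qed
  have "(\<integral>\<^sup>+y. ennreal (norm (mollifier y *\<^sub>R F (c + e *\<^sub>R y))) \<partial>lborel)
      \<le> (\<integral>\<^sup>+y. ennreal (mollifier y) + ennreal C * ennreal (norm (F (c + e *\<^sub>R y)) powr r) \<partial>lborel)"
  proof (rule nn_integral_mono)
    fix y :: 'a
    define t where "t = norm (F (c + e *\<^sub>R y))"
    have "t \<le> 1 + t powr r" by (rule le_one_plus_powr[OF r])
    then have "mollifier y * t \<le> mollifier y * (1 + t powr r)"
      by (intro mult_left_mono mollifier_nonneg)
    also have "\<dots> \<le> mollifier y + C * t powr r"
      using C(1)[of y] by (simp add: distrib_left mult_right_mono)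
    finally have "ennreal (mollifier y * t) \<le> ennreal (mollifier y + C * t powr r)" by (rule ennreal_leI)
    then show "ennreal (norm (mollifier y *\<^sub>R F (c + e *\<^sub>R y))) \<le> ennreal (mollifier y) + ennreal C * ennreal (norm (F (c + e *\<^sub>R y)) powr r)"
      using C(2) by (simp add: t_def mollifier_nonneg ennreal_mult)
  qed
  also have "\<dots> = 1 + ennreal C * (\<integral>\<^sup>+y. ennreal (norm (F (c + e *\<^sub>R y)) powr r) \<partial>lborel)"
    by (simp add: nn_integral_add nn_integral_cmult nn_integral_mollifier)
  also have "\<dots> < \<infinity>"
    using fin' by (simp add: ennreal_mult_less_top)
  finally show "(\<integral>\<^sup>+y. ennreal (norm (mollifier y *\<^sub>R F (c + e *\<^sub>R y))) \<partial>lborel) < \<infinity>" .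
qed simp

context averaging
begin

lemma avg_measurable:
  fixes F :: "real^'d \<Rightarrow> 'b::euclidean_space"
  assumes [measurable]: "F \<in> borel_measurable borel"
  shows "avg k \<zeta> \<delta> F \<in> borel_measurable borel"
proof -
  have "avg k \<zeta> \<delta> F = (\<lambda>x. LINT y|lborel. mollifier y *\<^sub>R F (shift_map k \<delta> x + (\<delta> * \<zeta>) *\<^sub>R y))"
    by (intro ext) (simp add: avg_def integral_completion)
  also have "\<dots> \<in> borel_measurable borel"
    by (rule lborel.borel_measurable_lebesgue_integral) measurable
  finally show ?thesis .
qed

lemma nn_integral_avg_le:
  fixes F :: "real^'d \<Rightarrow> 'b::euclidean_space"
  assumes "\<delta> \<in> {0..\<delta>\<^sub>0}" "1 \<le> r" and [measurable]: "F \<in> borel_measurable borel"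
  shows "powr_integral_on D r (avg k \<zeta> \<delta> F) \<le> ennreal overlap * powr_integral lborel r F"
  unfolding avg_def
  by (rule mollifier_average_le[OF _ sets_D assms(2)], measurable)
    (rule nn_integral_shift_le[OF assms(1), of "\<lambda>x. ennreal (norm (F x) powr r)"], measurable)

text \<open>The difference of F at the shifted point and at x is split in three through a continuous
  approximation g: two approximation errors, one of them transported by the shift estimate, and an
  increment of g that is small by uniform continuity.\<close>

lemma avg_tendsto:
  fixes F :: "real^'d \<Rightarrow> 'b::euclidean_space"
  assumes [measurable]: "F \<in> borel_measurable borel" and r: "1 \<le> r"
    and fin: "powr_integral lborel r F < \<infinity>" and \<epsilon>: "0 < \<epsilon>"
  obtains \<delta>\<^sub>1 where "0 < \<delta>\<^sub>1" "\<And>\<delta>. 0 < \<delta> \<Longrightarrow> \<delta> \<le> \<delta>\<^sub>0 \<Longrightarrow> \<delta> < \<delta>\<^sub>1 \<Longrightarrow>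
    powr_integral_on D r (\<lambda>x. avg k \<zeta> \<delta> F x - F x) \<le> ennreal \<epsilon>"
proof -
  obtain R\<^sub>1 where R1: "R\<^sub>1 > 0" "\<And>x. x \<in> D \<Longrightarrow> norm x \<le> R\<^sub>1"
    using bounded_D by (auto simp: bounded_pos)
  have "bounded (k ` closure D)"
    using bounded_D by (intro compact_imp_bounded compact_continuous_image continuous_on_k) (simp add: compact_closure)
  then obtain R\<^sub>2 where R2: "R\<^sub>2 > 0" "\<And>x. x \<in> D \<Longrightarrow> norm (k x) \<le> R\<^sub>2"
    using closure_subset by (auto simp: bounded_pos)
  \<comment> \<open>As \<delta> is at most 1, points of D and all their shifted points stay in this
    ball, the region where g approximates F.\<close>
  define R where "R = R\<^sub>1 + R\<^sub>2 + \<zeta>"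
  have near: "norm (shift_map k \<delta> x + (\<delta> * \<zeta>) *\<^sub>R y - x) \<le> \<delta> * (R\<^sub>2 + \<zeta>)"
    if "0 < \<delta>" "x \<in> D" "norm y < 1" for \<delta> x y
  proof -
    have "norm (shift_map k \<delta> x + (\<delta> * \<zeta>) *\<^sub>R y - x) \<le> norm (\<delta> *\<^sub>R k x) + norm ((\<delta> * \<zeta>) *\<^sub>R y)"
      unfolding shift_map_def using norm_triangle_ineq[of "\<delta> *\<^sub>R k x" "(\<delta> * \<zeta>) *\<^sub>R y"] by (simp add: algebra_simps)
    also have "\<dots> \<le> \<delta> * R\<^sub>2 + \<delta> * \<zeta> * 1"
      using that R2(2) \<zeta> by (intro add_mono) (auto intro!: mult_left_mono simp: abs_mult)
    finally show ?thesis by (simp add: distrib_left)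
  qed
  have far: "shift_map k \<delta> x + (\<delta> * \<zeta>) *\<^sub>R y \<in> cball 0 R" "x \<in> cball 0 R"
    if "0 < \<delta>" "\<delta> \<le> \<delta>\<^sub>0" "x \<in> D" "norm y < 1" for \<delta> x y
  proof -
    have "\<delta> * (R\<^sub>2 + \<zeta>) \<le> 1 * (R\<^sub>2 + \<zeta>)"
      using that \<delta>\<^sub>0 R2 \<zeta> by (intro mult_right_mono) auto
    then have "norm (shift_map k \<delta> x + (\<delta> * \<zeta>) *\<^sub>R y) \<le> R"
      using near[OF that(1,3,4)] R1(2)[OF that(3)]
        norm_triangle_sub[of "shift_map k \<delta> x + (\<delta> * \<zeta>) *\<^sub>R y" x] by (simp add: R_def)
    then show "shift_map k \<delta> x + (\<delta> * \<zeta>) *\<^sub>R y \<in> cball 0 R" "x \<in> cball 0 R"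
      using R1(2)[OF that(3)] R2(1) \<zeta> by (simp_all add: R_def)
  qed
  have "emeasure lborel D < \<infinity>" using bounded_D by (rule emeasure_bounded_finite)
  then obtain \<mu> where \<mu>: "emeasure lborel D = ennreal \<mu>" "0 \<le> \<mu>"
    by (metis ennreal_cases infinity_ennreal_def less_irrefl)
  \<comment> \<open>The transported error costs the factor \<open>overlap\<close>, the direct error
    and the increment of g cost 1 each, and the splitting multiplies everything by 3^r.\<close>
  define \<epsilon>\<^sub>1 where "\<epsilon>\<^sub>1 = \<epsilon> / (3 powr r * (overlap + 2))"
  have \<epsilon>1: "\<epsilon>\<^sub>1 > 0" using \<epsilon> overlap_nonneg by (simp add: \<epsilon>\<^sub>1_def)
  \<comment> \<open>Makes the r-th power of \<open>\<eta>\<close> times the volume of D at most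
    \<open>\<epsilon>\<^sub>1\<close>; adding 1 to the volume covers volume 0.\<close>
  define \<eta> where "\<eta> = (\<epsilon>\<^sub>1 / (\<mu> + 1)) powr (1 / r)"
  have \<eta>: "\<eta> > 0" using \<epsilon>1 \<mu>(2) by (simp add: \<eta>_def)
  have "\<eta> powr r = \<epsilon>\<^sub>1 / (\<mu> + 1)" using \<epsilon>1 \<mu>(2) r by (simp add: \<eta>_def powr_powr)
  then have "\<eta> powr r * \<mu> + \<eta> powr r = \<epsilon>\<^sub>1" using \<epsilon>1 \<mu>(2) by (simp add: field_simps)
  moreover have "0 \<le> \<eta> powr r" by simp
  ultimately have \<eta>_le: "\<eta> powr r * \<mu> \<le> \<epsilon>\<^sub>1" by linarith
  obtain g where g: "continuous_on UNIV g"
    "powr_integral_on (cball 0 R) r (\<lambda>x. F x - g x) < ennreal \<epsilon>\<^sub>1"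
    by (rule Lp_continuous_approx[OF assms(1) r fin \<epsilon>1])
  have [measurable]: "g \<in> borel_measurable borel"
    by (intro borel_measurable_continuous_onI g)
  have "uniformly_continuous_on (cball 0 R) g"
    by (intro compact_uniformly_continuous continuous_on_subset[OF g(1)]) auto
  then obtain s where s: "s > 0" "\<And>x y. x \<in> cball 0 R \<Longrightarrow> y \<in> cball 0 R \<Longrightarrow> dist x y < s \<Longrightarrow> dist (g x) (g y) < \<eta>"
    using \<eta> unfolding uniformly_continuous_on_def by (metis dist_commute)
  define \<delta>\<^sub>1 where "\<delta>\<^sub>1 = s / (R\<^sub>2 + \<zeta>)"
  have \<delta>1: "\<delta>\<^sub>1 > 0" using s(1) R2(1) \<zeta> by (simp add: \<delta>\<^sub>1_def)
  have [measurable]: "cball (0::real^'d) R \<in> sets borel" by simp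
  define G where "G x = ennreal (norm (F x - g x) powr r) * indicator (cball 0 R) x" for x
  have [measurable]: "G \<in> borel_measurable borel" unfolding G_def[abs_def] by measurable
  have intG: "(\<integral>\<^sup>+x. G x \<partial>lborel) \<le> ennreal \<epsilon>\<^sub>1" using g(2) by (simp add: G_def less_imp_le)
  show ?thesis
  proof (rule that[OF \<delta>1])
    fix \<delta> assume \<delta>: "0 < \<delta>" "\<delta> \<le> \<delta>\<^sub>0" "\<delta> < \<delta>\<^sub>1"
    let ?\<Phi> = "\<lambda>x y. shift_map k \<delta> x + (\<delta> * \<zeta>) *\<^sub>R y"
    have e: "\<delta> * \<zeta> > 0" using \<delta>(1) \<zeta> by simp
    \<comment> \<open>The kernel has mass 1, so F x may be moved under the integral.\<close>
    have avg_diff: "avg k \<zeta> \<delta> F x - F x = (LINT y|lebesgue. mollifier y *\<^sub>R (F (?\<Phi> x y) - F x))" for x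
    proof -
      have "(LINT y|lborel. mollifier y *\<^sub>R (F (?\<Phi> x y) - F x)) =
          (LINT y|lborel. mollifier y *\<^sub>R F (?\<Phi> x y)) - (LINT y|lborel. mollifier (y::real^'d) *\<^sub>R F x)"
        unfolding scaleR_diff_right
        by (rule Bochner_Integration.integral_diff[OF integrable_mollifier_affine[OF assms(1) r e fin]])
          (simp add: integrable_mollifier)
      also have "(LINT y|lborel. mollifier (y::real^'d) *\<^sub>R F x) = F x"
        by (simp add: integrable_mollifier integral_mollifier_lborel)
      finally show ?thesis by (simp add: avg_def integral_completion)
    qed
    have inner: "powr_integral_on D r (\<lambda>x. F (?\<Phi> x y) - F x) \<le> ennreal \<epsilon>"
      if y: "norm y < 1" for y
    proof -
      have "powr_integral_on D r (\<lambda>x. F (?\<Phi> x y) - F x)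
        \<le> (\<integral>\<^sup>+x. ennreal (3 powr r) * (G (?\<Phi> x y) * indicator D x + ennreal (\<eta> powr r) * indicator D x + G x) \<partial>lborel)"
      proof (rule nn_integral_mono)
        fix x
        show "ennreal (norm (F (?\<Phi> x y) - F x) powr r) * indicator D x
            \<le> ennreal (3 powr r) * (G (?\<Phi> x y) * indicator D x + ennreal (\<eta> powr r) * indicator D x + G x)"
        proof (cases "x \<in> D")
          case True
          note in_ball = far[OF \<delta>(1,2) True y]
          have "norm (?\<Phi> x y - x) \<le> \<delta> * (R\<^sub>2 + \<zeta>)" by (rule near[OF \<delta>(1) True y])
          also have "\<dots> < s"
            using \<delta>(3) R2(1) \<zeta> by (simp add: \<delta>\<^sub>1_def pos_less_divide_eq)
          finally have "norm (g (?\<Phi> x y) - g x) \<le> \<eta>"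
            using s(2)[OF in_ball] by (simp add: dist_norm)
          moreover have "norm (F (?\<Phi> x y) - F x) \<le> norm (F (?\<Phi> x y) - g (?\<Phi> x y)) + norm (g (?\<Phi> x y) - g x) + norm (F x - g x)"
            using norm_triangle_ineq[of "F (?\<Phi> x y) - g (?\<Phi> x y) + (g (?\<Phi> x y) - g x)" "g x - F x"]
              norm_triangle_ineq[of "F (?\<Phi> x y) - g (?\<Phi> x y)" "g (?\<Phi> x y) - g x"]
            by (simp add: norm_minus_commute)
          ultimately have "norm (F (?\<Phi> x y) - F x) powr r \<le> (norm (F (?\<Phi> x y) - g (?\<Phi> x y)) + \<eta> + norm (F x - g x)) powr r"
            using r by (intro powr_mono2) auto
          also have "\<dots> \<le> 3 powr r * (norm (F (?\<Phi> x y) - g (?\<Phi> x y)) powr r + \<eta> powr r + norm (F x - g x) powr r)"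
            using r \<eta> by (intro powr_add3_le) auto
          finally show ?thesis
            using True in_ball by (simp add: G_def ennreal_mult[symmetric] ennreal_plus[symmetric] ennreal_leI del: ennreal_plus)
        qed simp
      qed
      also have "\<dots> = ennreal (3 powr r) * ((\<integral>\<^sup>+x. G (?\<Phi> x y) * indicator D x \<partial>lborel)
          + ennreal (\<eta> powr r) * emeasure lborel D + (\<integral>\<^sup>+x. G x \<partial>lborel))"
        by (simp add: nn_integral_cmult nn_integral_add)
      also have "\<dots> \<le> ennreal (3 powr r) * (ennreal overlap * ennreal \<epsilon>\<^sub>1 + ennreal \<epsilon>\<^sub>1 + ennreal \<epsilon>\<^sub>1)"
      proof (intro mult_left_mono add_mono intG)
        have "(\<integral>\<^sup>+x. G (?\<Phi> x y) * indicator D x \<partial>lborel) \<le> ennreal overlap * (\<integral>\<^sup>+x. G x \<partial>lborel)"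
          using \<delta> by (intro nn_integral_shift_le) auto
        also have "\<dots> \<le> ennreal overlap * ennreal \<epsilon>\<^sub>1" by (intro mult_left_mono intG) simp
        finally show "(\<integral>\<^sup>+x. G (?\<Phi> x y) * indicator D x \<partial>lborel) \<le> ennreal overlap * ennreal \<epsilon>\<^sub>1" .
        show "ennreal (\<eta> powr r) * emeasure lborel D \<le> ennreal \<epsilon>\<^sub>1"
          using \<eta>_le by (simp add: \<mu> ennreal_mult[symmetric] ennreal_leI)
      qed simp
      also have "\<dots> = ennreal (3 powr r * (overlap * \<epsilon>\<^sub>1 + \<epsilon>\<^sub>1 + \<epsilon>\<^sub>1))"
        using overlap_nonneg \<epsilon>1 by (simp add: ennreal_mult[symmetric] ennreal_plus[symmetric] del: ennreal_plus)
      also have "3 powr r * (overlap * \<epsilon>\<^sub>1 + \<epsilon>\<^sub>1 + \<epsilon>\<^sub>1) = 3 powr r * (overlap + 2) * \<epsilon>\<^sub>1"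
        by (simp add: algebra_simps)
      also have "\<dots> = \<epsilon>"
        using overlap_nonneg by (simp add: \<epsilon>\<^sub>1_def)
      finally show ?thesis .
    qed
    show "powr_integral_on D r (\<lambda>x. avg k \<zeta> \<delta> F x - F x) \<le> ennreal \<epsilon>"
      unfolding avg_diff by (rule mollifier_average_le[OF _ sets_D r inner]) measurable
  qed
qed

end

section \<open>Uniform bounds and convergence\<close>

lemma nn_integral_lebesgue_on:
  "S \<in> sets borel \<Longrightarrow> (\<integral>\<^sup>+x. h x \<partial>lebesgue_on S) = (\<integral>\<^sup>+x. h x * indicator S x \<partial>lborel)"
  by (simp add: nn_integral_restrict_space nn_integral_completion)

section \<open>Norms of finite exponent through integrals of powers\<close>

lemma enn2real_ge_1:
  assumes "1 \<le> p" "p < \<infinity>"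
  shows "1 \<le> enn2real p"
  using enn2real_mono[OF assms(1)] assms(2) by simp

lemma Lp_norm_le:
  assumes p: "1 \<le> p" "p < \<infinity>" and c: "0 \<le> c"
    and le: "powr_integral (lebesgue_on S) (enn2real p) f \<le> ennreal (c powr enn2real p)"
  shows "Lp_norm p S f \<le> ennreal c"
proof -
  let ?I = "\<integral>\<^sup>+x. ennreal (norm (f x) powr enn2real p) \<partial>lebesgue_on S"
  note r = enn2real_ge_1[OF p]
  have "?I < \<infinity>" using le by (rule order_le_less_trans) simp
  have "enn2real ?I \<le> c powr enn2real p"
    using enn2real_mono[OF le] by simp
  then have "enn2real ?I powr (1 / enn2real p) \<le> (c powr enn2real p) powr (1 / enn2real p)"
    using r by (intro powr_mono2) auto
  also have "\<dots> = c"
    using c r by (simp add: powr_powr)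
  finally show ?thesis
    using p(2) \<open>?I < \<infinity>\<close> by (auto simp: Lp_norm_def Let_def intro: ennreal_leI)
qed

lemma Lp_space_iff:
  assumes "p < \<infinity>"
  shows "f \<in> Lp_space p S \<longleftrightarrow> f \<in> borel_measurable (lebesgue_on S) \<and>
    powr_integral (lebesgue_on S) (enn2real p) f < \<infinity>"
  using assms by (auto simp: Lp_space_def Lp_norm_def Let_def less_top)

text \<open>Positivity of C settles the case of an infinite norm on the right, where the product
  must stay infinite.\<close>

lemma Lp_norm_scale:
  assumes p: "1 \<le> p" "p < \<infinity>" and C: "0 < C"
    and le: "powr_integral (lebesgue_on S) (enn2real p) f \<le>
      ennreal (C powr enn2real p) * powr_integral (lebesgue_on S) (enn2real p) g"
  shows "Lp_norm p S f \<le> ennreal C * Lp_norm p S g"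
proof (cases "powr_integral (lebesgue_on S) (enn2real p) g = \<infinity>")
  case True
  moreover have "p \<noteq> \<infinity>" using p by auto
  ultimately show ?thesis using C by (simp add: Lp_norm_def Let_def ennreal_mult_top)
next
  case False
  note r = enn2real_ge_1[OF p]
  let ?I = "\<integral>\<^sup>+x. ennreal (norm (g x) powr enn2real p) \<partial>lebesgue_on S"
  define s where "s = enn2real ?I"
  have s: "?I = ennreal s" "0 \<le> s" using False by (auto simp: s_def less_top)
  have "powr_integral (lebesgue_on S) (enn2real p) f \<le> ennreal ((C * s powr (1 / enn2real p)) powr enn2real p)"
    using le s r C by (simp add: ennreal_mult powr_mult powr_powr)
  then have "Lp_norm p S f \<le> ennreal (C * s powr (1 / enn2real p))"
    using C by (intro Lp_norm_le p) auto
  also have "\<dots> = ennreal C * Lp_norm p S g"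
    using p(2) C False by (auto simp: Lp_norm_def Let_def s_def[symmetric] ennreal_mult)
  finally show ?thesis .
qed

lemma zero_ext_measurable:
  fixes f :: "'a::euclidean_space \<Rightarrow> 'b::euclidean_space"
  assumes "S \<in> sets borel" "f \<in> borel_measurable (lebesgue_on S)"
  shows "zero_ext S f \<in> borel_measurable lebesgue"
proof -
  have "(\<lambda>x. indicator S x *\<^sub>R f x) \<in> borel_measurable lebesgue"
    using assms by (simp add: borel_measurable_restrict_space_iff)
  moreover have "(\<lambda>x. indicator S x *\<^sub>R f x) = zero_ext S f"
    by (auto simp: zero_ext_def indicator_def)
  ultimately show ?thesis by simp
qed

lemma nn_integral_zero_ext:
  assumes "S \<in> sets borel" "1 \<le> r"
  shows "powr_integral lborel r (zero_ext S f) = powr_integral (lebesgue_on S) r f"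
  unfolding nn_integral_lebesgue_on[OF assms(1)]
  using assms(2) by (intro nn_integral_cong) (auto simp: zero_ext_def indicator_def)

lemma zero_ext_Lp_space:
  assumes "S \<in> sets borel" "1 \<le> p" "p < \<infinity>" "f \<in> Lp_space p S"
  shows "zero_ext S f \<in> Lp_space p UNIV"
  using assms zero_ext_measurable[OF assms(1), of f] nn_integral_zero_ext[OF assms(1) enn2real_ge_1[OF assms(2,3)], of f]
  by (simp add: Lp_space_iff lebesgue_on_UNIV_eq nn_integral_completion)

text \<open>On a bounded set every L^p, including p = \<infinity>, lies in L^1. This makes the
  convolution calculus, stated for integrable functions, available for all data.\<close>

lemma integrable_zero_ext:
  fixes f :: "'a::euclidean_space \<Rightarrow> 'b::euclidean_space"
  assumes S: "S \<in> sets borel" "bounded S" and p: "1 \<le> p" and f: "f \<in> Lp_space p S"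
  shows "integrable lebesgue (zero_ext S f)"
proof (rule integrableI_bounded)
  have fm: "f \<in> borel_measurable (lebesgue_on S)" using f by (simp add: Lp_space_def)
  show "zero_ext S f \<in> borel_measurable lebesgue"
    by (rule zero_ext_measurable[OF S(1) fm])
  have fin: "emeasure lborel S < \<infinity>" using S(2) by (rule emeasure_bounded_finite)
  have eq: "(\<integral>\<^sup>+x. ennreal (norm (zero_ext S f x)) \<partial>lebesgue) = (\<integral>\<^sup>+x. ennreal (norm (f x)) \<partial>lebesgue_on S)"
    unfolding nn_integral_lebesgue_on[OF S(1)] nn_integral_completion
    by (intro nn_integral_cong) (auto simp: zero_ext_def indicator_def)
  also have "\<dots> < \<infinity>"
  proof (cases "p = \<infinity>")
    case True
    have "esssup (lebesgue_on S) (\<lambda>x. ennreal (norm (f x))) < \<infinity>"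
      using f True by (simp add: Lp_space_def Lp_norm_def)
    then obtain m where m: "esssup (lebesgue_on S) (\<lambda>x. ennreal (norm (f x))) = ennreal m"
      by (metis ennreal_cases infinity_ennreal_def less_irrefl)
    have "(\<integral>\<^sup>+x. ennreal (norm (f x)) \<partial>lebesgue_on S) \<le> (\<integral>\<^sup>+x. ennreal m \<partial>lebesgue_on S)"
      using esssup_AE[where M = "lebesgue_on S" and f = "\<lambda>x. ennreal (norm (f x))"] by (intro nn_integral_mono_AE) (simp add: m)
    also have "\<dots> = ennreal m * emeasure lborel S"
      unfolding nn_integral_lebesgue_on[OF S(1)] using S(1) by (simp add: nn_integral_cmult)
    also have "\<dots> < \<infinity>" using fin by (simp add: ennreal_mult_less_top)
    finally show ?thesis .
  next
    case False
    then have p': "p < \<infinity>" by (simp add: less_top)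
    note r = enn2real_ge_1[OF p p']
    have "(\<integral>\<^sup>+x. ennreal (norm (f x)) \<partial>lebesgue_on S) \<le> (\<integral>\<^sup>+x. 1 + ennreal (norm (f x) powr enn2real p) \<partial>lebesgue_on S)"
    proof (rule nn_integral_mono)
      fix x
      have "norm (f x) \<le> 1 + norm (f x) powr enn2real p" by (rule le_one_plus_powr[OF r])
      then have "ennreal (norm (f x)) \<le> ennreal (1 + norm (f x) powr enn2real p)" by (rule ennreal_leI)
      then show "ennreal (norm (f x)) \<le> 1 + ennreal (norm (f x) powr enn2real p)" by simp
    qed
    also have "\<dots> = (\<integral>\<^sup>+x. 1 \<partial>lebesgue_on S) + powr_integral (lebesgue_on S) (enn2real p) f"
      using fm by (intro nn_integral_add) auto
    also have "(\<integral>\<^sup>+x. 1 \<partial>lebesgue_on S) = emeasure lborel S"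
      unfolding nn_integral_lebesgue_on[OF S(1)] using S(1) by simp
    also have "emeasure lborel S + powr_integral (lebesgue_on S) (enn2real p) f < \<infinity>"
      using fin f p' by (simp add: Lp_space_iff)
    finally show ?thesis .
  qed
  finally show "(\<integral>\<^sup>+x. ennreal (norm (zero_ext S f x)) \<partial>lebesgue) < \<infinity>" .
qed

lemma tendsto_0_ennrealI:
  assumes "\<And>\<epsilon>. 0 < \<epsilon> \<Longrightarrow> \<forall>\<^sub>F x in F. f x \<le> ennreal \<epsilon>"
  shows "(f \<longlongrightarrow> 0) F"
proof (rule order_tendstoI)
  fix a :: ennreal assume "0 < a"
  then obtain b where "0 < b" "b < a" using dense by blast
  then obtain \<epsilon> where "b = ennreal \<epsilon>" "0 < \<epsilon>"
    by (metis ennreal_cases ennreal_less_zero_iff not_less_zero order_less_imp_not_less top.not_eq_extremum ennreal_0 less_le)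
  then show "\<forall>\<^sub>F x in F. f x < a"
    using assms[of \<epsilon>] \<open>b < a\<close> by (auto elim: eventually_mono)
qed simp

context averaging
begin

text \<open>The common core of all the limits. The error splits into the deviation of A from the
  identity at the average, which is O(\<delta>) by the uniform bound, and the average minus
  F.\<close>

lemma perturbed_avg_tendsto:
  fixes F :: "real^'d \<Rightarrow> 'b::euclidean_space"
  assumes p: "1 \<le> p" "p < \<infinity>" and F: "F \<in> Lp_space p UNIV" and c: "0 \<le> c"
    and A: "\<And>\<delta> x v. 0 < \<delta> \<Longrightarrow> \<delta> \<le> \<delta>\<^sub>0 \<Longrightarrow> x \<in> D \<Longrightarrow> norm (A \<delta> x v - v) \<le> c * \<delta> * norm v"
  shows "((\<lambda>\<delta>. Lp_norm p D (\<lambda>x. A \<delta> x (avg k \<zeta> \<delta> F x) - F x)) \<longlongrightarrow> 0) (at 0 within {0..\<delta>\<^sub>0})"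
proof (rule tendsto_0_ennrealI)
  fix \<epsilon> :: real assume \<epsilon>: "0 < \<epsilon>"
  define r where "r = enn2real p"
  have r: "1 \<le> r" unfolding r_def by (rule enn2real_ge_1[OF p])
  have Fm: "F \<in> borel_measurable lebesgue" and Ffin: "powr_integral lborel r F < \<infinity>"
    using F p by (auto simp: Lp_space_iff lebesgue_on_UNIV_eq nn_integral_completion r_def)
  obtain F' where F'[measurable]: "F' \<in> borel_measurable borel" and ae: "AE x in lborel. F x = F' x"
    by (rule lebesgue_measurable_borel_representative[OF Fm])
  have F'm: "F' \<in> borel_measurable lebesgue" by (intro measurable_completion) simp
  have F'fin: "powr_integral lborel r F' < \<infinity>"
  proof -
    have "powr_integral lborel r F' = powr_integral lborel r F"
      using ae by (intro nn_integral_cong_AE) (auto elim: eventually_mono)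
    then show ?thesis using Ffin by simp
  qed
  obtain s where s: "powr_integral lborel r F' = ennreal s" "0 \<le> s"
    using F'fin by (metis ennreal_cases infinity_ennreal_def less_irrefl)
  have avg_eq: "avg k \<zeta> \<delta> F x = avg k \<zeta> \<delta> F' x" if "0 < \<delta>" for \<delta> x
    using ae by (intro avg_cong_AE that \<zeta> Fm F'm) (rule AE_completion)
  \<comment> \<open>Each of the two errors may take half of the r-th power of
    \<open>\<epsilon>\<close>, after division by the factor 3^r of the splitting.\<close>
  define E where "E = \<epsilon> powr r / (3 powr r * 2)"
  have E: "E > 0" using \<epsilon> by (simp add: E_def)
  obtain \<delta>\<^sub>1 where \<delta>1: "0 < \<delta>\<^sub>1" "\<And>\<delta>. 0 < \<delta> \<Longrightarrow> \<delta> \<le> \<delta>\<^sub>0 \<Longrightarrow> \<delta> < \<delta>\<^sub>1 \<Longrightarrow>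
    powr_integral_on D r (\<lambda>x. avg k \<zeta> \<delta> F' x - F' x) \<le> ennreal E"
    by (rule avg_tendsto[OF F' r F'fin E]) blast
  define K where "K = c powr r * (overlap * s)"
  have K: "0 \<le> K" using overlap_nonneg s(2) by (simp add: K_def)
  \<comment> \<open>Below this value the first error, at most K times the r-th power of \<delta>,
    stays under E; K + 1 covers K = 0.\<close>
  define \<delta>\<^sub>2 where "\<delta>\<^sub>2 = (E / (K + 1)) powr (1 / r)"
  have \<delta>2: "0 < \<delta>\<^sub>2" "\<delta>\<^sub>2 powr r * K \<le> E"
  proof -
    show "0 < \<delta>\<^sub>2" using E K by (simp add: \<delta>\<^sub>2_def)
    have "\<delta>\<^sub>2 powr r = E / (K + 1)" using E K r by (simp add: \<delta>\<^sub>2_def powr_powr)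
    moreover have "E / (K + 1) * K \<le> E * 1"
      using E K by (simp add: field_simps)
    ultimately show "\<delta>\<^sub>2 powr r * K \<le> E" by simp
  qed
  have "Lp_norm p D (\<lambda>x. A \<delta> x (avg k \<zeta> \<delta> F x) - F x) \<le> ennreal \<epsilon>"
    if \<delta>: "0 < \<delta>" "\<delta> \<le> \<delta>\<^sub>0" "\<delta> < \<delta>\<^sub>1" "\<delta> < \<delta>\<^sub>2" for \<delta>
  proof (rule Lp_norm_le[OF p less_imp_le[OF \<epsilon>]])
    let ?a = "avg k \<zeta> \<delta> F'"
    note [measurable] = avg_measurable[OF F', of \<delta>]
    have "powr_integral (lebesgue_on D) (enn2real p) (\<lambda>x. A \<delta> x (avg k \<zeta> \<delta> F x) - F x)
      = powr_integral_on D r (\<lambda>x. A \<delta> x (?a x) - F x)"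
      by (simp add: nn_integral_lebesgue_on r_def avg_eq[OF \<delta>(1)])
    also have "\<dots> \<le> (\<integral>\<^sup>+x. ennreal (3 powr r) * (ennreal ((c * \<delta>) powr r) * (ennreal (norm (?a x) powr r) * indicator D x)
        + ennreal (norm (?a x - F' x) powr r) * indicator D x) \<partial>lborel)"
    proof (rule nn_integral_mono_AE, use ae in eventually_elim)
      fix x assume eq: "F x = F' x"
      show "ennreal (norm (A \<delta> x (?a x) - F x) powr r) * indicator D x \<le>
          ennreal (3 powr r) * (ennreal ((c * \<delta>) powr r) * (ennreal (norm (?a x) powr r) * indicator D x)
          + ennreal (norm (?a x - F' x) powr r) * indicator D x)"
      proof (cases "x \<in> D")
        case True
        have "norm (A \<delta> x (?a x) - F x) \<le> norm (A \<delta> x (?a x) - ?a x) + norm (?a x - F' x)"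
          using norm_triangle_ineq[of "A \<delta> x (?a x) - ?a x" "?a x - F' x"] by (simp add: eq)
        also have "\<dots> \<le> c * \<delta> * norm (?a x) + norm (?a x - F' x) + 0"
          using A[OF \<delta>(1,2) True, of "?a x"] by simp
        finally have "norm (A \<delta> x (?a x) - F x) powr r \<le> (c * \<delta> * norm (?a x) + norm (?a x - F' x) + 0) powr r"
          using r by (intro powr_mono2) auto
        also have "\<dots> \<le> 3 powr r * ((c * \<delta> * norm (?a x)) powr r + norm (?a x - F' x) powr r + 0 powr r)"
          using r c \<delta>(1) by (intro powr_add3_le) auto
        also have "\<dots> = 3 powr r * ((c * \<delta>) powr r * norm (?a x) powr r + norm (?a x - F' x) powr r)"
          by (simp add: powr_mult)
        finally show ?thesis
          using True by (simp add: ennreal_mult[symmetric] ennreal_plus[symmetric] ennreal_leI del: ennreal_plus)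
      qed simp
    qed
    also have "\<dots> = ennreal (3 powr r) * (ennreal ((c * \<delta>) powr r) * powr_integral_on D r ?a
        + powr_integral_on D r (\<lambda>x. ?a x - F' x))"
      by (simp add: nn_integral_cmult nn_integral_add)
    also have "\<dots> \<le> ennreal (3 powr r) * (ennreal ((c * \<delta>) powr r) * (ennreal overlap * ennreal s) + ennreal E)"
    proof (intro mult_left_mono add_mono \<delta>1(2) \<delta>(1-3))
      show "powr_integral_on D r ?a \<le> ennreal overlap * ennreal s"
        using nn_integral_avg_le[OF _ r F', of \<delta>] \<delta> s(1) by simp
    qed simp_all
    also have "\<dots> = ennreal (3 powr r * (\<delta> powr r * K + E))"
      using overlap_nonneg s(2) E K by (simp add: ennreal_mult[symmetric] ennreal_plus[symmetric] K_def powr_mult mult_ac del: ennreal_plus)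
    also have "\<dots> \<le> ennreal (3 powr r * (E + E))"
    proof (intro ennreal_leI mult_left_mono add_mono)
      have "\<delta> powr r * K \<le> \<delta>\<^sub>2 powr r * K"
        using \<delta> r K by (intro mult_right_mono powr_mono2) auto
      then show "\<delta> powr r * K \<le> E" using \<delta>2(2) by simp
    qed simp_all
    also have "3 powr r * (E + E) = \<epsilon> powr r" by (simp add: E_def)
    finally show "powr_integral (lebesgue_on D) (enn2real p) (\<lambda>x. A \<delta> x (avg k \<zeta> \<delta> F x) - F x)
        \<le> ennreal (\<epsilon> powr enn2real p)" by (simp add: r_def)
  qed
  then show "\<forall>\<^sub>F \<delta> in at 0 within {0..\<delta>\<^sub>0}. Lp_norm p D (\<lambda>x. A \<delta> x (avg k \<zeta> \<delta> F x) - F x) \<le> ennreal \<epsilon>"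
    unfolding eventually_at using \<delta>1(1) \<delta>2(1)
    by (intro exI[of _ "min \<delta>\<^sub>1 \<delta>\<^sub>2"]) (auto simp: dist_real_def)
qed

text \<open>The kernel vanishes off the unit ball, so integration may extend over the whole
  space.\<close>

lemma mollify_g_eq_avg: "mollify_g D k \<zeta> \<delta> f x = avg k \<zeta> \<delta> (zero_ext D f) x"
  unfolding mollify_g_def avg_def
  by (subst integral_lebesgue_on_eq) (auto simp: mollifier_eq_0)

lemma mollify_eq_avg:
  assumes "0 \<le> \<delta>" "integrable lebesgue (zero_ext D f)"
  shows "mollify D k \<zeta> B \<delta> f x = B \<delta> x *v avg k \<zeta> \<delta> (zero_ext D f) x"
proof -
  have "zero_ext D (\<lambda>z. f z $ i) = (\<lambda>z. zero_ext D f z $ i)" for i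
    by (auto simp: zero_ext_def)
  then have "(\<chi> i. mollify_g D k \<zeta> \<delta> (\<lambda>z. f z $ i) x) = avg k \<zeta> \<delta> (zero_ext D f) x"
    by (simp add: vec_eq_iff mollify_g_eq_avg avg_component[OF assms(1) \<zeta> assms(2)])
  then show ?thesis by (simp add: mollify_def)
qed

lemma mollify_operator_bound:
  fixes B :: "real \<Rightarrow> real^'d \<Rightarrow> real^'q^'q"
  assumes p: "1 \<le> p" and c: "0 \<le> c"
    and cont: "\<And>\<delta>. \<delta> \<in> {0..\<delta>\<^sub>0} \<Longrightarrow> continuous_on D (B \<delta>)"
    and B: "\<And>\<delta> x v. \<delta> \<in> {0..\<delta>\<^sub>0} \<Longrightarrow> x \<in> D \<Longrightarrow> norm (B \<delta> x *v v - v) \<le> c * \<delta> * norm v"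
  shows "\<exists>C. \<forall>\<delta>\<in>{0..\<delta>\<^sub>0}. Lp_operator_bound p D (mollify D k \<zeta> B \<delta>) C"
proof -
  define r where "r = enn2real p"
  \<comment> \<open>The factor 1 + c bounds the matrices, as \<delta> is at most 1. The 1 added to
    \<open>overlap\<close> covers \<delta> = 0, where the average is the function itself. For p =
    \<infinity> averaging does not increase the norm.\<close>
  define C' where "C' = (1 + c) * (if p = \<infinity> then 1 else (overlap + 1) powr (1 / r))"
  have C': "C' > 0" using c overlap_nonneg by (simp add: C'_def)
  note int = integrable_zero_ext[OF sets_D bounded_D p]
  have B_le: "norm (B \<delta> x *v v) \<le> (1 + c) * norm v" if "\<delta> \<in> {0..\<delta>\<^sub>0}" "x \<in> D" for \<delta> x v
  proof -
    have "norm (B \<delta> x *v v) \<le> norm v + norm (B \<delta> x *v v - v)"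
      using norm_triangle_sub by blast
    also have "\<dots> \<le> norm v + c * 1 * norm v"
      using B[OF that, of v] that(1) \<delta>\<^sub>0 c
      by (intro add_mono order_trans[OF B[OF that]] mult_right_mono mult_left_mono) auto
    finally show ?thesis by (simp add: distrib_right)
  qed
  have "Lp_operator_bound p D (mollify D k \<zeta> B \<delta>) C'" if \<delta>: "\<delta> \<in> {0..\<delta>\<^sub>0}" for \<delta>
    unfolding Lp_operator_bound_def
  proof (intro conjI ballI allI)
    have \<delta>0: "0 \<le> \<delta>" using \<delta> by simp
    show "AE x in lebesgue_on D. mollify D k \<zeta> B \<delta> (\<lambda>z. a *\<^sub>R f z + b *\<^sub>R g z) x =
        a *\<^sub>R mollify D k \<zeta> B \<delta> f x + b *\<^sub>R mollify D k \<zeta> B \<delta> g x"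
      if f: "f \<in> Lp_space p D" and g: "g \<in> Lp_space p D" for f g a b
    \<comment> \<open>Linearity holds at every point, because the extensions by zero are
      integrable.\<close>
    proof (rule AE_I2)
      fix x
      have eq: "zero_ext D (\<lambda>z. a *\<^sub>R f z + b *\<^sub>R g z) = (\<lambda>z. a *\<^sub>R zero_ext D f z + b *\<^sub>R zero_ext D g z)"
        by (auto simp: zero_ext_def)
      have i: "integrable lebesgue (zero_ext D (\<lambda>z. a *\<^sub>R f z + b *\<^sub>R g z))"
        unfolding eq using int[OF f] int[OF g] by simp
      show "mollify D k \<zeta> B \<delta> (\<lambda>z. a *\<^sub>R f z + b *\<^sub>R g z) x =
          a *\<^sub>R mollify D k \<zeta> B \<delta> f x + b *\<^sub>R mollify D k \<zeta> B \<delta> g x"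
        unfolding mollify_eq_avg[OF \<delta>0 i] mollify_eq_avg[OF \<delta>0 int[OF f]] mollify_eq_avg[OF \<delta>0 int[OF g]] eq
          avg_linear[OF \<delta>0 \<zeta> int[OF f] int[OF g]]
        by (simp add: matrix_vector_right_distrib matrix_vector_mult_scaleR)
    qed
    fix f :: "real^'d \<Rightarrow> real^'q" assume f: "f \<in> Lp_space p D"
    define F where "F = zero_ext D f"
    have F_int: "integrable lebesgue F" unfolding F_def by (rule int[OF f])
    have Fm: "F \<in> borel_measurable lebesgue" by (rule borel_measurable_integrable[OF F_int])
    have fm: "f \<in> borel_measurable (lebesgue_on D)" using f by (simp add: Lp_space_def)
    have D_leb: "D \<in> sets lebesgue" by (rule open_sets_lebesgue[OF open_D])
    have T: "mollify D k \<zeta> B \<delta> f = (\<lambda>x. B \<delta> x *v avg k \<zeta> \<delta> F x)"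
      by (intro ext) (simp add: mollify_eq_avg[OF \<delta>0 int[OF f]] F_def)
    obtain F' where F'[measurable]: "F' \<in> borel_measurable borel" and ae: "AE x in lborel. F x = F' x"
      by (rule lebesgue_measurable_borel_representative[OF Fm])
    have F'm: "F' \<in> borel_measurable lebesgue" by (intro measurable_completion) simp
    have avg_eq: "avg k \<zeta> \<delta> F x = avg k \<zeta> \<delta> F' x" if "0 < \<delta>" for x
      using ae by (intro avg_cong_AE that \<zeta> Fm F'm) (rule AE_completion)
    have avg_meas: "avg k \<zeta> \<delta> F \<in> borel_measurable (lebesgue_on D)"
    proof (cases "\<delta> = 0")
      case True
      then have "avg k \<zeta> \<delta> F = F" by (simp add: avg_zero fun_eq_iff)
      then show ?thesis using Fm by (simp add: measurable_restrict_space1)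
    next
      case False
      then have "avg k \<zeta> \<delta> F = avg k \<zeta> \<delta> F'" using avg_eq \<delta>0 by (simp add: fun_eq_iff)
      moreover have "avg k \<zeta> \<delta> F' \<in> borel_measurable lebesgue"
        by (intro measurable_completion) (simp add: avg_measurable)
      ultimately show ?thesis by (simp add: measurable_restrict_space1)
    qed
    have "B \<delta> \<in> borel_measurable (lebesgue_on D)"
      by (intro continuous_imp_measurable_on_sets_lebesgue cont \<delta> D_leb)
    then have T_meas: "mollify D k \<zeta> B \<delta> f \<in> borel_measurable (lebesgue_on D)"
      unfolding T using avg_meas
      by (intro borel_measurable_continuous_Pair[where H = "(*v)"])
        (auto simp: matrix_vector_mult_def intro!: continuous_intros)
    have "Lp_norm p D (mollify D k \<zeta> B \<delta> f) \<le> ennreal C' * Lp_norm p D f"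
    proof (cases "p = \<infinity>")
      case True
      have norm_fin: "Lp_norm p D f < \<infinity>" using f by (simp add: Lp_space_def)
      define m where "m = enn2real (Lp_norm p D f)"
      have m: "Lp_norm p D f = ennreal m" "0 \<le> m" using norm_fin by (auto simp: m_def)
      have "AE x in lebesgue_on D. ennreal (norm (f x)) \<le> ennreal m"
        using esssup_AE[where M = "lebesgue_on D" and f = "\<lambda>x. ennreal (norm (f x))"] m(1) True by (simp add: Lp_norm_def)
      then have ae_D: "AE x in lebesgue_on D. norm (f x) \<le> m"
        using m(2) by (auto elim: eventually_mono simp: ennreal_le_iff)
      then have "AE x in lebesgue. x \<in> D \<longrightarrow> norm (f x) \<le> m"
        using D_leb by (simp add: AE_restrict_space_iff)
      then have ae_F: "AE z in lebesgue. norm (F z) \<le> m"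
        by eventually_elim (auto simp: F_def zero_ext_def m(2))
      have "AE x in lebesgue_on D. norm (avg k \<zeta> \<delta> F x) \<le> m"
      proof (cases "\<delta> = 0")
        case True
        then show ?thesis
          using ae_F D_leb by (simp add: avg_zero AE_restrict_space_iff) (auto elim: eventually_mono)
      qed (use norm_avg_le[OF _ \<zeta> F_int ae_F] \<delta>0 in simp)
      then have "AE x in lebesgue_on D. ennreal (norm (mollify D k \<zeta> B \<delta> f x)) \<le> ennreal (C' * m)"
        using AE_space
      proof eventually_elim
        fix x assume x: "norm (avg k \<zeta> \<delta> F x) \<le> m" "x \<in> space (lebesgue_on D)"
        then have "norm (mollify D k \<zeta> B \<delta> f x) \<le> (1 + c) * norm (avg k \<zeta> \<delta> F x)"
          using B_le[OF \<delta>] by (simp add: T space_restrict_space)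
        also have "\<dots> \<le> (1 + c) * m" using x c by (intro mult_left_mono) auto
        finally show "ennreal (norm (mollify D k \<zeta> B \<delta> f x)) \<le> ennreal (C' * m)"
          using True by (intro ennreal_leI) (simp add: C'_def)
      qed
      then have "Lp_norm p D (mollify D k \<zeta> B \<delta> f) \<le> ennreal (C' * m)"
        using True T_meas by (simp add: Lp_norm_def esssup_I)
      then show ?thesis using C' m by (simp add: ennreal_mult)
    next
      case False
      then have p': "p < \<infinity>" by (simp add: less_top)
      have r: "1 \<le> r" unfolding r_def by (rule enn2real_ge_1[OF p p'])
      have I_F: "powr_integral lborel r F = powr_integral (lebesgue_on D) r f"
        unfolding F_def by (rule nn_integral_zero_ext[OF sets_D r])
      have avg_le: "powr_integral_on D r (avg k \<zeta> \<delta> F)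
          \<le> ennreal (overlap + 1) * powr_integral lborel r F"
      proof (cases "\<delta> = 0")
        case True
        have "powr_integral_on D r F \<le> 1 * powr_integral lborel r F"
          by (simp, intro nn_integral_mono) (auto simp: indicator_def)
        also have "\<dots> \<le> ennreal (overlap + 1) * powr_integral lborel r F"
          using overlap_nonneg by (intro mult_right_mono) auto
        finally show ?thesis using True by (simp add: avg_zero)
      next
        case False
        then have "avg k \<zeta> \<delta> F = avg k \<zeta> \<delta> F'" using avg_eq \<delta>0 by (simp add: fun_eq_iff)
        moreover have "powr_integral lborel r F' = powr_integral lborel r F"
          using ae by (intro nn_integral_cong_AE) (auto elim: eventually_mono)
        ultimately have "powr_integral_on D r (avg k \<zeta> \<delta> F)
            \<le> ennreal overlap * powr_integral lborel r F"
          using nn_integral_avg_le[OF \<delta> r F'] by simp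
        also have "\<dots> \<le> ennreal (overlap + 1) * powr_integral lborel r F"
          by (intro mult_right_mono ennreal_leI) auto
        finally show ?thesis .
      qed
      have "powr_integral (lebesgue_on D) r (mollify D k \<zeta> B \<delta> f)
          \<le> (\<integral>\<^sup>+x. ennreal ((1 + c) powr r) * ennreal (norm (avg k \<zeta> \<delta> F x) powr r) \<partial>lebesgue_on D)"
      proof (rule nn_integral_mono)
        fix x assume "x \<in> space (lebesgue_on D)"
        then have "x \<in> D" by (simp add: space_restrict_space)
        then have "norm (mollify D k \<zeta> B \<delta> f x) powr r \<le> ((1 + c) * norm (avg k \<zeta> \<delta> F x)) powr r"
          using B_le[OF \<delta>] r unfolding T by (intro powr_mono2) auto
        then show "ennreal (norm (mollify D k \<zeta> B \<delta> f x) powr r) \<le> ennreal ((1 + c) powr r) * ennreal (norm (avg k \<zeta> \<delta> F x) powr r)"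
          by (simp add: powr_mult ennreal_mult[symmetric] ennreal_leI)
      qed
      also have "\<dots> = ennreal ((1 + c) powr r) * powr_integral (lebesgue_on D) r (avg k \<zeta> \<delta> F)"
        using avg_meas by (intro nn_integral_cmult) measurable
      also have "\<dots> \<le> ennreal ((1 + c) powr r) * (ennreal (overlap + 1) * powr_integral lborel r F)"
        unfolding nn_integral_lebesgue_on[OF sets_D] by (intro mult_left_mono avg_le) simp
      also have "\<dots> = ennreal (C' powr enn2real p) * powr_integral (lebesgue_on D) r f"
        using False r overlap_nonneg by (simp add: I_F C'_def r_def[symmetric] powr_mult powr_powr ennreal_mult mult.assoc)
      finally show ?thesis
        by (intro Lp_norm_scale[OF p p' C']) (simp add: r_def)
    qed
    moreover have "ennreal C' * Lp_norm p D f < \<infinity>"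
      using f by (simp add: Lp_space_def ennreal_mult_less_top)
    ultimately show "mollify D k \<zeta> B \<delta> f \<in> Lp_space p D"
      "Lp_norm p D (mollify D k \<zeta> B \<delta> f) \<le> ennreal C' * Lp_norm p D f"
      using T_meas by (auto simp: Lp_space_def intro: order_le_less_trans)
  qed
  then show ?thesis by blast
qed

end

lemma Lp_norm_cong:
  assumes "p < \<infinity>" "\<And>x. x \<in> S \<Longrightarrow> f x = g x"
  shows "Lp_norm p S f = Lp_norm p S g"
proof -
  have "powr_integral (lebesgue_on S) (enn2real p) f =
      powr_integral (lebesgue_on S) (enn2real p) g"
    using assms(2) by (intro nn_integral_cong) (simp add: space_restrict_space)
  moreover have "p \<noteq> \<infinity>" using assms(1) by auto
  ultimately show ?thesis by (simp add: Lp_norm_def Let_def)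
qed

lemma mollification_setting_averaging:
  "mollification_setting D xD rD Out k \<zeta> \<delta>\<^sub>0 \<Longrightarrow> averaging D k \<zeta> \<delta>\<^sub>0"
  by (auto simp: mollification_setting_def transversal_setting_def intro!: averaging.intro)

text \<open>This is the derivative bound of order l = 0: the only list of directions is then the
  empty one, and the supremum is the matrix norm itself.\<close>

lemma admissible_fieldsE:
  fixes B :: "real \<Rightarrow> real^'d \<Rightarrow> real^'q^'q"
  assumes "admissible_fields D B"
  obtains c where "0 \<le> c"
    "\<And>\<delta> x v. \<delta> \<in> {0..1} \<Longrightarrow> x \<in> D \<Longrightarrow> norm (B \<delta> x *v v - v) \<le> c * \<delta> * norm v"
proof -
  obtain c where c: "0 \<le> c" "\<And>\<delta>. \<delta> \<in> {0..1} \<Longrightarrow>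
      (SUP x\<in>D. deriv_norm 0 (\<lambda>z. B \<delta> z - mat 1) x) \<le> ennreal (c * \<delta>)"
    using assms unfolding admissible_fields_def by blast
  have "norm (B \<delta> x *v v - v) \<le> c * \<delta> * norm v" if "\<delta> \<in> {0..1}" "x \<in> D" for \<delta> x v
  proof -
    have "{hs :: (real^'d) list. length hs = 0 \<and> (\<forall>h\<in>set hs. norm h \<le> 1)} = {[]}" by auto
    then have "deriv_norm 0 (\<lambda>z. B \<delta> z - mat 1) x = ennreal (matrix_norm (B \<delta> x - mat 1))"
      by (simp add: deriv_norm_def)
    then have "ennreal (matrix_norm (B \<delta> x - mat 1)) \<le> ennreal (c * \<delta>)"
      using c(2)[OF that(1)] that(2) by (metis SUP_le_iff)
    then have le: "matrix_norm (B \<delta> x - mat 1) \<le> c * \<delta>"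
      using that(1) c(1) by (simp add: ennreal_le_iff)
    have "norm (B \<delta> x *v v - v) = norm ((B \<delta> x - mat 1) *v v)"
      by (simp add: matrix_vector_mult_diff_rdistrib)
    also have "\<dots> \<le> matrix_norm (B \<delta> x - mat 1) * norm v"
      unfolding matrix_norm_def by (rule onorm[OF matrix_vector_mul_bounded_linear])
    also have "\<dots> \<le> c * \<delta> * norm v"
      by (rule mult_right_mono[OF le norm_ge_zero])
    finally show ?thesis .
  qed
  with c(1) show ?thesis by (rule that)
qed

lemma (in averaging) mollify_tendsto:
  fixes B :: "real \<Rightarrow> real^'d \<Rightarrow> real^'q^'q"
  assumes p: "1 \<le> p" "p < \<infinity>" and c: "0 \<le> c"
    and B: "\<And>\<delta> x v. \<delta> \<in> {0..\<delta>\<^sub>0} \<Longrightarrow> x \<in> D \<Longrightarrow> norm (B \<delta> x *v v - v) \<le> c * \<delta> * norm v"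
    and f: "f \<in> Lp_space p D"
  shows "((\<lambda>\<delta>. Lp_norm p D (\<lambda>x. mollify D k \<zeta> B \<delta> f x - f x)) \<longlongrightarrow> 0) (at 0 within {0..\<delta>\<^sub>0})"
proof -
  have lim: "((\<lambda>\<delta>. Lp_norm p D (\<lambda>x. B \<delta> x *v avg k \<zeta> \<delta> (zero_ext D f) x - zero_ext D f x)) \<longlongrightarrow> 0) (at 0 within {0..\<delta>\<^sub>0})"
    using B by (intro perturbed_avg_tendsto[OF p zero_ext_Lp_space[OF sets_D p f] c]) auto
  have eq: "Lp_norm p D (\<lambda>x. B \<delta> x *v avg k \<zeta> \<delta> (zero_ext D f) x - zero_ext D f x) =
      Lp_norm p D (\<lambda>x. mollify D k \<zeta> B \<delta> f x - f x)" if "\<delta> \<in> {0..\<delta>\<^sub>0}" for \<delta>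
    using that mollify_eq_avg[OF _ integrable_zero_ext[OF sets_D bounded_D p(1) f], of \<delta> B]
    by (intro Lp_norm_cong p) (simp add: zero_ext_def)
  have "\<forall>\<^sub>F \<delta> in at 0 within {0..\<delta>\<^sub>0}. Lp_norm p D (\<lambda>x. B \<delta> x *v avg k \<zeta> \<delta> (zero_ext D f) x - zero_ext D f x) =
      Lp_norm p D (\<lambda>x. mollify D k \<zeta> B \<delta> f x - f x)"
    unfolding eventually_at_filter by (intro always_eventually) (simp add: eq)
  then show ?thesis
    by (rule Lim_transform_eventually[OF lim])
qed

lemma (in averaging) shift_jacobian_zero: "shift_jacobian k 0 x = mat 1"
  by (simp add: shift_jacobian_eq)

section \<open>Gradient, curl and divergence of the averages\<close>

lemma adjugate3_mat_1: "adjugate3 (mat 1) = mat 1"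
  by (simp add: vec_eq_iff forall_3 adjugate3_def mat_def)

lemma norm_matrix_vector_mult_le:
  fixes A :: "real^3^3"
  assumes "\<And>i j. \<bar>A $ i $ j\<bar> \<le> b"
  shows "norm (A *v v) \<le> 9 * b * norm v"
proof -
  have "norm (A *v v) \<le> onorm ((*v) A) * norm v"
    by (rule onorm[OF matrix_vector_mul_bounded_linear])
  also have "\<dots> \<le> (real CARD(3) * real CARD(3) * b) * norm v"
    by (intro mult_right_mono onorm_le_matrix_component assms) simp
  finally show ?thesis by simp
qed

lemma abs_adjugate3_le:
  assumes "\<And>i j. \<bar>A $ i $ j\<bar> \<le> b"
  shows "\<bar>adjugate3 A $ i $ j\<bar> \<le> 2 * b\<^sup>2"
proof -
  have "\<bar>x * y - z * w\<bar> \<le> 2 * b\<^sup>2" if "\<bar>x\<bar> \<le> b" "\<bar>y\<bar> \<le> b" "\<bar>z\<bar> \<le> b" "\<bar>w\<bar> \<le> b" for x y z w :: real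
  proof -
    have "\<bar>x * y\<bar> \<le> b * b" "\<bar>z * w\<bar> \<le> b * b"
      unfolding abs_mult using that by (auto intro!: mult_mono)
    then show ?thesis by (simp add: power2_eq_square)
  qed
  then have "\<forall>i j. \<bar>adjugate3 A $ i $ j\<bar> \<le> 2 * b\<^sup>2"
    unfolding forall_3 adjugate3_def by (simp add: assms)
  then show ?thesis by blast
qed

lemma abs_det_le:
  fixes A :: "real^3^3"
  assumes "\<And>i j. \<bar>A $ i $ j\<bar> \<le> b"
  shows "\<bar>det A\<bar> \<le> 6 * b ^ 3"
proof -
  have *: "\<bar>A $ i $ j * A $ l $ m * A $ n $ q\<bar> \<le> b ^ 3" for i j l m n q
  proof -
    have "0 \<le> b" using assms abs_ge_zero order_trans by blast
    then have "\<bar>A $ i $ j\<bar> * \<bar>A $ l $ m\<bar> * \<bar>A $ n $ q\<bar> \<le> b * b * b"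
      by (intro mult_mono assms) auto
    then show ?thesis by (simp add: abs_mult power3_eq_cube)
  qed
  show ?thesis
    unfolding det_3
    using *[of 1 1 2 2 3 3] *[of 1 2 2 3 3 1] *[of 1 3 2 1 3 2] *[of 1 1 2 3 3 2] *[of 1 2 2 1 3 3] *[of 1 3 2 2 3 1]
    by linarith
qed

locale averaging3 = averaging D k \<zeta> \<delta>\<^sub>0
  for D :: "(real^3) set" and k :: "real^3 \<Rightarrow> real^3" and \<zeta> \<delta>\<^sub>0 :: real
begin

abbreviation "J \<equiv> shift_jacobian k"

lemma jacobian_estimates:
  obtains c where "0 \<le> c"
    "\<And>\<delta> x v. 0 < \<delta> \<Longrightarrow> \<delta> \<le> \<delta>\<^sub>0 \<Longrightarrow> x \<in> D \<Longrightarrow> norm (transpose (J \<delta> x) *v v - v) \<le> c * \<delta> * norm v"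
    "\<And>\<delta> x v. 0 < \<delta> \<Longrightarrow> \<delta> \<le> \<delta>\<^sub>0 \<Longrightarrow> x \<in> D \<Longrightarrow> norm (adjugate3 (J \<delta> x) *v v - v) \<le> c * \<delta> * norm v"
    "\<And>\<delta> x v. 0 < \<delta> \<Longrightarrow> \<delta> \<le> \<delta>\<^sub>0 \<Longrightarrow> x \<in> D \<Longrightarrow> norm (det (J \<delta> x) * v - v) \<le> c * \<delta> * norm v"
proof -
  define N :: "real^3 \<Rightarrow> real^3^3" where "N x = (\<chi> l i. partial_deriv i (\<lambda>x. k x $ l) x)" for x
  have "bounded ((\<lambda>x. partial_deriv i (\<lambda>x. k x $ l) x) ` closure D)" for i l
    using bounded_D by (intro compact_imp_bounded compact_continuous_image
        C1_continuous_on_partial_deriv C1_k[OF smooth_k]) (simp add: compact_closure)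
  then have "\<forall>l i. \<exists>b. \<forall>x\<in>closure D. \<bar>N x $ l $ i\<bar> \<le> b"
    by (auto simp: bounded_iff N_def)
  then obtain b' where b': "\<And>l i x. x \<in> closure D \<Longrightarrow> \<bar>N x $ l $ i\<bar> \<le> b' l i" by metis
  define b where "b = (\<Sum>l\<in>UNIV. \<Sum>i\<in>UNIV. \<bar>b' l i\<bar>)"
  have b0: "0 \<le> b" unfolding b_def by (intro sum_nonneg) auto
  have b: "\<bar>N x $ l $ i\<bar> \<le> b" if "x \<in> D" for x l i
  proof -
    have "\<bar>N x $ l $ i\<bar> \<le> \<bar>b' l i\<bar>" using b'[of x l i] that closure_subset by fastforce
    also have "\<dots> \<le> (\<Sum>i\<in>UNIV. \<bar>b' l i\<bar>)" by (rule member_le_sum) auto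
    also have "\<dots> \<le> b" unfolding b_def by (rule member_le_sum) (auto intro: sum_nonneg)
    finally show ?thesis .
  qed
  have J: "J \<delta> x = mat 1 + \<delta> *\<^sub>R N x" for \<delta> x
    by (simp add: shift_jacobian_eq N_def)
  \<comment> \<open>With entries of N bounded by b, the entries of trace times identity minus N are
    at most 3 b + b, those of the adjugate 2 b^2, its trace 6 b^2 and the determinant 6 b^3; the 9
    counts matrix entries. One c serves all three estimates, since \<delta> at most 1 absorbs the
    higher powers.\<close>
  define c where "c = 9 * (4 * b + 2 * b\<^sup>2) + (6 * b\<^sup>2 + 6 * b ^ 3)"
  have c: "0 \<le> c" "9 * b \<le> c" "9 * (4 * b + 2 * b\<^sup>2) \<le> c" "3 * b + 6 * b\<^sup>2 + 6 * b ^ 3 \<le> c"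
    using b0 by (auto simp: c_def)
  have sq: "\<delta>\<^sup>2 \<le> \<delta>" "\<delta> ^ 3 \<le> \<delta>" if "0 < \<delta>" "\<delta> \<le> \<delta>\<^sub>0" for \<delta>
    using that \<delta>\<^sub>0 power_decreasing[of 1 2 \<delta>] power_decreasing[of 1 3 \<delta>] by auto
  have tr: "\<bar>trace A\<bar> \<le> 3 * a" if "\<And>i j. \<bar>A $ i $ j\<bar> \<le> a" for A :: "real^3^3" and a
    using that[of 1 1] that[of 2 2] that[of 3 3] by (simp add: trace_def sum_3)
  show ?thesis
  proof (rule that[OF c(1)])
    fix \<delta> x v assume \<delta>: "0 < \<delta>" "\<delta> \<le> \<delta>\<^sub>0" and x: "x \<in> D"
    have "transpose (J \<delta> x) *v v - v = \<delta> *\<^sub>R (transpose (N x) *v v)"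
      by (simp add: J vec_eq_iff transpose_def matrix_vector_mult_def mat_def sum_3 forall_3 algebra_simps)
    moreover have "norm (transpose (N x) *v v) \<le> 9 * b * norm v"
      using b[OF x] by (intro norm_matrix_vector_mult_le) (simp add: transpose_def)
    moreover have "9 * b * norm v \<le> c * norm v" using c(2) by (rule mult_right_mono) simp
    ultimately show "norm (transpose (J \<delta> x) *v v - v) \<le> c * \<delta> * norm v"
      using \<delta>(1) by simp
  next
    fix \<delta> x v assume \<delta>: "0 < \<delta>" "\<delta> \<le> \<delta>\<^sub>0" and x: "x \<in> D"
    let ?A = "\<delta> *\<^sub>R (trace (N x) *\<^sub>R mat 1 - N x) + \<delta>\<^sup>2 *\<^sub>R adjugate3 (N x)"
    have "adjugate3 (J \<delta> x) *v v - v = ?A *v v"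
      unfolding J adjugate3_perturbation
      by (simp add: matrix_vector_mult_add_rdistrib)
    moreover have "norm (?A *v v) \<le> 9 * (\<delta> * (4 * b + 2 * b\<^sup>2)) * norm v"
    proof (rule norm_matrix_vector_mult_le)
      fix i j
      have "\<bar>(trace (N x) *\<^sub>R mat 1 - N x) $ i $ j\<bar> \<le> 4 * b"
        using tr[OF b[OF x]] b[OF x, of i j] b0 by (cases "i = j") (simp_all add: mat_def)
      then have "\<delta> * \<bar>(trace (N x) *\<^sub>R mat 1 - N x) $ i $ j\<bar> \<le> \<delta> * (4 * b)"
        using \<delta>(1) by (intro mult_left_mono) auto
      moreover have "\<delta>\<^sup>2 * \<bar>adjugate3 (N x) $ i $ j\<bar> \<le> \<delta> * (2 * b\<^sup>2)"
        using sq[OF \<delta>] \<delta>(1) abs_adjugate3_le[OF b[OF x]] by (intro mult_mono) auto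
      moreover have "\<bar>?A $ i $ j\<bar> \<le> \<delta> * \<bar>(trace (N x) *\<^sub>R mat 1 - N x) $ i $ j\<bar> + \<delta>\<^sup>2 * \<bar>adjugate3 (N x) $ i $ j\<bar>"
        using \<delta>(1) abs_triangle_ineq[of "\<delta> * (trace (N x) *\<^sub>R mat 1 - N x) $ i $ j" "\<delta>\<^sup>2 * adjugate3 (N x) $ i $ j"]
        by (simp add: abs_mult)
      ultimately show "\<bar>?A $ i $ j\<bar> \<le> \<delta> * (4 * b + 2 * b\<^sup>2)" by (simp add: distrib_left)
    qed
    moreover have "9 * (\<delta> * (4 * b + 2 * b\<^sup>2)) * norm v \<le> c * \<delta> * norm v"
      using mult_right_mono[OF c(3), of "\<delta> * norm v"] \<delta>(1) by (simp add: mult_ac)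
    ultimately show "norm (adjugate3 (J \<delta> x) *v v - v) \<le> c * \<delta> * norm v" by simp
  next
    fix \<delta> x and v :: real assume \<delta>: "0 < \<delta>" "\<delta> \<le> \<delta>\<^sub>0" and x: "x \<in> D"
    have "det (J \<delta> x) - 1 = \<delta> * trace (N x) + \<delta>\<^sup>2 * trace (adjugate3 (N x)) + \<delta> ^ 3 * det (N x)"
      unfolding J det_perturbation by simp
    moreover have "\<bar>\<delta> * trace (N x)\<bar> \<le> \<delta> * (3 * b)"
      using \<delta>(1) tr[OF b[OF x]] by (simp add: abs_mult)
    moreover have "\<bar>\<delta>\<^sup>2 * trace (adjugate3 (N x))\<bar> \<le> \<delta> * (3 * (2 * b\<^sup>2))"
      unfolding abs_mult using sq[OF \<delta>] \<delta>(1) tr[OF abs_adjugate3_le[OF b[OF x]]] by (intro mult_mono) auto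
    moreover have "\<bar>\<delta> ^ 3 * det (N x)\<bar> \<le> \<delta> * (6 * b ^ 3)"
      unfolding abs_mult using sq[OF \<delta>] \<delta>(1) abs_det_le[OF b[OF x]] by (intro mult_mono) auto
    ultimately have "\<bar>det (J \<delta> x) - 1\<bar> \<le> \<delta> * (3 * b + 6 * b\<^sup>2 + 6 * b ^ 3)"
      by (simp add: distrib_left)
    also have "\<dots> \<le> \<delta> * c" using \<delta>(1) c(4) by (intro mult_left_mono) auto
    finally have "\<bar>det (J \<delta> x) - 1\<bar> * norm v \<le> \<delta> * c * norm v" by (rule mult_right_mono) simp
    moreover have "det (J \<delta> x) * v - v = (det (J \<delta> x) - 1) * v" by (simp add: left_diff_distrib)
    ultimately show "norm (det (J \<delta> x) * v - v) \<le> c * \<delta> * norm v"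
      by (simp add: abs_mult mult.commute)
  qed
qed

lemma integrable_component: "integrable lebesgue u \<Longrightarrow> integrable lebesgue (\<lambda>z. u z $ i :: real)"
  by (rule integrable_bounded_linear[OF bounded_linear_vec_nth])

section \<open>Weak derivatives of the averages on D\<close>

lemma has_weak_gradient_avg:
  assumes w: "has_weak_gradient UNIV u G" and u: "integrable lebesgue u"
    and G: "G \<in> borel_measurable lebesgue" and \<delta>: "0 \<le> \<delta>"
  shows "has_weak_gradient D (avg k \<zeta> \<delta> u) (\<lambda>x. transpose (J \<delta> x) *v avg k \<zeta> \<delta> G x)"
\<comment> \<open>At \<delta> = 0 the average is u itself, which need not be differentiable; its
  weak gradient is restricted to D. Otherwise the average is continuously differentiable and its
  classical gradient is the weak one.\<close>
proof (cases "\<delta> = 0")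
  case True
  then show ?thesis
    using weak_deriv_subset[OF local_operator_divergence w[unfolded has_weak_gradient_eq] open_D] by (simp add: avg_zero[abs_def] shift_jacobian_zero transpose_mat has_weak_gradient_eq)
next
  case False
  then have pos: "0 < \<delta>" and e: "0 < \<delta> * \<zeta>" using \<delta> \<zeta> by auto
  let ?M = "conv (\<delta> * \<zeta>) u"
  have "has_weak_gradient D (\<lambda>x. ?M (shift_map k \<delta> x)) (gradient (\<lambda>x. ?M (shift_map k \<delta> x)))"
    by (rule has_weak_gradient_C1[OF C1_compose[OF C1_conv[OF e u] C1_shift_map[OF smooth_k]] open_D])
  moreover have "gradient (\<lambda>x. ?M (shift_map k \<delta> x)) = (\<lambda>x. transpose (J \<delta> x) *v avg k \<zeta> \<delta> G x)"
    by (intro ext) (simp add: gradient_shift[OF smooth_k C1_conv[OF e u]] gradient_conv[OF w e u]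
        avg_eq_conv[OF pos \<zeta> G])
  moreover have "(\<lambda>x. ?M (shift_map k \<delta> x)) = avg k \<zeta> \<delta> u"
    by (intro ext) (simp add: avg_eq_conv[OF pos \<zeta> borel_measurable_integrable[OF u]])
  ultimately show ?thesis by simp
qed

lemma has_weak_curl_avg:
  assumes w: "has_weak_curl UNIV u W" and u: "integrable lebesgue u"
    and W: "W \<in> borel_measurable lebesgue" and \<delta>: "0 \<le> \<delta>"
  shows "has_weak_curl D (\<lambda>x. transpose (J \<delta> x) *v avg k \<zeta> \<delta> u x) (\<lambda>x. adjugate3 (J \<delta> x) *v avg k \<zeta> \<delta> W x)"
proof (cases "\<delta> = 0")
  case True
  then show ?thesis
    using weak_deriv_subset[OF local_operator_curl w[unfolded has_weak_curl_eq] open_D] by (simp add: avg_zero shift_jacobian_zero transpose_mat adjugate3_mat_1 has_weak_curl_eq)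
next
  case False
  then have pos: "0 < \<delta>" and e: "0 < \<delta> * \<zeta>" using \<delta> \<zeta> by auto
  \<comment> \<open>The mollified field assembled from components, the form that
    \<open>curl_conv\<close> and the transformation formulas expect.\<close>
  define M where "M c = (\<chi> i. conv (\<delta> * \<zeta>) (\<lambda>z. u z $ i) c)" for c
  have M: "C1 (\<lambda>x. M x $ l)" for l
    using C1_conv[OF e integrable_component[OF u]] by (simp add: M_def)
  have avg_u: "avg k \<zeta> \<delta> u x = M (shift_map k \<delta> x)" for x
    using conv_component[OF locally_integrable_integrable[OF u] e]
    by (simp add: avg_eq_conv[OF pos \<zeta> borel_measurable_integrable[OF u]] M_def vec_eq_iff)
  have curl_M: "curl M (shift_map k \<delta> x) = avg k \<zeta> \<delta> W x" for x
    using curl_conv[OF w e integrable_component[OF u]]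
    by (simp add: avg_eq_conv[OF pos \<zeta> W] M_def[abs_def])
  have "has_weak_curl D (\<lambda>x. transpose (J \<delta> x) *v M (shift_map k \<delta> x))
      (curl (\<lambda>x. transpose (J \<delta> x) *v M (shift_map k \<delta> x)))"
    by (rule has_weak_curl_C1[OF C1_covariant[OF smooth_k M] open_D])
  moreover have "curl (\<lambda>x. transpose (J \<delta> x) *v M (shift_map k \<delta> x)) = (\<lambda>x. adjugate3 (J \<delta> x) *v avg k \<zeta> \<delta> W x)"
    by (intro ext) (simp only: curl_covariant[OF smooth_k M] curl_M)
  ultimately show ?thesis by (simp add: avg_u)
qed

lemma has_weak_divergence_avg:
  assumes w: "has_weak_divergence UNIV u W" and u: "integrable lebesgue u"
    and W: "W \<in> borel_measurable lebesgue" and \<delta>: "0 \<le> \<delta>"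
  shows "has_weak_divergence D (\<lambda>x. adjugate3 (J \<delta> x) *v avg k \<zeta> \<delta> u x) (\<lambda>x. det (J \<delta> x) * avg k \<zeta> \<delta> W x)"
proof (cases "\<delta> = 0")
  case True
  then show ?thesis
    using weak_deriv_subset[OF local_operator_gradient w[unfolded has_weak_divergence_eq] open_D] by (simp add: avg_zero shift_jacobian_zero adjugate3_mat_1 has_weak_divergence_eq)
next
  case False
  then have pos: "0 < \<delta>" and e: "0 < \<delta> * \<zeta>" using \<delta> \<zeta> by auto
  define M where "M c = (\<chi> i. conv (\<delta> * \<zeta>) (\<lambda>z. u z $ i) c)" for c
  have M: "C1 (\<lambda>x. M x $ l)" for l
    using C1_conv[OF e integrable_component[OF u]] by (simp add: M_def)
  have avg_u: "avg k \<zeta> \<delta> u x = M (shift_map k \<delta> x)" for x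
    using conv_component[OF locally_integrable_integrable[OF u] e]
    by (simp add: avg_eq_conv[OF pos \<zeta> borel_measurable_integrable[OF u]] M_def vec_eq_iff)
  have div_M: "divergence M (shift_map k \<delta> x) = avg k \<zeta> \<delta> W x" for x
    using divergence_conv[OF w e integrable_component[OF u]]
    by (simp add: avg_eq_conv[OF pos \<zeta> W] M_def[abs_def] divergence_def)
  have "has_weak_divergence D (\<lambda>x. adjugate3 (J \<delta> x) *v M (shift_map k \<delta> x))
      (divergence (\<lambda>x. adjugate3 (J \<delta> x) *v M (shift_map k \<delta> x)))"
    by (rule has_weak_divergence_C1[OF C1_contravariant[OF smooth_k M] open_D])
  moreover have "divergence (\<lambda>x. adjugate3 (J \<delta> x) *v M (shift_map k \<delta> x)) = (\<lambda>x. det (J \<delta> x) * avg k \<zeta> \<delta> W x)"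
    by (intro ext) (simp add: divergence_contravariant[OF smooth_k M] div_M)
  ultimately show ?thesis by (simp add: avg_u)
qed

lemma Lp_space_UNIV_measurable: "G \<in> Lp_space p UNIV \<Longrightarrow> G \<in> borel_measurable lebesgue"
  by (simp add: Lp_space_def lebesgue_on_UNIV_eq)

text \<open>One argument for gradient, curl and divergence. The witness is A applied to the average
  of F, minus F: the weak derivative of T minus that of u, the latter restricted from the whole
  space to D.\<close>

lemma weak_deriv_difference_tendsto:
  fixes F :: "real^3 \<Rightarrow> 'b::euclidean_space" and u :: "real^3 \<Rightarrow> 'c::euclidean_space"
  assumes p: "1 \<le> p" "p < \<infinity>" and F: "F \<in> Lp_space p UNIV"
    and L: "local_operator L" "weak_deriv L s UNIV (zero_ext D u) F"
    and T: "\<And>\<delta>. \<delta> \<in> {0..\<delta>\<^sub>0} \<Longrightarrow> weak_deriv L s D (T \<delta>) (\<lambda>x. A \<delta> x (avg k \<zeta> \<delta> F x))"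
    and c: "0 \<le> c" "\<And>\<delta> x v. 0 < \<delta> \<Longrightarrow> \<delta> \<le> \<delta>\<^sub>0 \<Longrightarrow> x \<in> D \<Longrightarrow> norm (A \<delta> x v - v) \<le> c * \<delta> * norm v"
  shows "\<exists>G. (\<forall>\<delta>\<in>{0..\<delta>\<^sub>0}. weak_deriv L s D (\<lambda>x. T \<delta> x - u x) (G \<delta>)) \<and>
    ((\<lambda>\<delta>. Lp_norm p D (G \<delta>)) \<longlongrightarrow> 0) (at 0 within {0..\<delta>\<^sub>0})"
proof (intro exI conjI ballI)
  show "((\<lambda>\<delta>. Lp_norm p D (\<lambda>x. A \<delta> x (avg k \<zeta> \<delta> F x) - F x)) \<longlongrightarrow> 0) (at 0 within {0..\<delta>\<^sub>0})"
    by (rule perturbed_avg_tendsto[OF p F c])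
  fix \<delta> assume "\<delta> \<in> {0..\<delta>\<^sub>0}"
  then have "weak_deriv L s D (\<lambda>x. T \<delta> x - zero_ext D u x) (\<lambda>x. A \<delta> x (avg k \<zeta> \<delta> F x) - F x)"
    by (intro weak_deriv_diff weak_deriv_subset[OF L] L(1) T open_D)
  then show "weak_deriv L s D (\<lambda>x. T \<delta> x - u x) (\<lambda>x. A \<delta> x (avg k \<zeta> \<delta> F x) - F x)"
    by (subst weak_deriv_cong[of D]) (simp_all add: zero_ext_def)
qed

lemma mollify_g_gradient_tendsto:
  assumes p: "1 \<le> p" "p < \<infinity>" and f: "f \<in> Zg_space p D"
  shows "\<exists>G. (\<forall>\<delta>\<in>{0..\<delta>\<^sub>0}. has_weak_gradient D (\<lambda>x. mollify_g D k \<zeta> \<delta> f x - f x) (G \<delta>)) \<and>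
    ((\<lambda>\<delta>. Lp_norm p D (G \<delta>)) \<longlongrightarrow> 0) (at 0 within {0..\<delta>\<^sub>0})"
proof -
  obtain G where fp: "f \<in> Lp_space p D" and G: "G \<in> Lp_space p UNIV"
    and w: "has_weak_gradient UNIV (zero_ext D f) G"
    using f by (auto simp: Zg_space_def)
  obtain c where c: "0 \<le> c"
    "\<And>\<delta> x v. 0 < \<delta> \<Longrightarrow> \<delta> \<le> \<delta>\<^sub>0 \<Longrightarrow> x \<in> D \<Longrightarrow> norm (transpose (J \<delta> x) *v v - v) \<le> c * \<delta> * norm v"
    by (rule jacobian_estimates) blast
  have "has_weak_gradient D (mollify_g D k \<zeta> \<delta> f) (\<lambda>x. transpose (J \<delta> x) *v avg k \<zeta> \<delta> G x)"
    if "\<delta> \<in> {0..\<delta>\<^sub>0}" for \<delta>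
    using has_weak_gradient_avg[OF w integrable_zero_ext[OF sets_D bounded_D p(1) fp] Lp_space_UNIV_measurable[OF G], of \<delta>] that
    by (simp add: mollify_g_eq_avg[abs_def])
  from weak_deriv_difference_tendsto[OF p G local_operator_divergence w[unfolded has_weak_gradient_eq]
      this[unfolded has_weak_gradient_eq] c]
  show ?thesis by (simp only: has_weak_gradient_eq)
qed

text \<open>The field is multiplied by the transposed Jacobian, but its curl by the adjugate, so the
  perturbation A in the limit is the adjugate.\<close>

lemma mollify_c_curl_tendsto:
  assumes p: "1 \<le> p" "p < \<infinity>" and g: "g \<in> Zc_space p D"
  shows "\<exists>w. (\<forall>\<delta>\<in>{0..\<delta>\<^sub>0}. has_weak_curl D (\<lambda>x. mollify_c D k \<zeta> \<delta> g x - g x) (w \<delta>)) \<and>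
    ((\<lambda>\<delta>. Lp_norm p D (w \<delta>)) \<longlongrightarrow> 0) (at 0 within {0..\<delta>\<^sub>0})"
proof -
  obtain W where gp: "g \<in> Lp_space p D" and W: "W \<in> Lp_space p UNIV"
    and w: "has_weak_curl UNIV (zero_ext D g) W"
    using g by (auto simp: Zc_space_def)
  note int = integrable_zero_ext[OF sets_D bounded_D p(1) gp]
  obtain c where c: "0 \<le> c"
    "\<And>\<delta> x v. 0 < \<delta> \<Longrightarrow> \<delta> \<le> \<delta>\<^sub>0 \<Longrightarrow> x \<in> D \<Longrightarrow> norm (adjugate3 (J \<delta> x) *v v - v) \<le> c * \<delta> * norm v"
    by (rule jacobian_estimates) blast
  have "has_weak_curl D (mollify_c D k \<zeta> \<delta> g) (\<lambda>x. adjugate3 (J \<delta> x) *v avg k \<zeta> \<delta> W x)"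
    if "\<delta> \<in> {0..\<delta>\<^sub>0}" for \<delta>
  proof -
    have "mollify_c D k \<zeta> \<delta> g = (\<lambda>x. transpose (J \<delta> x) *v avg k \<zeta> \<delta> (zero_ext D g) x)"
      using that by (intro ext) (simp only: mollify_c_def mollify_eq_avg[OF _ int] atLeastAtMost_iff)
    then show ?thesis
      using has_weak_curl_avg[OF w int Lp_space_UNIV_measurable[OF W], of \<delta>] that by simp
  qed
  from weak_deriv_difference_tendsto[OF p W local_operator_curl w[unfolded has_weak_curl_eq]
      this[unfolded has_weak_curl_eq] c]
  show ?thesis by (simp only: has_weak_curl_eq)
qed

text \<open>By the contravariant formula the perturbation in the limit is scalar, namely
  multiplication by the determinant.\<close>

lemma mollify_d_divergence_tendsto:
  assumes p: "1 \<le> p" "p < \<infinity>" and g: "g \<in> Zd_space p D"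
    and inv: "\<And>\<delta> x. \<delta> \<in> {0..\<delta>\<^sub>0} \<Longrightarrow> x \<in> D \<Longrightarrow> invertible (J \<delta> x)"
  shows "\<exists>w. (\<forall>\<delta>\<in>{0..\<delta>\<^sub>0}. has_weak_divergence D (\<lambda>x. mollify_d D k \<zeta> \<delta> g x - g x) (w \<delta>)) \<and>
    ((\<lambda>\<delta>. Lp_norm p D (w \<delta>)) \<longlongrightarrow> 0) (at 0 within {0..\<delta>\<^sub>0})"
proof -
  obtain W where gp: "g \<in> Lp_space p D" and W: "W \<in> Lp_space p UNIV"
    and w: "has_weak_divergence UNIV (zero_ext D g) W"
    using g by (auto simp: Zd_space_def)
  note int = integrable_zero_ext[OF sets_D bounded_D p(1) gp]
  obtain c where c: "0 \<le> c"
    "\<And>\<delta> x v. 0 < \<delta> \<Longrightarrow> \<delta> \<le> \<delta>\<^sub>0 \<Longrightarrow> x \<in> D \<Longrightarrow> norm (det (J \<delta> x) * v - v) \<le> c * \<delta> * norm v"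
    by (rule jacobian_estimates) blast
  have "weak_deriv gradient (-1) D (mollify_d D k \<zeta> \<delta> g) (\<lambda>x. det (J \<delta> x) * avg k \<zeta> \<delta> W x)"
    if "\<delta> \<in> {0..\<delta>\<^sub>0}" for \<delta>
    using that has_weak_divergence_avg[OF w int Lp_space_UNIV_measurable[OF W], of \<delta>]
    \<comment> \<open>Invertibility is known on D only, so determinant times inverse is exchanged
      for the adjugate pointwise on D and not as an identity of functions.\<close>
    by (subst weak_deriv_cong[where v = "\<lambda>x. adjugate3 (J \<delta> x) *v avg k \<zeta> \<delta> (zero_ext D g) x"])
      (auto simp: mollify_d_def mollify_eq_avg[OF _ int] det_matrix_inv_eq_adjugate3[OF inv]
        has_weak_divergence_eq)
  from weak_deriv_difference_tendsto[OF p W local_operator_gradient w[unfolded has_weak_divergence_eq] this c]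
  show ?thesis by (simp only: has_weak_divergence_eq)
qed

end

text \<open>Weak derivatives are determined almost everywhere, so the norms in the last three limits
  do not depend on the choice of G and w. The limit at 0 within \<open>{0..\<delta>\<^sub>0}\<close>
  is the one from the right.\<close>

theorem theorem4p4:
  shows
    "(\<forall>(D :: (real^'d) set) xD rD Out k \<zeta> \<delta>\<^sub>0 (B :: real \<Rightarrow> real^'d \<Rightarrow> real^'q^'q).
        mollification_setting D xD rD Out k \<zeta> \<delta>\<^sub>0 \<and> admissible_fields D B \<longrightarrow>
          (\<forall>p. 1 \<le> p \<longrightarrow>
             (\<exists>C. \<forall>\<delta>\<in>{0..\<delta>\<^sub>0}. Lp_operator_bound p D (mollify D k \<zeta> B \<delta>) C)) \<and>
          (\<forall>p. 1 \<le> p \<and> p < \<infinity> \<longrightarrow>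
             (\<forall>f\<in>Lp_space p D.
                ((\<lambda>\<delta>. Lp_norm p D (\<lambda>x. mollify D k \<zeta> B \<delta> f x - f x)) \<longlongrightarrow> 0)
                  (at 0 within {0..\<delta>\<^sub>0}))))
     \<and>
     (\<forall>(D :: (real^3) set) xD rD Out k \<zeta> \<delta>\<^sub>0.
        mollification_setting D xD rD Out k \<zeta> \<delta>\<^sub>0 \<longrightarrow>
          (\<forall>p. 1 \<le> p \<and> p < \<infinity> \<longrightarrow>
             (\<forall>f\<in>Zg_space p D. \<exists>G.
                (\<forall>\<delta>\<in>{0..\<delta>\<^sub>0}. has_weak_gradient D (\<lambda>x. mollify_g D k \<zeta> \<delta> f x - f x) (G \<delta>)) \<and>
                ((\<lambda>\<delta>. Lp_norm p D (G \<delta>)) \<longlongrightarrow> 0) (at 0 within {0..\<delta>\<^sub>0})) \<and>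
             (\<forall>g\<in>Zc_space p D. \<exists>w.
                (\<forall>\<delta>\<in>{0..\<delta>\<^sub>0}. has_weak_curl D (\<lambda>x. mollify_c D k \<zeta> \<delta> g x - g x) (w \<delta>)) \<and>
                ((\<lambda>\<delta>. Lp_norm p D (w \<delta>)) \<longlongrightarrow> 0) (at 0 within {0..\<delta>\<^sub>0})) \<and>
             (\<forall>g\<in>Zd_space p D. \<exists>w.
                (\<forall>\<delta>\<in>{0..\<delta>\<^sub>0}. has_weak_divergence D (\<lambda>x. mollify_d D k \<zeta> \<delta> g x - g x) (w \<delta>)) \<and>
                ((\<lambda>\<delta>. Lp_norm p D (w \<delta>)) \<longlongrightarrow> 0) (at 0 within {0..\<delta>\<^sub>0}))))"
proof (intro conjI allI impI)
  fix D :: "(real^'d) set" and xD rD Out k \<zeta> \<delta>\<^sub>0 and B :: "real \<Rightarrow> real^'d \<Rightarrow> real^'q^'q"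
  assume *: "mollification_setting D xD rD Out k \<zeta> \<delta>\<^sub>0 \<and> admissible_fields D B"
  interpret averaging D k \<zeta> \<delta>\<^sub>0
    by (rule mollification_setting_averaging[OF conjunct1[OF *]])
  obtain c where c: "0 \<le> c"
    "\<And>\<delta> x v. \<delta> \<in> {0..1} \<Longrightarrow> x \<in> D \<Longrightarrow> norm (B \<delta> x *v v - v) \<le> c * \<delta> * norm v"
    using * admissible_fieldsE by blast
  have \<delta>_le: "\<delta> \<in> {0..1}" if "\<delta> \<in> {0..\<delta>\<^sub>0}" for \<delta> using that \<delta>\<^sub>0 by simp
  have B: "norm (B \<delta> x *v v - v) \<le> c * \<delta> * norm v" if "\<delta> \<in> {0..\<delta>\<^sub>0}" "x \<in> D" for \<delta> x v
    by (rule c(2)[OF \<delta>_le[OF that(1)] that(2)])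
  have cont: "continuous_on D (B \<delta>)" if "\<delta> \<in> {0..\<delta>\<^sub>0}" for \<delta>
    using * \<delta>_le[OF that] by (auto simp: admissible_fields_def intro: smooth_on_continuous_on)
  show "\<exists>C. \<forall>\<delta>\<in>{0..\<delta>\<^sub>0}. Lp_operator_bound p D (mollify D k \<zeta> B \<delta>) C" if "1 \<le> p" for p
    by (rule mollify_operator_bound[OF that c(1) cont B])
  show "\<forall>f\<in>Lp_space p D. ((\<lambda>\<delta>. Lp_norm p D (\<lambda>x. mollify D k \<zeta> B \<delta> f x - f x)) \<longlongrightarrow> 0)
      (at 0 within {0..\<delta>\<^sub>0})" if "1 \<le> p \<and> p < \<infinity>" for p
    using that by (intro ballI mollify_tendsto[OF _ _ c(1) B]) auto
next
  fix D :: "(real^3) set" and xD rD Out k \<zeta> \<delta>\<^sub>0 and p :: ennreal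
  assume *: "mollification_setting D xD rD Out k \<zeta> \<delta>\<^sub>0" and p: "1 \<le> p \<and> p < \<infinity>"
  interpret averaging3 D k \<zeta> \<delta>\<^sub>0
    using mollification_setting_averaging[OF *] by (rule averaging3.intro)
  have inv: "invertible (shift_jacobian k \<delta> x)" if "\<delta> \<in> {0..\<delta>\<^sub>0}" "x \<in> D" for \<delta> x
    using * that unfolding mollification_setting_def by blast
  show "\<forall>f\<in>Zg_space p D. \<exists>G.
      (\<forall>\<delta>\<in>{0..\<delta>\<^sub>0}. has_weak_gradient D (\<lambda>x. mollify_g D k \<zeta> \<delta> f x - f x) (G \<delta>)) \<and>
      ((\<lambda>\<delta>. Lp_norm p D (G \<delta>)) \<longlongrightarrow> 0) (at 0 within {0..\<delta>\<^sub>0})"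
    using p mollify_g_gradient_tendsto by blast
  show "\<forall>g\<in>Zc_space p D. \<exists>w.
      (\<forall>\<delta>\<in>{0..\<delta>\<^sub>0}. has_weak_curl D (\<lambda>x. mollify_c D k \<zeta> \<delta> g x - g x) (w \<delta>)) \<and>
      ((\<lambda>\<delta>. Lp_norm p D (w \<delta>)) \<longlongrightarrow> 0) (at 0 within {0..\<delta>\<^sub>0})"
    using p mollify_c_curl_tendsto by blast
  show "\<forall>g\<in>Zd_space p D. \<exists>w.
      (\<forall>\<delta>\<in>{0..\<delta>\<^sub>0}. has_weak_divergence D (\<lambda>x. mollify_d D k \<zeta> \<delta> g x - g x) (w \<delta>)) \<and>
      ((\<lambda>\<delta>. Lp_norm p D (w \<delta>)) \<longlongrightarrow> 0) (at 0 within {0..\<delta>\<^sub>0})"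
    using p mollify_d_divergence_tendsto inv by blast
qed

end
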